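(* Let $p\ge 2$, $n\ge 1$, and let $u\in C^{2,1}(Q)$, $Q:=\mathbb{R}^n\times(-\infty,0)$, be a classical solution of $$u_t-\Delta u=|\nabla u|^p\quad\text{in } Q.$$ Assume that there exists $t_0\in(-\infty,0)$ such that $u(x,t_0)\le o(|x|)$ as $|x|\to\infty$, i.e. for every $\varepsilon>0$ there is $R>0$ with $u(x,t_0)\le \varepsilon|x|$ for all $|x|\ge R$. Then $u$ is constant on $Q$.
   Context: No lower growth bound on $u$ is assumed; the hypothesis concerns only the single time $t_0$. *)

theory Defs
  imports "HOL-Analysis.Analysis"
begin

definition Qdom :: "('a::euclidean_space \<times> real) set" where
  "Qdom = UNIV \<times> {..<0}"

definition classical_solution :: "real \<Rightarrow> ('a::euclidean_space \<Rightarrow> real \<Rightarrow> real) \<Rightarrow> bool" where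
  "classical_solution p u \<longleftrightarrow>
     (\<exists>(ut :: 'a \<Rightarrow> real \<Rightarrow> real) (g :: 'a \<Rightarrow> real \<Rightarrow> 'a) (H :: 'a \<Rightarrow> real \<Rightarrow> 'a \<Rightarrow> 'a).
        (\<forall>x t. t < 0 \<longrightarrow>
            ((\<lambda>s. u x s) has_real_derivative ut x t) (at t)
          \<and> ((\<lambda>y. u y t) has_derivative (\<lambda>h. g x t \<bullet> h)) (at x)
          \<and> ((\<lambda>y. g y t) has_derivative H x t) (at x))
      \<and> continuous_on Qdom (\<lambda>z. u (fst z) (snd z))
      \<and> continuous_on Qdom (\<lambda>z. ut (fst z) (snd z))
      \<and> continuous_on Qdom (\<lambda>z. g (fst z) (snd z))
      \<and> (\<forall>i\<in>Basis. \<forall>j\<in>Basis. continuous_on Qdom (\<lambda>z. H (fst z) (snd z) i \<bullet> j))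
      \<and> (\<forall>x t. t < 0 \<longrightarrow>
            ut x t - (\<Sum>i\<in>Basis. H x t i \<bullet> i) = norm (g x t) powr p))"

end

theory Submission
  imports Defs "HOL-Real_Asymp.Real_Asymp"
begin

text \<open>
  Let \<open>q = p/(p-1)\<close>.  Radial barriers (for \<open>p > 2\<close>), respectively the heat equation for
  \<open>exp u\<close> (for \<open>p = 2\<close>), give the Harnack inequality
  \<open>u(y,s) \<le> u(x,t) + C (|x-y|^2 + (t-s))^(q/2) (t-s)^(1-q)\<close> for \<open>s < t < 0\<close>.
  It carries the sublinear upper bound at \<open>t0\<close> back to all earlier times, and, letting
  \<open>s \<rightarrow> -\<infinity>\<close>, it shows that the negative part of \<open>u(\<cdot>,t)\<close> is \<open>o(|x|^q)\<close>.

  To compare \<open>u(y,s)\<close> with \<open>u(y+h,s)\<close>, start at time \<open>s-T\<close> and let the second point drift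
  from \<open>y\<close> to \<open>y+h\<close> at speed \<open>|h|/T\<close>.  Multiplying the first function by \<open>1+\<Lambda>/T\<close> makes the
  convexity of \<open>|\<xi>|^p\<close> strict enough to absorb the drift, so the maximum principle applies; as
  \<open>T \<rightarrow> \<infinity>\<close> and then \<open>\<Lambda> \<rightarrow> \<infinity>\<close> the defect vanishes.  Thus \<open>u\<close> is constant for \<open>t \<le> t0\<close>.

  Harnack also bounds \<open>u\<close> by \<open>O(|x|^q)\<close> locally uniformly in time, and a barrier of that growth
  keeps a solution that is constant at time \<open>t'\<close> bounded above for a time step independent of
  \<open>t'\<close>.  The first part then applies at the later time, and iteration reaches \<open>t = 0\<close>.
\<close>

subsection \<open>Parabolic maximum principle\<close>

text \<open>The growth threshold is sharp: u(x,t) = a \<bullet> x + |a|^p t solves the equation for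
  every vector a. The argument must therefore distinguish \<epsilon>|x| from linear growth. It does
  so in the defect of the translation argument, which consists of a multiple of \<Lambda>
  \<epsilon>^p and a multiple of |h|^q \<Lambda>^(-1/(p-1)); \<epsilon> tends to 0 before \<Lambda>
  tends to infinity.

  The exponent q is dictated by (q-1) p = q: the p-th power of the gradient of |x|^q is again a
  multiple of |x|^q, so profiles of this growth close up under the equation.

  The obstacle is that nothing bounds u from below, so comparison on a ball has no lateral data.
  Lower barriers that blow up on the lateral boundary (p > 2), or the positivity of
  \<open>exp u\<close> (p = 2), make up for this in the Harnack inequality; only afterwards can
  translates be compared on large balls. The case p = 2 is separate because the constant
  \<open>L\<close> of the power barrier contains 1/(1 - q/2), which is infinite for q = 2.\<close>

lemma second_derivative_nonpos_at_max:
  fixes f :: "'a::euclidean_space \<Rightarrow> real"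
  assumes "open S" "x \<in> S"
    and max: "\<And>y. y \<in> S \<Longrightarrow> f y \<le> f x"
    and df: "\<And>y. y \<in> S \<Longrightarrow> (f has_derivative (\<lambda>h. g y \<bullet> h)) (at y)"
    and dg: "(g has_derivative H) (at x)"
  shows "g x = 0" "H i \<bullet> i \<le> 0"
proof -
  have "(\<lambda>h. g x \<bullet> h) = (\<lambda>v. 0)"
    using differential_zero_maxmin[OF \<open>x \<in> S\<close> \<open>open S\<close> df[OF \<open>x \<in> S\<close>]] max by blast
  then have "g x \<bullet> g x = 0" by (rule fun_cong)
  then show gx: "g x = 0" by simp
  show "H i \<bullet> i \<le> 0"
  proof (rule ccontr)
    assume "\<not> H i \<bullet> i \<le> 0"
    then have pos: "0 < H i \<bullet> i" by simp
    \<comment> \<open>The slope of f along the ray in direction i. It vanishes at 0 and has positive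
      derivative there, so it is positive just to the right, and the mean value theorem makes f
      exceed its maximum.\<close>
    define \<psi> where "\<psi> s = g (x + s *\<^sub>R i) \<bullet> i" for s
    have d0: "((\<lambda>s. x + s *\<^sub>R i) has_derivative (\<lambda>s. s *\<^sub>R i)) (at s)" for s
      by (auto intro!: derivative_eq_intros)
    have "((\<lambda>s. g (x + s *\<^sub>R i)) has_derivative (\<lambda>s. H (s *\<^sub>R i))) (at 0)"
      by (rule has_derivative_compose[OF d0]) (use dg in simp)
    then have "(\<psi> has_derivative (\<lambda>s. H (s *\<^sub>R i) \<bullet> i)) (at 0)"
      unfolding \<psi>_def by (rule has_derivative_inner_left)
    moreover have "(\<lambda>s. H (s *\<^sub>R i) \<bullet> i) = (*) (H i \<bullet> i)"
      using has_derivative_linear[OF dg] by (auto simp: linear_cmul)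
    ultimately have "(\<psi> has_real_derivative H i \<bullet> i) (at 0)"
      by (simp add: has_field_derivative_def)
    from DERIV_pos_inc_right[OF this pos] obtain d where d: "d > 0"
      and inc: "\<And>h. h > 0 \<Longrightarrow> h < d \<Longrightarrow> \<psi> 0 < \<psi> (0 + h)" by auto
    have \<psi>0: "\<psi> 0 = 0" by (simp add: \<psi>_def gx)
    from assms(1,2) obtain e where e: "e > 0" "ball x e \<subseteq> S"
      by (meson openE)
    define h where "h = min (d/2) (e / (2 * (1 + norm i)))"
    have h: "0 < h" "h < d" using d e by (auto simp: h_def add_pos_nonneg)
    have ins: "x + s *\<^sub>R i \<in> S" if "0 \<le> s" "s \<le> h" for s
    proof -
      have "s * norm i \<le> h * norm i" using that by (simp add: mult_right_mono)
      also have "\<dots> \<le> e / (2 * (1 + norm i)) * norm i"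
        by (intro mult_right_mono) (auto simp: h_def)
      also have "\<dots> < e" using e by (simp add: field_simps add_pos_nonneg)
          (smt (verit, best) norm_ge_zero mult_nonneg_nonneg)
      finally show ?thesis using that e by (auto simp: dist_norm)
    qed
    have dd: "((\<lambda>s. f (x + s *\<^sub>R i)) has_real_derivative \<psi> s) (at s)" if "0 \<le> s" "s \<le> h" for s
    proof -
      have "((\<lambda>s. f (x + s *\<^sub>R i)) has_derivative (\<lambda>t. g (x + s *\<^sub>R i) \<bullet> (t *\<^sub>R i))) (at s)"
        by (rule has_derivative_compose[OF d0 df[OF ins[OF that]]])
      moreover have "(\<lambda>t. g (x + s *\<^sub>R i) \<bullet> (t *\<^sub>R i)) = (*) (\<psi> s)" by (auto simp: \<psi>_def)
      ultimately show ?thesis by (simp add: has_field_derivative_def)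
    qed
    obtain z where z: "z > 0" "z < h"
      "f (x + h *\<^sub>R i) - f (x + 0 *\<^sub>R i) = (h - 0) * \<psi> z"
      using MVT2[OF h(1), of "\<lambda>s. f (x + s *\<^sub>R i)" \<psi>] dd by auto
    have "\<psi> z > 0" using inc[of z] z h \<psi>0 by simp
    then have "f (x + h *\<^sub>R i) > f x" using z(3) h(1) by (simp add: mult_pos_pos)
       (smt (verit) mult_pos_pos)
    with max[OF ins[of h]] h show False by simp
  qed
qed

text \<open>The hypothesis \<open>strict\<close> is posed only at a positive maximum, where the
  gradient vanishes. When f is a difference of solutions or barriers, this ties their gradients
  together and can be fed into the nonlinear term. One lemma thus serves linear, nonlinear and
  two-point comparisons.\<close>

lemma parabolic_max_principle:
  fixes f :: "'a::euclidean_space \<Rightarrow> real \<Rightarrow> real"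
  assumes cont: "continuous_on (cball c R \<times> {a..b}) (\<lambda>z. f (fst z) (snd z))"
    and dt: "\<And>x t. x \<in> ball c R \<Longrightarrow> a < t \<Longrightarrow> t \<le> b \<Longrightarrow> ((\<lambda>s. f x s) has_real_derivative ft x t) (at t)"
    and dx: "\<And>x t. x \<in> ball c R \<Longrightarrow> a < t \<Longrightarrow> t \<le> b \<Longrightarrow> ((\<lambda>y. f y t) has_derivative (\<lambda>h. g x t \<bullet> h)) (at x)"
    and dxx: "\<And>x t. x \<in> ball c R \<Longrightarrow> a < t \<Longrightarrow> t \<le> b \<Longrightarrow> ((\<lambda>y. g y t) has_derivative H x t) (at x)"
    and strict: "\<And>x t. \<lbrakk>x \<in> ball c R; a < t; t \<le> b; f x t > 0; g x t = 0;
        (\<Sum>i\<in>Basis. H x t i \<bullet> i) \<le> 0; 0 \<le> ft x t\<rbrakk> \<Longrightarrow> False"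
    and init: "\<And>x. x \<in> cball c R \<Longrightarrow> f x a \<le> 0"
    and lat: "\<And>x t. dist c x = R \<Longrightarrow> a \<le> t \<Longrightarrow> t \<le> b \<Longrightarrow> f x t \<le> 0"
    and "x \<in> cball c R" "a \<le> t" "t \<le> b"
  shows "f x t \<le> 0"
proof (rule ccontr)
  assume neg: "\<not> f x t \<le> 0"
  let ?K = "cball c R \<times> {a..b}"
  have "compact ?K" by (intro compact_Times) auto
  moreover have "(x, t) \<in> ?K" using assms(8-10) by auto
  ultimately obtain z where z: "z \<in> ?K" and zmax: "\<And>w. w \<in> ?K \<Longrightarrow> f (fst w) (snd w) \<le> f (fst z) (snd z)"
    using continuous_attains_sup[OF _ _ cont] by (metis empty_iff)
  obtain x0 \<tau> where zz: "z = (x0, \<tau>)" by (cases z)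
  have K: "dist c x0 \<le> R" "a \<le> \<tau>" "\<tau> \<le> b" using z zz by auto
  have max: "f w s \<le> f x0 \<tau>" if "dist c w \<le> R" "a \<le> s" "s \<le> b" for w s
    using zmax[of "(w,s)"] that zz by auto
  have pos: "f x0 \<tau> > 0" using max[of x t] neg assms(8-10) by simp
  have "\<tau> \<noteq> a" using pos init[of x0] K by force
  then have \<tau>: "a < \<tau>" using K by simp
  have "dist c x0 \<noteq> R" using pos lat[of x0 \<tau>] K by force
  then have x0: "x0 \<in> ball c R" using K by simp
  note sd = second_derivative_nonpos_at_max[OF open_ball x0, of "\<lambda>y. f y \<tau>" "\<lambda>y. g y \<tau>" "H x0 \<tau>"]
  have g0: "g x0 \<tau> = 0"
    by (rule sd(1)) (use max K dx dxx \<tau> x0 in auto)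
  have H0: "H x0 \<tau> i \<bullet> i \<le> 0" for i
    by (rule sd(2)) (use max K dx dxx \<tau> x0 in auto)
  have "0 \<le> ft x0 \<tau>"
  proof (rule ccontr)
    assume "\<not> 0 \<le> ft x0 \<tau>"
    then have "ft x0 \<tau> < 0" by simp
    from DERIV_neg_dec_left[OF dt[OF x0 \<tau> K(3)] this] obtain d where d: "d > 0"
      and dec: "\<And>h. h > 0 \<Longrightarrow> h < d \<Longrightarrow> f x0 \<tau> < f x0 (\<tau> - h)" by auto
    \<comment> \<open>The maximum may lie on the final slice \<tau> = b, so a negative time
      derivative is refuted by stepping back in time, but not below a.\<close>
    define h where "h = min (d/2) (\<tau> - a)"
    have "h > 0" "h < d" "h \<le> \<tau> - a" using d \<tau> by (auto simp: h_def)
    with dec[of h] max[of x0 "\<tau> - h"] K show False by simp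
  qed
  with strict[OF x0 \<tau> K(3) pos g0] H0 show False by (simp add: sum_nonpos)
qed

text \<open>Radial functions are taken as functions of r = |x - c|^2 rather than of |x - c|: they
  are then differentiable at the centre, and a barrier needs only one-variable derivatives in
  r.\<close>

lemma radial_has_derivative:
  fixes c :: "'a::euclidean_space"
  assumes "(G has_real_derivative G' ((norm (x - c))\<^sup>2)) (at ((norm (x - c))\<^sup>2))"
  shows "((\<lambda>y. G ((norm (y - c))\<^sup>2)) has_derivative (\<lambda>h. ((2 * G' ((norm (x - c))\<^sup>2)) *\<^sub>R (x - c)) \<bullet> h)) (at x)"
proof -
  have *: "((\<lambda>y. (norm (y - c))\<^sup>2) has_derivative (\<lambda>h. 2 * ((x - c) \<bullet> h))) (at x)"
    unfolding power2_norm_eq_inner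
    by (auto intro!: derivative_eq_intros simp: inner_commute)
  have "((\<lambda>y. G ((norm (y - c))\<^sup>2)) has_derivative (\<lambda>h. G' ((norm (x - c))\<^sup>2) * (2 * ((x - c) \<bullet> h)))) (at x)"
    using has_derivative_compose[OF *] assms by (simp add: has_field_derivative_def)
  then show ?thesis by (simp add: mult.assoc mult.left_commute)
qed

lemma radial_gradient_has_derivative:
  fixes c :: "'a::euclidean_space"
  assumes "(G' has_real_derivative G'' ((norm (x - c))\<^sup>2)) (at ((norm (x - c))\<^sup>2))"
  shows "((\<lambda>y. (2 * G' ((norm (y - c))\<^sup>2)) *\<^sub>R (y - c)) has_derivative
     (\<lambda>h. (2 * G' ((norm (x - c))\<^sup>2)) *\<^sub>R h + (4 * G'' ((norm (x - c))\<^sup>2) * ((x - c) \<bullet> h)) *\<^sub>R (x - c))) (at x)"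
  by (rule derivative_eq_intros radial_has_derivative[where G' = G''] assms refl)+
     (auto simp: algebra_simps)

text \<open>The trace of the Hessian found in \<open>radial_gradient_has_derivative\<close>, with a
  = G' and b = G''.\<close>

lemma radial_laplacian:
  fixes x c :: "'a::euclidean_space"
  shows "(\<Sum>i\<in>Basis. ((2 * a) *\<^sub>R i + (4 * b * ((x - c) \<bullet> i)) *\<^sub>R (x - c)) \<bullet> i)
     = 2 * real DIM('a) * a + 4 * (norm (x - c))\<^sup>2 * b"
proof -
  have "(\<Sum>i\<in>Basis. ((2 * a) *\<^sub>R i + (4 * b * ((x - c) \<bullet> i)) *\<^sub>R (x - c)) \<bullet> i)
     = (\<Sum>i\<in>(Basis::'a set). 2 * a + 4 * b * ((x - c) \<bullet> i)\<^sup>2)"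
    by (intro sum.cong refl) (simp add: inner_add_left power2_eq_square del: inner_diff_left)
  also have "\<dots> = 2 * real DIM('a) * a + 4 * b * (\<Sum>i\<in>Basis. ((x - c) \<bullet> i)\<^sup>2)"
    by (simp add: sum.distrib sum_distrib_left)
  also have "(\<Sum>i\<in>Basis. ((x - c) \<bullet> i)\<^sup>2) = (norm (x - c))\<^sup>2"
    unfolding power2_norm_eq_inner by (subst euclidean_inner) (simp add: power2_eq_square)
  finally show ?thesis by simp
qed

subsection \<open>Classical solutions and radial barriers\<close>

text \<open>Regularity separated from the equation, so that both u and \<open>exp u\<close> can
  instantiate it.\<close>

locale C21 =
  fixes u :: "'a::euclidean_space \<Rightarrow> real \<Rightarrow> real" and ut g H
  assumes u_t: "t < 0 \<Longrightarrow> ((\<lambda>s. u x s) has_real_derivative ut x t) (at t)"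
    and u_x: "t < 0 \<Longrightarrow> ((\<lambda>y. u y t) has_derivative (\<lambda>h. g x t \<bullet> h)) (at x)"
    and u_xx: "t < 0 \<Longrightarrow> ((\<lambda>y. g y t) has_derivative H x t) (at x)"
    and u_cont: "continuous_on Qdom (\<lambda>z. u (fst z) (snd z))"
    and ut_cont: "continuous_on Qdom (\<lambda>z. ut (fst z) (snd z))"
begin

lemma continuous_on_u [continuous_intros]:
  assumes "continuous_on S \<alpha>" "continuous_on S \<beta>" "\<And>z. z \<in> S \<Longrightarrow> \<beta> z < 0"
  shows "continuous_on S (\<lambda>z. u (\<alpha> z) (\<beta> z))"
proof -
  have "continuous_on S (\<lambda>z. (\<alpha> z, \<beta> z))" by (intro continuous_intros assms)
  from continuous_on_compose2[OF u_cont this] assms(3) show ?thesis by (auto simp: Qdom_def)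
qed

text \<open>The regularity hypotheses give separate partial derivatives. Continuity of
  \<open>ut\<close> upgrades them to joint differentiability, which the chain rule along a moving
  point requires; both two-point comparisons below rely on it.\<close>

lemma u_path:
  assumes "t < 0" "(\<gamma> has_vector_derivative v) (at t)"
  shows "((\<lambda>s. u (\<gamma> s) s) has_real_derivative ut (\<gamma> t) t + g (\<gamma> t) t \<bullet> v) (at t)"
proof -
  have ut_isCont: "continuous (at (z::'a \<times> real)) (\<lambda>z. ut (fst z) (snd z))" if "z \<in> UNIV \<times> {..<0}" for z
  proof -
    have "open (UNIV \<times> {..<0::real} :: ('a \<times> real) set)" by (intro open_Times) auto
    from continuous_on_eq_continuous_at[OF this] that ut_cont show ?thesis
      unfolding Qdom_def by blast
  qed
  have lim: "((\<lambda>(x, y). ut x y *\<^sub>R id_blinfun) \<longlongrightarrow> ut (\<gamma> t) t *\<^sub>R id_blinfun) (at (\<gamma> t, t) within UNIV \<times> {..<0})"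
    proof -
      have "((\<lambda>z. ut (fst z) (snd z)) \<longlongrightarrow> ut (\<gamma> t) t) (at (\<gamma> t, t) within UNIV \<times> {..<0})"
        using ut_isCont[of "(\<gamma> t, t)"] assms(1) tendsto_within_subset[OF _ subset_UNIV]
        unfolding continuous_at by fastforce
      then show ?thesis unfolding case_prod_beta by (intro tendsto_intros)
    qed
  have *: "((\<lambda>(x,s). u x s) has_derivative
     (\<lambda>(tx, ty). g (\<gamma> t) t \<bullet> tx + blinfun_apply (ut (\<gamma> t) t *\<^sub>R id_blinfun) ty)) (at (\<gamma> t, t) within UNIV \<times> {..<0})"
  proof (rule has_derivative_partialsI[where fy = "\<lambda>x s. ut x s *\<^sub>R id_blinfun"])
    show "((\<lambda>x. u x t) has_derivative (\<bullet>) (g (\<gamma> t) t)) (at (\<gamma> t) within UNIV)"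
      using u_x[OF assms(1)] by simp
    show "(u x has_derivative blinfun_apply (ut x s *\<^sub>R id_blinfun)) (at s within {..<0})" if "s \<in> {..<0}" for x s
    proof -
      have "(u x has_derivative (*) (ut x s)) (at s)" using u_t[of s x] that by (simp add: has_field_derivative_def)
      moreover have "blinfun_apply (ut x s *\<^sub>R id_blinfun) = (*) (ut x s)"
        by (rule ext) (simp add: blinfun.scaleR_left)
      ultimately show ?thesis by (metis has_derivative_at_withinI)
    qed
  qed (use assms lim in \<open>auto simp: continuous_within\<close>)
  have op: "open (UNIV \<times> {..<0::real} :: ('a \<times> real) set)" by (intro open_Times) auto
  have "(\<gamma> t, t) \<in> UNIV \<times> {..<0}" using assms by auto
  then have D: "((\<lambda>(x,s). u x s) has_derivative
     (\<lambda>(tx, ty). g (\<gamma> t) t \<bullet> tx + ut (\<gamma> t) t * ty)) (at (\<gamma> t, t))"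
    using * at_within_open[OF _ op, of "(\<gamma> t, t)"] by (simp add: blinfun.scaleR_left)
  have "((\<lambda>s. (\<gamma> s, s)) has_derivative (\<lambda>s. (s *\<^sub>R v, s))) (at t)"
    using assms(2) unfolding has_vector_derivative_def by (auto intro!: derivative_eq_intros)
  from has_derivative_compose[OF this D]
  have "((\<lambda>s. u (\<gamma> s) s) has_derivative (\<lambda>s. g (\<gamma> t) t \<bullet> (s *\<^sub>R v) + ut (\<gamma> t) t * s)) (at t)" by simp
  moreover have "(\<lambda>s. g (\<gamma> t) t \<bullet> (s *\<^sub>R v) + ut (\<gamma> t) t * s) = (*) (ut (\<gamma> t) t + g (\<gamma> t) t \<bullet> v)"
    by (auto simp: algebra_simps)
  ultimately show ?thesis by (simp add: has_field_derivative_def)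
qed

end

lemma continuous_on_radial:
  fixes c :: "'a::euclidean_space"
  assumes "continuous_on ({0..R\<^sup>2} \<times> T) (\<lambda>z. G (fst z) (snd z))"
  shows "continuous_on (cball c R \<times> T) (\<lambda>z. G ((norm (fst z - c))\<^sup>2) (snd z))"
proof -
  have "continuous_on (cball c R \<times> T) (\<lambda>z. ((norm (fst z - c))\<^sup>2, snd z))"
    by (intro continuous_intros)
  from continuous_on_compose2[OF assms this] show ?thesis
    by (force simp: dist_norm norm_minus_commute intro: power_mono)
qed

locale hamilton_jacobi = C21 u ut g H for u :: "'a::euclidean_space \<Rightarrow> real \<Rightarrow> real" and ut g H +
  fixes p :: real
  assumes p: "2 \<le> p"
    and eq: "t < 0 \<Longrightarrow> ut x t = (\<Sum>i\<in>Basis. H x t i \<bullet> i) + norm (g x t) powr p"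
begin

text \<open>With r = |x - c|^2, \<open>2 * \<bar>Gr r t\<bar> * sqrt r\<close> is the length of the
  gradient of G, and \<open>strict\<close> says that C - G is a strict subsolution. At the critical
  point u has the gradient of the barrier, so the nonlinear terms cancel. The gradient term helps
  here: it can offset a positive Laplacian of G.\<close>

lemma lower_barrier:
  assumes b: "b < 0"
    and contG: "continuous_on ({0..R\<^sup>2} \<times> {a..b}) (\<lambda>z. G (fst z) (snd z))"
    and Gt: "\<And>r t. 0 \<le> r \<Longrightarrow> r < R\<^sup>2 \<Longrightarrow> a < t \<Longrightarrow> t \<le> b \<Longrightarrow> ((\<lambda>s. G r s) has_real_derivative Gt r t) (at t)"
    and Gr: "\<And>r t. 0 \<le> r \<Longrightarrow> r < R\<^sup>2 \<Longrightarrow> a < t \<Longrightarrow> t \<le> b \<Longrightarrow> ((\<lambda>r. G r t) has_real_derivative Gr r t) (at r)"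
    and Grr: "\<And>r t. 0 \<le> r \<Longrightarrow> r < R\<^sup>2 \<Longrightarrow> a < t \<Longrightarrow> t \<le> b \<Longrightarrow> ((\<lambda>r. Gr r t) has_real_derivative Grr r t) (at r)"
    and strict: "\<And>r t. 0 \<le> r \<Longrightarrow> r < R\<^sup>2 \<Longrightarrow> a < t \<Longrightarrow> t \<le> b \<Longrightarrow>
       2 * real DIM('a) * Gr r t + 4 * r * Grr r t < Gt r t + (2 * \<bar>Gr r t\<bar> * sqrt r) powr p"
    and init: "\<And>x. norm (x - c) \<le> R \<Longrightarrow> C - G ((norm (x - c))\<^sup>2) a \<le> u x a"
    and lat: "\<And>x t. norm (x - c) = R \<Longrightarrow> a \<le> t \<Longrightarrow> t \<le> b \<Longrightarrow> C - G (R\<^sup>2) t \<le> u x t"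
    and x: "norm (x - c) \<le> R" "a \<le> t" "t \<le> b"
  shows "C - G ((norm (x - c))\<^sup>2) t \<le> u x t"
proof -
  have R: "R \<ge> 0" using x(1) norm_ge_zero order_trans by blast
  have sq: "(norm (x - c))\<^sup>2 < R\<^sup>2" if "x \<in> ball c R" for x
    using that by (simp add: dist_norm norm_minus_commute power_strict_mono)
  have "C - G ((norm (x - c))\<^sup>2) t - u x t \<le> 0"
  proof (rule parabolic_max_principle[where a = a and b = b and c = c and R = R
       and f = "\<lambda>x t. C - G ((norm (x - c))\<^sup>2) t - u x t"
       and ft = "\<lambda>x t. - Gt ((norm (x - c))\<^sup>2) t - ut x t"
       and g = "\<lambda>x t. - ((2 * Gr ((norm (x - c))\<^sup>2) t) *\<^sub>R (x - c)) - g x t"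
       and H = "\<lambda>x t h. - ((2 * Gr ((norm (x - c))\<^sup>2) t) *\<^sub>R h + (4 * Grr ((norm (x - c))\<^sup>2) t * ((x - c) \<bullet> h)) *\<^sub>R (x - c)) - H x t h"])
    show "continuous_on (cball c R \<times> {a..b}) (\<lambda>z. C - G ((norm (fst z - c))\<^sup>2) (snd z) - u (fst z) (snd z))"
      using b by (intro continuous_intros continuous_on_radial contG) auto
  next
    fix x t assume xt: "x \<in> ball c R" "a < t" "t \<le> b"
    show "((\<lambda>s. C - G ((norm (x - c))\<^sup>2) s - u x s) has_real_derivative - Gt ((norm (x - c))\<^sup>2) t - ut x t) (at t)"
      using xt sq b by (auto intro!: derivative_eq_intros Gt u_t)
    show "((\<lambda>y. C - G ((norm (y - c))\<^sup>2) t - u y t) has_derivative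
        (\<lambda>h. (- ((2 * Gr ((norm (x - c))\<^sup>2) t) *\<^sub>R (x - c)) - g x t) \<bullet> h)) (at x)"
    proof -
      have "((\<lambda>y. G ((norm (y - c))\<^sup>2) t) has_derivative (\<lambda>h. ((2 * Gr ((norm (x - c))\<^sup>2) t) *\<^sub>R (x - c)) \<bullet> h)) (at x)"
        by (rule radial_has_derivative[where G = "\<lambda>r. G r t" and G' = "\<lambda>r. Gr r t"]) (use Gr xt sq in auto)
      from has_derivative_diff[OF has_derivative_diff[OF has_derivative_const[of C] this] u_x[OF le_less_trans[OF xt(3) b]]]
      show ?thesis by (simp only: inner_diff_left inner_minus_left diff_0)
    qed
    show "((\<lambda>y. - ((2 * Gr ((norm (y - c))\<^sup>2) t) *\<^sub>R (y - c)) - g y t) has_derivative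
        (\<lambda>h. - ((2 * Gr ((norm (x - c))\<^sup>2) t) *\<^sub>R h + (4 * Grr ((norm (x - c))\<^sup>2) t * ((x - c) \<bullet> h)) *\<^sub>R (x - c)) - H x t h)) (at x)"
      by (intro has_derivative_diff has_derivative_minus radial_gradient_has_derivative Grr u_xx)
         (use xt sq b in auto)
    assume 0: "- ((2 * Gr ((norm (x - c))\<^sup>2) t) *\<^sub>R (x - c)) - g x t = 0"
      and L: "(\<Sum>i\<in>Basis. (- ((2 * Gr ((norm (x - c))\<^sup>2) t) *\<^sub>R i + (4 * Grr ((norm (x - c))\<^sup>2) t * ((x - c) \<bullet> i)) *\<^sub>R (x - c)) - H x t i) \<bullet> i) \<le> 0"
      and T: "0 \<le> - Gt ((norm (x - c))\<^sup>2) t - ut x t"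
    have "g x t = - ((2 * Gr ((norm (x - c))\<^sup>2) t) *\<^sub>R (x - c))" using 0 by simp
    then have ng: "norm (g x t) = 2 * \<bar>Gr ((norm (x - c))\<^sup>2) t\<bar> * sqrt ((norm (x - c))\<^sup>2)"
      by (simp add: abs_mult)
    have "- (2 * real DIM('a) * Gr ((norm (x - c))\<^sup>2) t + 4 * (norm (x - c))\<^sup>2 * Grr ((norm (x - c))\<^sup>2) t)
        - (\<Sum>i\<in>Basis. H x t i \<bullet> i) \<le> 0"
      using L by (simp only: inner_diff_left inner_minus_left sum_subtractf sum_negf radial_laplacian[unfolded inner_diff_left])
    moreover have "ut x t = (\<Sum>i\<in>Basis. H x t i \<bullet> i) + (2 * \<bar>Gr ((norm (x - c))\<^sup>2) t\<bar> * sqrt ((norm (x - c))\<^sup>2)) powr p"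
      using eq[of t x] xt b ng by simp
    ultimately show False using strict[of "(norm (x - c))\<^sup>2" t] sq[OF xt(1)] xt T by fastforce
  qed (use init lat x in \<open>auto simp: dist_norm norm_minus_commute\<close>)
  then show ?thesis by simp
qed

text \<open>Counterpart for supersolutions C + G. The gradient term now has the unfavourable sign
  and must be paid for by growth of G in time, which is why it serves only for short time
  steps.\<close>

lemma upper_barrier:
  assumes b: "b < 0"
    and contG: "continuous_on ({0..R\<^sup>2} \<times> {a..b}) (\<lambda>z. G (fst z) (snd z))"
    and Gt: "\<And>r t. 0 \<le> r \<Longrightarrow> r < R\<^sup>2 \<Longrightarrow> a < t \<Longrightarrow> t \<le> b \<Longrightarrow> ((\<lambda>s. G r s) has_real_derivative Gt r t) (at t)"
    and Gr: "\<And>r t. 0 \<le> r \<Longrightarrow> r < R\<^sup>2 \<Longrightarrow> a < t \<Longrightarrow> t \<le> b \<Longrightarrow> ((\<lambda>r. G r t) has_real_derivative Gr r t) (at r)"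
    and Grr: "\<And>r t. 0 \<le> r \<Longrightarrow> r < R\<^sup>2 \<Longrightarrow> a < t \<Longrightarrow> t \<le> b \<Longrightarrow> ((\<lambda>r. Gr r t) has_real_derivative Grr r t) (at r)"
    and strict: "\<And>r t. 0 \<le> r \<Longrightarrow> r < R\<^sup>2 \<Longrightarrow> a < t \<Longrightarrow> t \<le> b \<Longrightarrow>
       2 * real DIM('a) * Gr r t + 4 * r * Grr r t + (2 * \<bar>Gr r t\<bar> * sqrt r) powr p < Gt r t"
    and init: "\<And>x. norm (x - c) \<le> R \<Longrightarrow> u x a \<le> C + G ((norm (x - c))\<^sup>2) a"
    and lat: "\<And>x t. norm (x - c) = R \<Longrightarrow> a \<le> t \<Longrightarrow> t \<le> b \<Longrightarrow> u x t \<le> C + G (R\<^sup>2) t"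
    and x: "norm (x - c) \<le> R" "a \<le> t" "t \<le> b"
  shows "u x t \<le> C + G ((norm (x - c))\<^sup>2) t"
proof -
  have sq: "(norm (x - c))\<^sup>2 < R\<^sup>2" if "x \<in> ball c R" for x
    using that by (simp add: dist_norm norm_minus_commute power_strict_mono)
  have "u x t - C - G ((norm (x - c))\<^sup>2) t \<le> 0"
  proof (rule parabolic_max_principle[where a = a and b = b and c = c and R = R
       and f = "\<lambda>x t. u x t - C - G ((norm (x - c))\<^sup>2) t"
       and ft = "\<lambda>x t. ut x t - Gt ((norm (x - c))\<^sup>2) t"
       and g = "\<lambda>x t. g x t - (2 * Gr ((norm (x - c))\<^sup>2) t) *\<^sub>R (x - c)"
       and H = "\<lambda>x t h. H x t h - ((2 * Gr ((norm (x - c))\<^sup>2) t) *\<^sub>R h + (4 * Grr ((norm (x - c))\<^sup>2) t * ((x - c) \<bullet> h)) *\<^sub>R (x - c))"])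
    show "continuous_on (cball c R \<times> {a..b}) (\<lambda>z. u (fst z) (snd z) - C - G ((norm (fst z - c))\<^sup>2) (snd z))"
      using b by (intro continuous_intros continuous_on_radial contG) auto
  next
    fix x t assume xt: "x \<in> ball c R" "a < t" "t \<le> b"
    show "((\<lambda>s. u x s - C - G ((norm (x - c))\<^sup>2) s) has_real_derivative ut x t - Gt ((norm (x - c))\<^sup>2) t) (at t)"
      using xt sq b by (auto intro!: derivative_eq_intros Gt u_t)
    show "((\<lambda>y. u y t - C - G ((norm (y - c))\<^sup>2) t) has_derivative
        (\<lambda>h. (g x t - (2 * Gr ((norm (x - c))\<^sup>2) t) *\<^sub>R (x - c)) \<bullet> h)) (at x)"
    proof -
      have "((\<lambda>y. G ((norm (y - c))\<^sup>2) t) has_derivative (\<lambda>h. ((2 * Gr ((norm (x - c))\<^sup>2) t) *\<^sub>R (x - c)) \<bullet> h)) (at x)"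
        by (rule radial_has_derivative[where G = "\<lambda>r. G r t" and G' = "\<lambda>r. Gr r t"]) (use Gr xt sq in auto)
      from has_derivative_diff[OF has_derivative_diff[OF u_x[OF le_less_trans[OF xt(3) b]] has_derivative_const[of C]] this]
      show ?thesis by (simp only: inner_diff_left diff_0_right)
    qed
    show "((\<lambda>y. g y t - (2 * Gr ((norm (y - c))\<^sup>2) t) *\<^sub>R (y - c)) has_derivative
        (\<lambda>h. H x t h - ((2 * Gr ((norm (x - c))\<^sup>2) t) *\<^sub>R h + (4 * Grr ((norm (x - c))\<^sup>2) t * ((x - c) \<bullet> h)) *\<^sub>R (x - c)))) (at x)"
      by (intro has_derivative_diff has_derivative_minus radial_gradient_has_derivative Grr u_xx)
         (use xt sq b in auto)
    assume 0: "g x t - (2 * Gr ((norm (x - c))\<^sup>2) t) *\<^sub>R (x - c) = 0"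
      and L: "(\<Sum>i\<in>Basis. (H x t i - ((2 * Gr ((norm (x - c))\<^sup>2) t) *\<^sub>R i + (4 * Grr ((norm (x - c))\<^sup>2) t * ((x - c) \<bullet> i)) *\<^sub>R (x - c))) \<bullet> i) \<le> 0"
      and T: "0 \<le> ut x t - Gt ((norm (x - c))\<^sup>2) t"
    have "g x t = (2 * Gr ((norm (x - c))\<^sup>2) t) *\<^sub>R (x - c)" using 0 by simp
    then have ng: "norm (g x t) = 2 * \<bar>Gr ((norm (x - c))\<^sup>2) t\<bar> * sqrt ((norm (x - c))\<^sup>2)"
      by (simp add: abs_mult)
    have "(\<Sum>i\<in>Basis. H x t i \<bullet> i) -
       (2 * real DIM('a) * Gr ((norm (x - c))\<^sup>2) t + 4 * (norm (x - c))\<^sup>2 * Grr ((norm (x - c))\<^sup>2) t) \<le> 0"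
      using L by (simp only: inner_diff_left sum_subtractf radial_laplacian[unfolded inner_diff_left])
    moreover have "ut x t = (\<Sum>i\<in>Basis. H x t i \<bullet> i) + (2 * \<bar>Gr ((norm (x - c))\<^sup>2) t\<bar> * sqrt ((norm (x - c))\<^sup>2)) powr p"
      using eq[of t x] xt b ng by simp
    ultimately show False using strict[of "(norm (x - c))\<^sup>2" t] sq[OF xt(1)] xt T by fastforce
  qed (use init lat x in \<open>auto simp: dist_norm norm_minus_commute algebra_simps\<close>)
  then show ?thesis by simp
qed

end

subsection \<open>Harnack inequality for \<open>p > 2\<close>\<close>

lemma DERIV_powr_affine:
  fixes a b c s t :: real
  assumes "0 < a + b * (t - s)"
  shows "((\<lambda>t. (a + b * (t - s)) powr c) has_real_derivative c * b * (a + b * (t - s)) powr (c - 1)) (at t)"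
proof -
  have "((\<lambda>t. a + b * (t - s)) has_real_derivative b) (at t)"
    by (auto intro!: derivative_eq_intros)
  from DERIV_fun_powr[OF this assms, of c] show ?thesis by (simp add: mult_ac)
qed

lemma DERIV_powr_shift:
  fixes c k r :: real
  assumes "0 < r + k"
  shows "((\<lambda>r. (r + k) powr c) has_real_derivative c * (r + k) powr (c - 1)) (at r)"
  using DERIV_powr_affine[of k 1 r 0 c] assms by (simp add: add.commute)

text \<open>Write z^p as z times the monotone factor z^(p-1). This allows the gradient terms of two
  barriers to be added.\<close>

lemma powr_superadditive:
  fixes a b p :: real
  assumes "0 \<le> a" "0 \<le> b" "1 \<le> p"
  shows "a powr p + b powr p \<le> (a + b) powr p"
proof -
  have *: "z powr p = z * z powr (p - 1)" if "z \<ge> 0" for z :: real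
    using that powr_mult_base[of z "p - 1"] by simp
  have "a powr p + b powr p \<le> a * (a + b) powr (p - 1) + b * (a + b) powr (p - 1)"
    unfolding *[OF assms(1)] *[OF assms(2)]
    using assms by (intro add_mono mult_left_mono powr_mono2) auto
  also have "\<dots> = (a + b) powr p" using *[of "a + b"] assms by (simp add: algebra_simps)
  finally show ?thesis .
qed

text \<open>Reduces the power p to a small multiple of the square, for which a logarithm is the
  natural barrier. The error is the same small multiple.\<close>

lemma powr_ge_quadratic:
  fixes l z p :: real
  assumes "0 \<le> l" "l \<le> 1" "2 \<le> p" "0 \<le> z"
  shows "l * z\<^sup>2 - l \<le> z powr p"
proof (cases "z \<le> 1")
  case True
  then have "l * z\<^sup>2 \<le> l * 1" using assms by (intro mult_left_mono) (auto simp: power_le_one)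
  then show ?thesis using powr_ge_zero[of z p] by linarith
next
  case False
  then have "z powr 2 \<le> z powr p" using assms by (intro powr_mono) auto
  moreover have "l * z\<^sup>2 \<le> 1 * z\<^sup>2" using assms by (intro mult_right_mono) auto
  moreover have "z powr 2 = z\<^sup>2" using assms(4) by simp
  ultimately show ?thesis using assms(1) by linarith
qed

text \<open>The derivatives of \<open>V(r) = -m ln (1 - r/R^2)\<close>, which blows up at the boundary of the ball
  of radius \<open>R\<close>, so no lateral lower bound on \<open>u\<close> is needed.\<close>

lemma log_barrier:
  fixes n R r p :: real
  assumes "1 \<le> n" "1 \<le> R" "0 \<le> r" "r < R\<^sup>2" "2 \<le> p"
  defines "m \<equiv> (n + 1) * R"
  shows "2 * n * (m / (R\<^sup>2 - r)) + 4 * r * (m / (R\<^sup>2 - r)\<^sup>2)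
     < (2 * (m / (R\<^sup>2 - r)) * sqrt r) powr p + (8 * n * (n + 1) + 2) / R"
proof -
  define D where "D = R\<^sup>2 - r"
  have D: "D > 0" using assms by (simp add: D_def)
  have R: "R > 0" using assms by simp
  have m: "m \<ge> 0" using assms by simp
  \<comment> \<open>The weight 1/R keeps the error of order 1/R. With m = (n + 1) R, the quadratic
    term changes the coefficient of 1/D^2 from 4 r m to -4 r m n.\<close>
  have "(1/R) * (2 * (m / D) * sqrt r)\<^sup>2 - 1/R \<le> (2 * (m / D) * sqrt r) powr p"
    using assms m D by (intro powr_ge_quadratic) auto
  moreover have "2 * n * (m / D) + 4 * r * (m / D\<^sup>2) - (1/R) * (2 * (m / D) * sqrt r)\<^sup>2 \<le> 8 * n * (n + 1) / R"
  proof -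
    have sq: "(1/R) * (2 * (m / D) * sqrt r)\<^sup>2 = 4 * r * m * (n + 1) / D\<^sup>2"
    proof -
      have "(1/R) * (2 * (m / D) * sqrt r)\<^sup>2 = (1/R) * (4 * (m / D)\<^sup>2 * r)"
        using assms(3) by (simp only: power_mult_distrib real_sqrt_pow2) simp
      also have "\<dots> = 4 * r * m * (n + 1) / D\<^sup>2" using R D by (simp add: m_def field_simps power2_eq_square)
      finally show ?thesis .
    qed
    \<comment> \<open>The resulting expression is nonpositive near the boundary, where D \<le> 2 r;
      elsewhere D is comparable with R^2 and the expression is O(1/R).\<close>
    have "2 * n * (m / D) + 4 * r * (m / D\<^sup>2) - (1/R) * (2 * (m / D) * sqrt r)\<^sup>2
       = 2 * n * m * (D - 2 * r) / D\<^sup>2"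
      unfolding sq using D by (simp add: field_simps power2_eq_square)
    also have "\<dots> \<le> 8 * n * (n + 1) / R"
    proof (cases "D \<le> 2 * r")
      case True
      then have "2 * n * m * (D - 2 * r) \<le> 0" using assms m by (intro mult_nonneg_nonpos) auto
      then have "2 * n * m * (D - 2 * r) / D\<^sup>2 \<le> 0" by (simp add: divide_nonpos_nonneg)
      also have "0 \<le> 8 * n * (n + 1) / R" using assms by simp
      finally show ?thesis .
    next
      case False
      then have DR: "D \<ge> R\<^sup>2 / 2" "D \<le> R\<^sup>2" using assms(3) by (auto simp: D_def)
      have "2 * n * m * (D - 2 * r) / D\<^sup>2 \<le> 2 * n * m * D / D\<^sup>2"
        using assms m D by (intro divide_right_mono mult_left_mono) auto
      also have "\<dots> = 2 * n * m / D" using D by (simp add: power2_eq_square)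
      also have "\<dots> \<le> 2 * n * m / (R\<^sup>2 / 2)"
        using assms m D DR R by (intro divide_left_mono) auto
      also have "\<dots> = 4 * n * (n + 1) / R" using R by (simp add: m_def power2_eq_square)
      also have "\<dots> \<le> 8 * n * (n + 1) / R" using assms by (intro divide_right_mono) auto
      finally show ?thesis .
    qed
    finally show ?thesis .
  qed
  moreover have "8 * n * (n + 1) / R + 1 / R < (8 * n * (n + 1) + 2) / R"
    using R by (simp add: field_simps)
  ultimately show ?thesis unfolding D_def by linarith
qed

text \<open>\<open>Wr\<close> is the derivative in \<open>r = |x|^2\<close> of \<open>W = A (r + L \<tau>)^(q/2) \<tau>^(1-q)\<close>, which tends to
  infinity off the origin as \<open>\<tau> \<rightarrow> 0\<close>.\<close>

lemma power_barrier:
  fixes p n r \<tau> :: real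
  assumes "2 < p" "1 \<le> n" "0 \<le> r" "0 < \<tau>"
  defines "q \<equiv> p / (p - 1)"
  defines "L \<equiv> (2 * n + 1) / (1 - q / 2)"
  defines "A \<equiv> 1 + L" and "g \<equiv> r + L * \<tau>"
  defines "Wr \<equiv> A * (q/2) * g powr (q/2 - 1) * \<tau> powr (1 - q)"
  shows "2 * n * Wr + 4 * r * (A * (q/2) * (q/2 - 1) * g powr (q/2 - 2) * \<tau> powr (1 - q))
    \<le> (A * (q/2) * L * g powr (q/2 - 1) * \<tau> powr (1 - q) + (1 - q) * A * g powr (q/2) * \<tau> powr (- q))
      + (2 * Wr * sqrt r) powr p"
proof -
  have q: "1 < q" "q < 2" using assms(1) by (auto simp: q_def field_simps)
  have L: "L > 0" using q assms(2) by (simp add: L_def)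
  have A: "A > 1" using L by (simp add: A_def)
  have g: "g > 0" using assms(3,4) L by (simp add: g_def add_nonneg_pos)
  define P where "P = A * g powr (q/2 - 1) * \<tau> powr (- q)"
  have P: "P > 0" using A g assms(4) by (simp add: P_def)
  have e1: "\<tau> powr (1 - q) = \<tau> * \<tau> powr (- q)"
    using powr_mult_base[of \<tau> "- q"] assms(4) by simp
  have e2: "g powr (q/2) = g * g powr (q/2 - 1)"
    using powr_mult_base[of g "q/2 - 1"] g by simp
  have Wr: "Wr = P * (q/2) * \<tau>" by (simp add: Wr_def P_def e1)
  have neg: "4 * r * (A * (q/2) * (q/2 - 1) * g powr (q/2 - 2) * \<tau> powr (1 - q)) \<le> 0"
  proof -
    have "A * (q/2) * (q/2 - 1) \<le> 0" using A q by (intro mult_nonneg_nonpos) auto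
    then have neg0: "A * (q/2) * (q/2 - 1) * g powr (q/2 - 2) * \<tau> powr (1 - q) \<le> 0"
      by (rule mult_nonpos_nonneg[OF mult_nonpos_nonneg[OF _ powr_ge_zero] powr_ge_zero])
    show ?thesis by (rule mult_nonneg_nonpos[OF _ neg0]) (use assms(3) in simp)
  qed
  have lin: "A * (q/2) * L * g powr (q/2 - 1) * \<tau> powr (1 - q) + (1 - q) * A * g powr (q/2) * \<tau> powr (- q) - 2 * n * Wr
     = P * ((1 - q/2) * L * \<tau> - n * q * \<tau> - (q - 1) * r)"
    unfolding Wr by (simp add: P_def e1 e2) (simp add: g_def algebra_simps)
  \<comment> \<open>\<open>L\<close> satisfies (1 - q/2) L = 2 n + 1: the part 2 n pays for the
    first-order part of the Laplacian and 1 leaves a spare \<tau>. The linear part of the inequality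
    can thus fail only for r > \<tau>, and by at most P (r - \<tau>).\<close>
  have "(1 - q/2) * L * \<tau> - n * q * \<tau> - (q - 1) * r \<ge> \<tau> - r"
  proof -
    have "(1 - q/2) * L = 2 * n + 1" using q by (simp add: L_def)
    then have "(1 - q/2) * L * \<tau> = (2 * n + 1) * \<tau>" by (simp only:)
    then have "(1 - q/2) * L * \<tau> = 2 * (n * \<tau>) + \<tau>" by (simp only: distrib_right mult.assoc mult_1)
    moreover have "n * q * \<tau> \<le> n * 2 * \<tau>" using q assms by (intro mult_right_mono mult_left_mono) auto
    then have "n * q * \<tau> \<le> 2 * (n * \<tau>)" by simp
    moreover have "(q - 1) * r \<le> 1 * r" using q assms by (intro mult_right_mono) auto
    ultimately show ?thesis by linarith
  qed
  then have lin2: "P * (\<tau> - r) \<le> P * ((1 - q/2) * L * \<tau> - n * q * \<tau> - (q - 1) * r)"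
    using P by (intro mult_left_mono) auto
  have "P * (r - \<tau>) \<le> (2 * Wr * sqrt r) powr p"
  proof (cases "r \<le> \<tau>")
    case True
    then have "P * (r - \<tau>) \<le> 0" using P by (intro mult_nonneg_nonpos) auto
    then show ?thesis using powr_ge_zero[of "2 * Wr * sqrt r" p] by linarith
  next
    case False
    then have r: "r > 0" "\<tau> < r" using assms(4) by auto
    have gA: "g \<le> A * r" using r L by (simp add: g_def A_def algebra_simps)
    \<comment> \<open>Both sides are products of powers, so the comparison is linear in logarithms.
      The \<open>lt\<close> terms cancel because p (1 - q) = -q. What remains contains (p - 2)/2 (lr
      - lg), which is controlled by g \<le> A r; this bound holds since \<tau> < r and A = 1 +
      L.\<close>
    define la lg lt lr where "la = ln A" and "lg = ln g" and "lt = ln \<tau>" and "lr = ln r"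
    have la: "la \<ge> 0" using A by (simp add: la_def)
    have lgA: "lg \<le> la + lr" unfolding lg_def la_def lr_def
      using gA g A r by (metis ln_mult ln_le_cancel_iff mult_pos_pos less_trans zero_less_one order_less_imp_not_less not_less_iff_gr_or_eq)
    have lq: "ln q \<ge> 0" using q by simp
    have "Wr > 0" unfolding Wr using P q assms(4) by (intro mult_pos_pos) auto
    then have pos: "2 * Wr * sqrt r > 0" using r by simp
    have "ln (P * r) = la + (q/2 - 1) * lg - q * lt + lr"
      using A g assms(4) r by (simp add: P_def ln_mult ln_powr la_def lg_def lt_def lr_def)
    moreover have "ln (2 * Wr * sqrt r) = ln q + la + (q/2 - 1) * lg + (1 - q) * lt + lr / 2"
    proof -
      have "2 * Wr * sqrt r = q * (A * (g powr (q/2 - 1) * (\<tau> powr (1 - q) * sqrt r)))" by (simp add: Wr_def)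
      also have "ln \<dots> = ln q + la + (q/2 - 1) * lg + (1 - q) * lt + lr / 2"
        using A g assms(4) r q by (simp add: ln_mult ln_powr ln_sqrt la_def lg_def lt_def lr_def)
      finally show ?thesis .
    qed
    then have "ln ((2 * Wr * sqrt r) powr p) = p * (ln q + la + (q/2 - 1) * lg + (1 - q) * lt + lr / 2)"
      using pos by (simp add: ln_powr)
    moreover have "la + (q/2 - 1) * lg - q * lt + lr \<le> p * (ln q + la + (q/2 - 1) * lg + (1 - q) * lt + lr / 2)"
    proof -
      have i1: "p * (1 - q) = - q" using assms(1) by (simp add: q_def field_simps)
      have i2: "p * (q/2 - 1) - (q/2 - 1) = - ((p - 2)/2)"
      proof -
        have "q * (p - 1) = p" using assms(1) by (simp add: q_def)
        then have "q * p - q = p" by (simp add: algebra_simps)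
        moreover have "p * (q/2 - 1) - (q/2 - 1) = (q * p - q) / 2 - p + 1" by (simp add: field_simps)
        ultimately have "p * (q/2 - 1) - (q/2 - 1) = p / 2 - p + 1" by (simp only:)
        also have "\<dots> = - ((p - 2)/2)" by (simp add: field_simps)
        finally show ?thesis .
      qed
      have "p * (ln q + la + (q/2 - 1) * lg + (1 - q) * lt + lr / 2) - (la + (q/2 - 1) * lg - q * lt + lr)
         = p * ln q + (p - 1) * la + (p * (q/2 - 1) - (q/2 - 1)) * lg + (p * (1 - q) + q) * lt + (p - 2)/2 * lr"
        by (simp add: algebra_simps add_divide_distrib diff_divide_distrib)
      also have "\<dots> = p * ln q + (p - 1) * la - (p - 2)/2 * (lg - lr)"
        unfolding i1 i2 by (simp add: algebra_simps add_divide_distrib diff_divide_distrib)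
      also have "\<dots> \<ge> p * ln q + (p - 1) * la - (p - 2)/2 * la"
        using lgA assms(1) by (intro diff_left_mono mult_left_mono) auto
      also (xtrans) have "p * ln q + (p - 1) * la - (p - 2)/2 * la = p * ln q + p / 2 * la"
        by (simp add: algebra_simps add_divide_distrib diff_divide_distrib)
      also (xtrans) have "\<dots> \<ge> 0" using lq la assms(1) by simp
      finally (xtrans) show ?thesis by simp
    qed
    ultimately have "ln (P * r) \<le> ln ((2 * Wr * sqrt r) powr p)" by (simp only:)
    then have "P * r \<le> (2 * Wr * sqrt r) powr p" using P r pos by (subst (asm) ln_le_cancel_iff) auto
    moreover have "P * (r - \<tau>) \<le> P * r" using P assms(4) by (intro mult_left_mono) auto
    ultimately show ?thesis by linarith
  qed
  moreover have "P * (r - \<tau>) = - (P * (\<tau> - r))" by (simp add: algebra_simps)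
  ultimately show ?thesis using lin lin2 neg by linarith
qed

context hamilton_jacobi begin

text \<open>Compare u with u(y,s) minus the sum of the power and log barriers. These are infinite
  exactly where u is uncontrolled: the first at the initial time away from y, the second on the
  lateral boundary. Starting slightly later and on a slightly smaller ball keeps them finite. The
  term \<sigma> covers the oscillation of u near (y,s), the term linear in t - s the error of the
  log barrier.\<close>

lemma harnack_supercritical_localized:
  fixes x y :: 'a
  assumes "2 < p" "s < t" "t < 0" "1 \<le> R" "norm (x - y) < R" "0 < \<sigma>"
  defines "n \<equiv> real DIM('a)" and "q \<equiv> p / (p - 1)"
  defines "L \<equiv> (2 * n + 1) / (1 - q / 2)"
  defines "A \<equiv> 1 + L"
  shows "u y s - (A * ((norm (x - y))\<^sup>2 + L * (t - s)) powr (q/2) * (t - s) powr (1 - q)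
      - (n + 1) * R * ln (1 - (norm (x - y))\<^sup>2 / R\<^sup>2) + \<sigma> + (8 * n * (n + 1) + 2) / R * (t - s)) \<le> u x t"
proof -
  have q: "1 < q" "q < 2" using assms(1) by (auto simp: q_def field_simps)
  have n: "1 \<le> n" using DIM_positive[where 'a='a] by (simp add: n_def Suc_leI)
  have L: "L > 0" using q n by (simp add: L_def)
  have A: "A > 1" using L by (simp add: A_def)
  define m where "m = (n + 1) * R"
  have m: "m > 0" using n assms(4) by (simp add: m_def)
  define e where "e = (8 * n * (n + 1) + 2) / R"
  have e: "e > 0" using n assms(4) by (simp add: e_def add_nonneg_pos)
  define G where "G r t' = A * (r + L * (t' - s)) powr (q/2) * (t' - s) powr (1 - q)
      - m * ln (1 - r / R\<^sup>2) + \<sigma> + e * (t' - s)" for r t'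
  have R0: "R > 0" using assms(4) by simp
  define V where "V r = - (m * ln (1 - r / R\<^sup>2))" for r
  have V: "V r \<ge> 0" if "0 \<le> r" "r < R\<^sup>2" for r
  proof -
    have "ln (1 - r / R\<^sup>2) \<le> 0" using that R0 by (subst ln_le_zero_iff) (auto simp: field_simps)
    then show ?thesis using m by (simp add: V_def mult_nonneg_nonpos)
  qed
  have GV: "G r t' = A * (r + L * (t' - s)) powr (q/2) * (t' - s) powr (1 - q) + V r + \<sigma> + e * (t' - s)" for r t'
    by (simp add: G_def V_def)
  obtain B where B: "B \<ge> 0" "\<And>x' t'. norm (x' - y) \<le> R \<Longrightarrow> s \<le> t' \<Longrightarrow> t' \<le> t \<Longrightarrow> u y s - u x' t' \<le> B"
  proof -
    have "compact ((\<lambda>z. u y s - u (fst z) (snd z)) ` (cball y R \<times> {s..t}))"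
      using assms(3) by (intro compact_continuous_image continuous_intros compact_Times) auto
    then have "bounded ((\<lambda>z. u y s - u (fst z) (snd z)) ` (cball y R \<times> {s..t}))"
      by (rule compact_imp_bounded)
    then obtain B where B0: "\<forall>w\<in>(\<lambda>z. u y s - u (fst z) (snd z)) ` (cball y R \<times> {s..t}). norm w \<le> B"
      unfolding bounded_iff by blast
    have B: "\<bar>u y s - u (fst z) (snd z)\<bar> \<le> B" if "z \<in> cball y R \<times> {s..t}" for z
      using bspec[OF B0 imageI[OF that]] by simp
    show ?thesis
    proof (rule that[of "\<bar>B\<bar>"])
      fix x' t' assume "norm (x' - y) \<le> R" "s \<le> t'" "t' \<le> t"
      then show "u y s - u x' t' \<le> \<bar>B\<bar>"
        using B[of "(x', t')"] by (auto simp: dist_norm norm_minus_commute)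
    qed simp
  qed
  \<comment> \<open>The radius \<open>R'\<close> is where 1 - r/R^2 equals \<omega>. The first entry
    keeps x inside the smaller ball; the second makes V on its boundary at least B, an upper bound
    for the drop of u below u(y,s).\<close>
  define \<omega> where "\<omega> = min (1 - (norm (x - y))\<^sup>2 / R\<^sup>2) (exp (- B / m))"
  have sqR: "(norm (x - y))\<^sup>2 < R\<^sup>2" using assms(5) by (intro power_strict_mono) auto
  have \<omega>: "0 < \<omega>" "\<omega> \<le> 1" "\<omega> \<le> exp (- B / m)" "(norm (x - y))\<^sup>2 \<le> R\<^sup>2 * (1 - \<omega>)"
  proof -
    show "0 < \<omega>" using sqR R0 by (simp add: \<omega>_def field_simps)
    show "\<omega> \<le> 1" unfolding \<omega>_def by (rule min.coboundedI1) simp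
    show "\<omega> \<le> exp (- B / m)" unfolding \<omega>_def by (rule min.cobounded2)
    have "\<omega> \<le> 1 - (norm (x - y))\<^sup>2 / R\<^sup>2" unfolding \<omega>_def by (rule min.cobounded1)
    then show "(norm (x - y))\<^sup>2 \<le> R\<^sup>2 * (1 - \<omega>)" using R0 by (simp add: field_simps)
  qed
  define R' where "R' = R * sqrt (1 - \<omega>)"
  have R'sq: "R'\<^sup>2 = R\<^sup>2 * (1 - \<omega>)" using \<omega> by (simp add: R'_def power_mult_distrib)
  have R'R: "R'\<^sup>2 < R\<^sup>2" using R'sq \<omega> R0 by (simp add: mult_less_cancel_left2)
  have R'0: "R' \<ge> 0" using R0 \<omega> by (simp add: R'_def)
  have R'le: "R' \<le> R" using R'R R0 by (meson less_imp_le power2_less_imp_less)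
  have xR': "norm (x - y) \<le> R'" using \<omega>(4) R'0 R'sq by (metis power2_le_imp_le)
  have VB: "V (R'\<^sup>2) \<ge> B"
  proof -
    have "1 - R'\<^sup>2 / R\<^sup>2 = \<omega>" using R'sq R0 by (simp add: field_simps)
    moreover have "ln \<omega> \<le> - B / m" using \<omega> by (metis ln_exp ln_le_cancel_iff exp_gt_zero)
    then have "m * ln \<omega> \<le> - B" using m by (simp add: field_simps)
    ultimately show ?thesis by (simp add: V_def)
  qed
  obtain d where d: "d > 0" "\<And>x' t'. norm (x' - y) < d \<Longrightarrow> \<bar>t' - s\<bar> < d \<Longrightarrow> t' < 0 \<Longrightarrow> u y s - \<sigma> \<le> u x' t'"
  proof -
    have "continuous_on (UNIV \<times> {..<0}) (\<lambda>z. u (fst z) (snd z))" using u_cont by (simp add: Qdom_def)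
    moreover have "(y, s) \<in> UNIV \<times> {..<0}" using assms by auto
    ultimately obtain d where d: "d > 0" and
      dd: "\<And>z. z \<in> UNIV \<times> {..<0} \<Longrightarrow> dist z (y,s) < d \<Longrightarrow> dist (u (fst z) (snd z)) (u y s) < \<sigma>"
      using assms(6) unfolding continuous_on_iff by force
    show ?thesis
    proof (rule that[of "d/2"])
      fix x' t' assume *: "norm (x' - y) < d/2" "\<bar>t' - s\<bar> < d/2" "t' < 0"
      have "dist (x', t') (y, s) \<le> norm (x' - y) + \<bar>t' - s\<bar>"
        unfolding dist_prod_def by (simp add: dist_norm dist_real_def)
          (metis norm_ge_zero abs_ge_zero sqrt_sum_squares_le_sum power2_abs)
      then have "dist (x', t') (y, s) < d" using * by simp
      from dd[OF _ this] *(3) show "u y s - \<sigma> \<le> u x' t'" by (auto simp: dist_real_def)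
    qed (use d in auto)
  qed
  \<comment> \<open>Since 1 - q < 0, a small \<tau> gives \<tau>^(1-q) \<ge> Kd, and the power
    barrier is then at least B at distance d or more from y. At smaller distance the continuity of u
    at (y,s) suffices.\<close>
  define Kd where "Kd = 1 + B / (A * (d\<^sup>2) powr (q/2))"
  have Ad: "A * (d\<^sup>2) powr (q/2) > 0" using A d by simp
  have Kd: "Kd \<ge> 1" using B Ad by (simp add: Kd_def)
  define \<tau> where "\<tau> = min (min (d/2) (t - s)) (Kd powr (1 / (1 - q)))"
  have \<tau>: "\<tau> > 0" "\<tau> < d" "\<tau> \<le> t - s" using d assms(2) Kd by (auto simp: \<tau>_def)
  have \<tau>K: "A * (d\<^sup>2) powr (q/2) * \<tau> powr (1 - q) \<ge> B"
  proof -
    have "Kd = (Kd powr (1 / (1 - q))) powr (1 - q)" using q Kd by (simp add: powr_powr)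
    also have "\<dots> \<le> \<tau> powr (1 - q)"
      using \<tau> q by (intro powr_mono2') (auto simp: \<tau>_def)
    finally have "A * (d\<^sup>2) powr (q/2) * Kd \<le> A * (d\<^sup>2) powr (q/2) * \<tau> powr (1 - q)"
      using Ad by (intro mult_left_mono) auto
    moreover have "A * (d\<^sup>2) powr (q/2) * Kd = A * (d\<^sup>2) powr (q/2) + B"
      using Ad A d(1) by (simp add: Kd_def field_simps)
    ultimately show ?thesis using Ad by linarith
  qed
  define Wr where "Wr r t' = A * (q/2) * (r + L * (t' - s)) powr (q/2 - 1) * (t' - s) powr (1 - q)" for r t'
  define Wt where "Wt r t' = A * (q/2) * L * (r + L * (t' - s)) powr (q/2 - 1) * (t' - s) powr (1 - q)
     + (1 - q) * A * (r + L * (t' - s)) powr (q/2) * (t' - s) powr (- q)" for r t'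
  have pos: "r + L * (t' - s) > 0" if "0 \<le> r" "s < t'" for r t'
    using that L by (simp add: add_nonneg_pos)
  have R'lt: "r / R\<^sup>2 < 1" if "r \<le> R'\<^sup>2" for r using that R'R R0 by (simp add: field_simps)
  have "u y s - G ((norm (x - y))\<^sup>2) t \<le> u x t"
  proof (rule lower_barrier[where a = "s + \<tau>" and b = t and c = y and R = R' and C = "u y s" and G = G
       and Gt = "\<lambda>r t'. Wt r t' + e"
       and Gr = "\<lambda>r t'. Wr r t' + m / (R\<^sup>2 - r)"
       and Grr = "\<lambda>r t'. A * (q/2) * (q/2 - 1) * (r + L * (t' - s)) powr (q/2 - 2) * (t' - s) powr (1 - q) + m / (R\<^sup>2 - r)\<^sup>2"])
    show "continuous_on ({0..R'\<^sup>2} \<times> {s + \<tau>..t}) (\<lambda>z. G (fst z) (snd z))"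
      unfolding G_def using \<tau> pos R'lt less_imp_neq[OF R'lt] less_imp_neq[OF pos] R0
      by (intro continuous_intros) (force simp: eq_commute[of 0])+
  next
    fix r t' assume rt: "0 \<le> r" "r < R'\<^sup>2" "s + \<tau> < t'" "t' \<le> t"
    have st: "s < t'" using rt \<tau> by simp
    have rR: "r < R\<^sup>2" using rt R'R by simp
    have D: "1 - r / R\<^sup>2 > 0" using rR R0 by (simp add: field_simps)
    note P = pos[OF rt(1) st]
    show "(G r has_real_derivative Wt r t' + e) (at t')"
    proof -
      have d1: "((\<lambda>t'. (r + L * (t' - s)) powr (q/2)) has_real_derivative q/2 * L * (r + L * (t' - s)) powr (q/2 - 1)) (at t')"
        using DERIV_powr_affine[OF P] .
      have d2: "((\<lambda>t'. (t' - s) powr (1 - q)) has_real_derivative (1 - q) * (t' - s) powr (- q)) (at t')"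
        using DERIV_powr_affine[of 0 1 t' s "1 - q"] st by simp
      have d3: "((\<lambda>t'. e * (t' - s)) has_real_derivative e) (at t')"
        by (auto intro!: derivative_eq_intros)
      have G: "G r = (\<lambda>t'. A * (r + L * (t' - s)) powr (q/2) * (t' - s) powr (1 - q) + (V r + \<sigma>) + e * (t' - s))"
        by (simp add: GV fun_eq_iff)
      show ?thesis unfolding G
        by (rule DERIV_cong[OF DERIV_add[OF DERIV_add[OF DERIV_mult[OF DERIV_cmult[OF d1, of A] d2] DERIV_const] d3]])
           (simp add: Wt_def algebra_simps)
    qed
    show "((\<lambda>r. G r t') has_real_derivative Wr r t' + m / (R\<^sup>2 - r)) (at r)"
    proof -
      have "((\<lambda>r. - (m * ln (1 - r / R\<^sup>2))) has_real_derivative m / (R\<^sup>2 - r)) (at r)"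
        using D R0 rR by (auto intro!: derivative_eq_intros simp: field_simps)
      then have "(V has_real_derivative m / (R\<^sup>2 - r)) (at r)" by (simp add: V_def[abs_def])
      from DERIV_add[OF this DERIV_const[of "\<sigma> + e * (t' - s)"]]
      have d2: "((\<lambda>r. V r + (\<sigma> + e * (t' - s))) has_real_derivative m / (R\<^sup>2 - r)) (at r)" by simp
      have G: "(\<lambda>r. G r t') = (\<lambda>r. A * (r + L * (t' - s)) powr (q/2) * (t' - s) powr (1 - q) + (V r + (\<sigma> + e * (t' - s))))"
        by (simp add: GV fun_eq_iff)
      show ?thesis unfolding G
        by (rule DERIV_cong[OF DERIV_add[OF DERIV_cmult_right[OF DERIV_cmult[OF DERIV_powr_shift[OF P], of A]] d2]])
           (simp add: Wr_def)
    qed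
    show "((\<lambda>r. Wr r t' + m / (R\<^sup>2 - r)) has_real_derivative
      A * (q/2) * (q/2 - 1) * (r + L * (t' - s)) powr (q/2 - 2) * (t' - s) powr (1 - q) + m / (R\<^sup>2 - r)\<^sup>2) (at r)"
    proof -
      have d2: "((\<lambda>r. m / (R\<^sup>2 - r)) has_real_derivative m / (R\<^sup>2 - r)\<^sup>2) (at r)"
        using rR by (auto intro!: derivative_eq_intros simp: power2_eq_square)
      show ?thesis unfolding Wr_def
        by (rule DERIV_cong[OF DERIV_add[OF DERIV_cmult_right[OF DERIV_cmult[OF DERIV_powr_shift[OF P], of "A * (q/2)"]] d2]])
           simp
    qed
    have Wr0: "Wr r t' \<ge> 0" using A q by (simp add: Wr_def)
    have Vr0: "m / (R\<^sup>2 - r) \<ge> 0" using m rR by simp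
    have "2 * n * Wr r t' + 4 * r * (A * (q/2) * (q/2 - 1) * (r + L * (t' - s)) powr (q/2 - 2) * (t' - s) powr (1 - q))
      \<le> Wt r t' + (2 * Wr r t' * sqrt r) powr p"
      unfolding Wr_def Wt_def A_def L_def q_def
      using power_barrier[of p n r "t' - s"] assms(1) n rt(1) st by simp
    moreover have "2 * n * (m / (R\<^sup>2 - r)) + 4 * r * (m / (R\<^sup>2 - r)\<^sup>2)
     < (2 * (m / (R\<^sup>2 - r)) * sqrt r) powr p + e"
      unfolding e_def m_def using n assms(1,4) rt(1) rR by (intro log_barrier) auto
    \<comment> \<open>Both barriers are nondecreasing in r, so their gradients are parallel and
      superadditivity lets each keep its own p-th power.\<close>
    moreover have "(2 * Wr r t' * sqrt r) powr p + (2 * (m / (R\<^sup>2 - r)) * sqrt r) powr p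
       \<le> (2 * \<bar>Wr r t' + m / (R\<^sup>2 - r)\<bar> * sqrt r) powr p"
    proof -
      have "(2 * Wr r t' * sqrt r) powr p + (2 * (m / (R\<^sup>2 - r)) * sqrt r) powr p
        \<le> (2 * Wr r t' * sqrt r + 2 * (m / (R\<^sup>2 - r)) * sqrt r) powr p"
        using Wr0 Vr0 rt(1) assms(1) by (intro powr_superadditive mult_nonneg_nonneg) auto
      also have "2 * Wr r t' * sqrt r + 2 * (m / (R\<^sup>2 - r)) * sqrt r = 2 * \<bar>Wr r t' + m / (R\<^sup>2 - r)\<bar> * sqrt r"
        using Wr0 Vr0 by (simp add: algebra_simps)
      finally show ?thesis .
    qed
    ultimately show "2 * real DIM('a) * (Wr r t' + m / (R\<^sup>2 - r)) + 4 * r * (A * (q/2) * (q/2 - 1) *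
        (r + L * (t' - s)) powr (q/2 - 2) * (t' - s) powr (1 - q) + m / (R\<^sup>2 - r)\<^sup>2)
      < Wt r t' + e + (2 * \<bar>Wr r t' + m / (R\<^sup>2 - r)\<bar> * sqrt r) powr p"
      by (simp add: n_def[symmetric] distrib_left)
  next
    fix x' assume x': "norm (x' - y) \<le> R'"
    have r: "(norm (x' - y))\<^sup>2 < R\<^sup>2" using x' R'R by (smt (verit) norm_ge_zero power_mono)
    show "u y s - G ((norm (x' - y))\<^sup>2) (s + \<tau>) \<le> u x' (s + \<tau>)"
    proof (cases "norm (x' - y) < d")
      case True
      then have "u y s - \<sigma> \<le> u x' (s + \<tau>)" using d(2)[of x' "s + \<tau>"] \<tau> assms(2,3) by simp
      moreover have "A * ((norm (x' - y))\<^sup>2 + L * \<tau>) powr (q/2) * \<tau> powr (1 - q) \<ge> 0" using A by simp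
      ultimately show ?thesis using V[OF zero_le_power2 r] mult_pos_pos[OF e \<tau>(1)]
        unfolding GV add_diff_cancel_left' by linarith
    next
      case False
      have "d\<^sup>2 \<le> (norm (x' - y))\<^sup>2 + L * \<tau>"
        using False d \<tau> L by (intro add_increasing2 power_mono) auto
      then have "A * (d\<^sup>2) powr (q/2) * \<tau> powr (1 - q) \<le> A * ((norm (x' - y))\<^sup>2 + L * \<tau>) powr (q/2) * \<tau> powr (1 - q)"
        using A q by (intro mult_right_mono mult_left_mono powr_mono2) auto
      moreover have "u y s - u x' (s + \<tau>) \<le> B" using B(2)[of x' "s + \<tau>"] x' R'le \<tau> by simp
      ultimately show ?thesis using \<tau>K V[OF zero_le_power2 r] mult_pos_pos[OF e \<tau>(1)] assms(6)
        unfolding GV add_diff_cancel_left' by linarith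
    qed
  next
    fix x' t' assume x': "norm (x' - y) = R'" "s + \<tau> \<le> t'" "t' \<le> t"
    have "u y s - u x' t' \<le> B" using B(2)[of x' t'] x' R'le \<tau> by simp
    moreover have "A * (R'\<^sup>2 + L * (t' - s)) powr (q/2) * (t' - s) powr (1 - q) \<ge> 0" using A by simp
    moreover have "e * (t' - s) \<ge> 0" using e x' \<tau> by simp
    ultimately show "u y s - G (R'\<^sup>2) t' \<le> u x' t'" using VB assms(6) by (simp add: GV)
  qed (use assms \<tau> xR' in auto)
  then show ?thesis by (simp add: G_def m_def e_def)
qed

text \<open>For fixed x and y the lateral barrier and its error are both O(1/R), so letting R tend
  to infinity removes the localisation.\<close>

lemma harnack_supercritical:
  fixes x y :: 'a
  assumes "2 < p" "s < t" "t < 0"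
  defines "n \<equiv> real DIM('a)" and "q \<equiv> p / (p - 1)"
  defines "L \<equiv> (2 * n + 1) / (1 - q / 2)"
  shows "u y s \<le> u x t + (1 + L) * ((norm (x - y))\<^sup>2 + L * (t - s)) powr (q/2) * (t - s) powr (1 - q)"
proof (rule field_le_epsilon)
  fix \<sigma> :: real assume "0 < \<sigma>"
  define W where "W = (1 + L) * ((norm (x - y))\<^sup>2 + L * (t - s)) powr (q/2) * (t - s) powr (1 - q)"
  define r where "r = (norm (x - y))\<^sup>2"
  have "((\<lambda>R. u y s - (W - (n + 1) * R * ln (1 - r / R\<^sup>2) + \<sigma> + (8 * n * (n + 1) + 2) / R * (t - s)))
      \<longlongrightarrow> u y s - (W + \<sigma>)) at_top"
    by real_asymp
  moreover have "eventually (\<lambda>R. u y s - (W - (n + 1) * R * ln (1 - r / R\<^sup>2) + \<sigma> + (8 * n * (n + 1) + 2) / R * (t - s)) \<le> u x t) at_top"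
    using eventually_ge_at_top[of "1::real"] eventually_gt_at_top[of "norm (x - y)"]
  proof eventually_elim
    case (elim R)
    from harnack_supercritical_localized[OF assms(1-3) elim \<open>0 < \<sigma>\<close>] show ?case
      by (simp add: W_def r_def n_def q_def L_def)
  qed
  ultimately have "u y s - (W + \<sigma>) \<le> u x t" by (rule tendsto_upperbound) simp
  then show "u y s \<le> u x t + (1 + L) * ((norm (x - y))\<^sup>2 + L * (t - s)) powr (q/2) * (t - s) powr (1 - q) + \<sigma>"
    by (simp add: W_def)
qed

end

subsection \<open>Harnack inequality for the heat equation\<close>

lemma has_derivative_shift:
  assumes "(f has_derivative D) (at (x + c))"
  shows "((\<lambda>y. f (y + c)) has_derivative D) (at x)"
proof -
  have "((\<lambda>y. y + c) has_derivative (\<lambda>h. h)) (at x)"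
    by (auto intro!: derivative_eq_intros)
  from has_derivative_compose[OF this assms] show ?thesis .
qed

locale heat = C21 v vt g H for v :: "'a::euclidean_space \<Rightarrow> real \<Rightarrow> real" and vt g H +
  assumes pos: "t < 0 \<Longrightarrow> 0 < v x t"
    and heat: "t < 0 \<Longrightarrow> vt x t = (\<Sum>i\<in>Basis. H x t i \<bullet> i)"
begin

text \<open>The maximum principle for \<open>v(y,t)^2 - M v(y + b(t),t)\<close>: the term \<open>2 |\<nabla>v|^2\<close> produced by
  the square absorbs the drift of the moving point \<open>y + b(t)\<close>, which ends at \<open>y + h\<close>.\<close>

lemma square_minus_shift_le:
  fixes y0 h :: 'a
  assumes "s < 0" "0 < r" "0 < \<theta>"
    and M: "\<And>y t. norm (y - y0) \<le> r \<Longrightarrow> s - \<theta> \<le> t \<Longrightarrow> t \<le> s \<Longrightarrow> v y t \<le> M"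
  shows "(v y0 s)\<^sup>2 - M * v (y0 + h) s
    \<le> M\<^sup>2 * ((norm h)\<^sup>2 / (2 * \<theta>) + 2 * real DIM('a) * \<theta> / r\<^sup>2 + 2 * norm h / r)"
proof (rule field_le_epsilon)
  fix \<epsilon> :: real assume \<epsilon>: "0 < \<epsilon>"
  define n where "n = real DIM('a)"
  \<comment> \<open>The rate at which errors accumulate: the drift after Young's inequality against
    2 |\<nabla>v|^2, the Laplacian of the localisation M^2/r^2 |y - y0|^2, and the drift meeting the
    gradient of the localisation; the last summand makes the comparison strict. The localisation is
    0 at y0 and M^2 \<ge> v^2 on the lateral boundary, and initially the shift is 0, so that v^2
    \<le> M v.\<close>
  define a where "a = M\<^sup>2 * ((norm h)\<^sup>2 / (2 * \<theta>\<^sup>2) + 2 * n / r\<^sup>2 + 2 * norm h / (r * \<theta>)) + \<epsilon> / \<theta>"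
  define t1 where "t1 = s - \<theta>"
  define b where "b t = ((t - t1) / \<theta>) *\<^sub>R h" for t
  have b': "((\<lambda>t. y + b t) has_vector_derivative (1/\<theta>) *\<^sub>R h) (at t)" for y t
    unfolding b_def has_vector_derivative_def
    by (auto intro!: derivative_eq_intros simp: divide_inverse)
  have M0: "M > 0" using M[of y0 s] pos[of s y0] assms(1-3) by simp
  have "(v y0 s)\<^sup>2 - M * v (y0 + b s) s - M\<^sup>2 / r\<^sup>2 * (norm (y0 - y0))\<^sup>2 - a * (s - t1) \<le> 0"
  proof (rule parabolic_max_principle[where a = t1 and b = s and c = y0 and R = r
       and f = "\<lambda>y t. (v y t)\<^sup>2 - M * v (y + b t) t - M\<^sup>2 / r\<^sup>2 * (norm (y - y0))\<^sup>2 - a * (t - t1)"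
       and ft = "\<lambda>y t. 2 * v y t * vt y t - M * (vt (y + b t) t + g (y + b t) t \<bullet> ((1/\<theta>) *\<^sub>R h)) - a"
       and g = "\<lambda>y t. (2 * v y t) *\<^sub>R g y t - M *\<^sub>R g (y + b t) t - (2 * (M\<^sup>2 / r\<^sup>2)) *\<^sub>R (y - y0)"
       and H = "\<lambda>y t k. (2 * v y t) *\<^sub>R H y t k + (2 * (g y t \<bullet> k)) *\<^sub>R g y t - M *\<^sub>R H (y + b t) t k - (2 * (M\<^sup>2 / r\<^sup>2)) *\<^sub>R k"])
    show "continuous_on (cball y0 r \<times> {t1..s}) (\<lambda>z. (v (fst z) (snd z))\<^sup>2 - M * v (fst z + b (snd z)) (snd z)
        - M\<^sup>2 / r\<^sup>2 * (norm (fst z - y0))\<^sup>2 - a * (snd z - t1))"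
      unfolding b_def using assms by (intro continuous_intros) auto
  next
    fix y t assume yt: "y \<in> ball y0 r" "t1 < t" "t \<le> s"
    have t0: "t < 0" using yt assms by simp
    show "((\<lambda>t. (v y t)\<^sup>2 - M * v (y + b t) t - M\<^sup>2 / r\<^sup>2 * (norm (y - y0))\<^sup>2 - a * (t - t1)) has_real_derivative
      2 * v y t * vt y t - M * (vt (y + b t) t + g (y + b t) t \<bullet> ((1/\<theta>) *\<^sub>R h)) - a) (at t)"
    proof -
      have d1: "((\<lambda>t. (v y t)\<^sup>2) has_real_derivative 2 * v y t * vt y t) (at t)"
        using u_t[OF t0] by (auto intro!: derivative_eq_intros)
      have d2: "((\<lambda>t. a * (t - t1)) has_real_derivative a) (at t)"
        by (auto intro!: derivative_eq_intros)
      show ?thesis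
        by (rule DERIV_cong[OF DERIV_diff[OF DERIV_diff[OF DERIV_diff[OF d1 DERIV_cmult[OF u_path[OF t0 b'], of M]] DERIV_const] d2]]) simp
    qed
    have dn: "((\<lambda>y. (norm (y - y0))\<^sup>2) has_derivative (\<lambda>k. (2 *\<^sub>R (y - y0)) \<bullet> k)) (at y)"
      using radial_has_derivative[of "\<lambda>r. r" "\<lambda>r. 1" y y0] by simp
    show "((\<lambda>y. (v y t)\<^sup>2 - M * v (y + b t) t - M\<^sup>2 / r\<^sup>2 * (norm (y - y0))\<^sup>2 - a * (t - t1)) has_derivative
      (\<lambda>k. ((2 * v y t) *\<^sub>R g y t - M *\<^sub>R g (y + b t) t - (2 * (M\<^sup>2 / r\<^sup>2)) *\<^sub>R (y - y0)) \<bullet> k)) (at y)"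
      by (rule derivative_eq_intros refl u_x[OF t0] has_derivative_shift[OF u_x[OF t0]] dn)+
         (simp add: fun_eq_iff inner_diff_left algebra_simps)
    show "((\<lambda>y. (2 * v y t) *\<^sub>R g y t - M *\<^sub>R g (y + b t) t - (2 * (M\<^sup>2 / r\<^sup>2)) *\<^sub>R (y - y0)) has_derivative
      (\<lambda>k. (2 * v y t) *\<^sub>R H y t k + (2 * (g y t \<bullet> k)) *\<^sub>R g y t - M *\<^sub>R H (y + b t) t k - (2 * (M\<^sup>2 / r\<^sup>2)) *\<^sub>R k)) (at y)"
      by (rule derivative_eq_intros refl u_x[OF t0] u_xx[OF t0] has_derivative_shift[OF u_xx[OF t0]])+
         (simp add: fun_eq_iff algebra_simps)
    define X where "X = g y t"
    define Y where "Y = g (y + b t) t"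
    define \<zeta> where "\<zeta> = (2 * (M\<^sup>2 / r\<^sup>2)) *\<^sub>R (y - y0)"
    assume 0: "(2 * v y t) *\<^sub>R g y t - M *\<^sub>R g (y + b t) t - (2 * (M\<^sup>2 / r\<^sup>2)) *\<^sub>R (y - y0) = 0"
      and L: "(\<Sum>i\<in>Basis. ((2 * v y t) *\<^sub>R H y t i + (2 * (g y t \<bullet> i)) *\<^sub>R g y t - M *\<^sub>R H (y + b t) t i - (2 * (M\<^sup>2 / r\<^sup>2)) *\<^sub>R i) \<bullet> i) \<le> 0"
      and T: "0 \<le> 2 * v y t * vt y t - M * (vt (y + b t) t + g (y + b t) t \<bullet> ((1/\<theta>) *\<^sub>R h)) - a"
    have XX: "(\<Sum>i\<in>Basis. 2 * (X \<bullet> i) * (X \<bullet> i)) = 2 * (norm X)\<^sup>2"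
      unfolding power2_norm_eq_inner by (subst euclidean_inner) (simp add: sum_distrib_left mult_ac)
    have "(\<Sum>i\<in>Basis. ((2 * v y t) *\<^sub>R H y t i + (2 * (X \<bullet> i)) *\<^sub>R X - M *\<^sub>R H (y + b t) t i - (2 * (M\<^sup>2 / r\<^sup>2)) *\<^sub>R i) \<bullet> i)
      = (\<Sum>i\<in>Basis. 2 * v y t * (H y t i \<bullet> i) + 2 * (X \<bullet> i) * (X \<bullet> i) - M * (H (y + b t) t i \<bullet> i) - 2 * (M\<^sup>2 / r\<^sup>2))"
      by (intro sum.cong refl) (simp add: inner_diff_left inner_add_left)
    also have "\<dots> = 2 * v y t * vt y t + 2 * (norm X)\<^sup>2 - M * vt (y + b t) t - 2 * n * M\<^sup>2 / r\<^sup>2"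
      unfolding heat[OF t0] XX[symmetric] by (simp add: sum.distrib sum_subtractf sum_distrib_left n_def)
    finally have L': "2 * v y t * vt y t - M * vt (y + b t) t \<le> 2 * n * M\<^sup>2 / r\<^sup>2 - 2 * (norm X)\<^sup>2"
      using L unfolding X_def by simp
    have MY: "M *\<^sub>R Y = (2 * v y t) *\<^sub>R X - \<zeta>"
      using 0 unfolding X_def Y_def \<zeta>_def by (simp add: algebra_simps)
    have "- (M * (Y \<bullet> ((1/\<theta>) *\<^sub>R h))) = - ((M *\<^sub>R Y) \<bullet> h) / \<theta>" by simp
    also have "\<dots> = (\<zeta> \<bullet> h - 2 * v y t * (X \<bullet> h)) / \<theta>" unfolding MY by (simp add: inner_diff_left)
    also have "\<dots> \<le> (2 * M\<^sup>2 / r * norm h + 2 * M * (norm X * norm h)) / \<theta>"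
    proof (intro divide_right_mono)
      have "norm \<zeta> \<le> 2 * (M\<^sup>2 / r\<^sup>2) * r"
      proof -
        have "norm \<zeta> = 2 * (M\<^sup>2 / r\<^sup>2) * norm (y - y0)" by (simp add: \<zeta>_def)
        also have "\<dots> \<le> 2 * (M\<^sup>2 / r\<^sup>2) * r"
          using yt(1) by (intro mult_left_mono) (auto simp: dist_norm norm_minus_commute)
        finally show ?thesis .
      qed
      also have "\<dots> = 2 * M\<^sup>2 / r" using assms(2) by (simp add: power2_eq_square)
      finally have "\<zeta> \<bullet> h \<le> 2 * M\<^sup>2 / r * norm h"
        by (meson mult_right_mono norm_cauchy_schwarz norm_ge_zero order_trans)
      moreover have "- (2 * v y t * (X \<bullet> h)) \<le> 2 * M * (norm X * norm h)"
      proof -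
        have "- (X \<bullet> h) \<le> norm X * norm h"
          using norm_cauchy_schwarz[of "- X" h] by simp
        then have "2 * v y t * - (X \<bullet> h) \<le> 2 * v y t * (norm X * norm h)"
          using pos[OF t0, of y] by (intro mult_left_mono) auto
        also have "\<dots> \<le> 2 * M * (norm X * norm h)"
          using M[of y t] yt by (intro mult_right_mono) (auto simp: dist_norm norm_minus_commute t1_def)
        finally show ?thesis by (simp only: mult_minus_right)
      qed
      ultimately show "\<zeta> \<bullet> h - 2 * v y t * (X \<bullet> h) \<le> 2 * M\<^sup>2 / r * norm h + 2 * M * (norm X * norm h)"
        by linarith
    qed (use assms in auto)
    also have "\<dots> = 2 * M\<^sup>2 * norm h / (r * \<theta>) + 2 * norm X * (M * norm h / \<theta>)"
      by (simp add: add_divide_distrib mult_ac)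
    finally have "a \<le> 2 * n * M\<^sup>2 / r\<^sup>2 - 2 * (norm X)\<^sup>2 + 2 * M\<^sup>2 * norm h / (r * \<theta>) + 2 * norm X * (M * norm h / \<theta>)"
      using T L' unfolding Y_def[symmetric] by (simp add: algebra_simps)
    moreover have "2 * norm X * (M * norm h / \<theta>) - 2 * (norm X)\<^sup>2 \<le> (M * norm h / \<theta>)\<^sup>2 / 2"
    proof -
      have "2 * a * b - 2 * a\<^sup>2 \<le> b\<^sup>2 / 2" for a b :: real
        using zero_le_power2[of "2 * a - b"] by (simp add: power2_eq_square algebra_simps)
      then show ?thesis .
    qed
    moreover have "a = (M * norm h / \<theta>)\<^sup>2 / 2 + 2 * n * M\<^sup>2 / r\<^sup>2 + 2 * M\<^sup>2 * norm h / (r * \<theta>) + \<epsilon> / \<theta>"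
      unfolding a_def by (simp add: algebra_simps power_divide power_mult_distrib)
    moreover have "\<epsilon> / \<theta> > 0" using \<epsilon> assms by simp
    ultimately show False by linarith
  next
    fix y assume "y \<in> cball y0 r"
    then have "v y t1 \<le> M" using M[of y t1] assms(3) by (simp add: t1_def dist_norm norm_minus_commute)
    then have "v y t1 * v y t1 \<le> M * v y t1"
      using pos[of t1 y] assms(1,3) by (intro mult_right_mono) (auto simp: t1_def)
    moreover have "M\<^sup>2 / r\<^sup>2 * (norm (y - y0))\<^sup>2 \<ge> 0" by simp
    moreover have "b t1 = 0" by (simp add: b_def)
    ultimately show "(v y t1)\<^sup>2 - M * v (y + b t1) t1 - M\<^sup>2 / r\<^sup>2 * (norm (y - y0))\<^sup>2 - a * (t1 - t1) \<le> 0"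
      unfolding power2_eq_square[of "v y t1"] \<open>b t1 = 0\<close> add_0_right diff_self mult_zero_right by linarith
  next
    fix y t assume yt: "dist y0 y = r" "t1 \<le> t" "t \<le> s"
    have t0: "t < 0" using yt assms by simp
    have "v y t \<le> M" using M[of y t] yt by (simp add: t1_def dist_norm norm_minus_commute)
    then have "(v y t)\<^sup>2 \<le> M\<^sup>2" using pos[OF t0, of y] by (intro power_mono) auto
    moreover have "M * v (y + b t) t \<ge> 0" using M0 pos[OF t0, of "y + b t"] by simp
    moreover have "M\<^sup>2 / r\<^sup>2 * (norm (y - y0))\<^sup>2 = M\<^sup>2"
      using yt(1) assms(2) by (simp add: dist_norm norm_minus_commute)
    moreover have "a \<ge> 0" unfolding a_def using \<epsilon> assms by (simp add: n_def)
    then have "a * (t - t1) \<ge> 0" using yt by simp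
    ultimately show "(v y t)\<^sup>2 - M * v (y + b t) t - M\<^sup>2 / r\<^sup>2 * (norm (y - y0))\<^sup>2 - a * (t - t1) \<le> 0" by linarith
  qed (use assms in \<open>auto simp: t1_def\<close>)
  moreover have "a * (s - t1) = M\<^sup>2 * ((norm h)\<^sup>2 / (2 * \<theta>) + 2 * n * \<theta> / r\<^sup>2 + 2 * norm h / r) + \<epsilon>"
    using assms(2,3) by (simp add: a_def t1_def field_simps power2_eq_square)
  moreover have "b s = h" using assms(3) by (simp add: b_def t1_def)
  ultimately show "(v y0 s)\<^sup>2 - M * v (y0 + h) s
    \<le> M\<^sup>2 * ((norm h)\<^sup>2 / (2 * \<theta>) + 2 * real DIM('a) * \<theta> / r\<^sup>2 + 2 * norm h / r) + \<epsilon>"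
    by (simp add: n_def)
qed

text \<open>The barrier is a Gaussian heat solution already spread to scale k at time s and
  normalised to 1 at (z,s). Subtracting its initial value at radius \<rho> makes the initial datum
  at most 1 inside that radius and nonpositive outside, where only v > 0 is known.\<close>

lemma gaussian_lower_bound:
  fixes x z :: 'a
  assumes "s < t" "t < 0" "0 < k" "0 < \<rho>" "0 \<le> c"
    and c: "\<And>y. norm (y - z) \<le> \<rho> \<Longrightarrow> c \<le> v y s"
  shows "c * (exp (- (real DIM('a) / 2) * ln ((t - s + k) / k) - (norm (x - z))\<^sup>2 / (4 * (t - s + k)))
     - exp (- \<rho>\<^sup>2 / (4 * k))) \<le> v x t"
proof (rule field_le_epsilon)
  fix \<epsilon> :: real assume \<epsilon>: "0 < \<epsilon>"
  define n where "n = real DIM('a)"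
  define \<kappa> where "\<kappa> = exp (- \<rho>\<^sup>2 / (4 * k))"
  define G where "G r t' = exp (- (n / 2) * ln ((t' - s + k) / k) - r / (4 * (t' - s + k)))" for r t'
  define \<eta> where "\<eta> = \<epsilon> / (t - s)"
  have \<eta>: "\<eta> > 0" using \<epsilon> assms(1) by (simp add: \<eta>_def)
  \<comment> \<open>At time t' the Gaussian is at most the subtracted value once r \<ge> \<rho>^2
    (t' - s + k)/k. This bound increases with t', so R is chosen for the final time and the lateral
    data are nonpositive throughout.\<close>
  define R where "R = max (norm (x - z)) (sqrt (\<rho>\<^sup>2 * (t - s + k) / k))"
  have R: "norm (x - z) \<le> R" by (simp add: R_def)
  have R2: "\<rho>\<^sup>2 * (t - s + k) / k \<le> R\<^sup>2"
  proof -
    have "\<rho>\<^sup>2 * (t - s + k) / k \<ge> 0" using assms by simp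
    then have "(sqrt (\<rho>\<^sup>2 * (t - s + k) / k))\<^sup>2 = \<rho>\<^sup>2 * (t - s + k) / k" by simp
    moreover have "(sqrt (\<rho>\<^sup>2 * (t - s + k) / k))\<^sup>2 \<le> R\<^sup>2"
      using assms by (intro power_mono) (auto simp: R_def)
    ultimately show ?thesis by simp
  qed
  have G_le: "G r t' \<le> \<kappa>" if "\<rho>\<^sup>2 * (t' - s + k) / k \<le> r" "s \<le> t'" for r t'
  proof -
    have w: "t' - s + k > 0" using that assms by simp
    have "n / 2 * ln ((t' - s + k) / k) \<ge> 0" using that assms by (simp add: n_def)
    moreover have "\<rho>\<^sup>2 / (4 * k) \<le> r / (4 * (t' - s + k))"
      using that(1) w assms(3) by (simp add: field_simps)
    ultimately show ?thesis by (simp add: G_def \<kappa>_def)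
  qed
  have "c * (G ((norm (x - z))\<^sup>2) t - \<kappa>) - v x t - \<eta> * (t - s) \<le> 0"
  proof (rule parabolic_max_principle[where a = s and b = t and c = z and R = R
       and f = "\<lambda>y t. c * (G ((norm (y - z))\<^sup>2) t - \<kappa>) - v y t - \<eta> * (t - s)"
       and ft = "\<lambda>y t. c * (G ((norm (y - z))\<^sup>2) t * (- n / (2 * (t - s + k)) + (norm (y - z))\<^sup>2 / (4 * (t - s + k)\<^sup>2))) - vt y t - \<eta>"
       and g = "\<lambda>y t. (2 * (c * (- G ((norm (y - z))\<^sup>2) t / (4 * (t - s + k))))) *\<^sub>R (y - z) - g y t"
       and H = "\<lambda>y t h. ((2 * (c * (- G ((norm (y - z))\<^sup>2) t / (4 * (t - s + k))))) *\<^sub>R h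
          + (4 * (c * (G ((norm (y - z))\<^sup>2) t / (16 * (t - s + k)\<^sup>2))) * ((y - z) \<bullet> h)) *\<^sub>R (y - z)) - H y t h"])
    show "continuous_on (cball z R \<times> {s..t}) (\<lambda>w. c * (G ((norm (fst w - z))\<^sup>2) (snd w) - \<kappa>) - v (fst w) (snd w) - \<eta> * (snd w - s))"
      unfolding G_def using assms by (intro continuous_intros) auto
  next
    fix y t' assume yt: "y \<in> ball z R" "s < t'" "t' \<le> t"
    have t0: "t' < 0" using yt assms by simp
    have w: "t' - s + k > 0" using yt assms by simp
    have Gt: "(G r has_real_derivative G r t' * (- n / (2 * (t' - s + k)) + r / (4 * (t' - s + k)\<^sup>2))) (at t')" for r
    proof -
      have d1: "((\<lambda>t'. - (n / 2) * ln ((t' - s + k) / k)) has_real_derivative - n / (2 * (t' - s + k))) (at t')"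
        using w assms(3) by (auto intro!: derivative_eq_intros simp: field_simps)
      have d2: "((\<lambda>t'. r / (4 * (t' - s + k))) has_real_derivative - (r / (4 * (t' - s + k)\<^sup>2))) (at t')"
      proof -
        have d: "((\<lambda>t'. 4 * (t' - s + k)) has_real_derivative 4) (at t')"
          by (auto intro!: derivative_eq_intros)
        have "(0 * (4 * W) - r * 4) / ((4 * W) * (4 * W)) = - (r / (4 * W\<^sup>2))" for W :: real
          by (simp add: power2_eq_square)
        from DERIV_cong[OF DERIV_divide[OF DERIV_const d] this] w show ?thesis by simp
      qed
      have "G r = (\<lambda>t'. exp (- (n / 2) * ln ((t' - s + k) / k) - r / (4 * (t' - s + k))))"
        by (simp add: G_def fun_eq_iff)
      then show ?thesis
        using DERIV_fun_exp[OF DERIV_diff[OF d1 d2]] by simp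
    qed
    have Gr0: "((\<lambda>r. G r t') has_real_derivative G r t' * (- 1 / (4 * (t' - s + k)))) (at r)" for r
      unfolding G_def by (rule DERIV_fun_exp) (use w in \<open>auto intro!: derivative_eq_intros\<close>)
    have Gr: "((\<lambda>r. c * (G r t' - \<kappa>)) has_real_derivative c * (- G r t' / (4 * (t' - s + k)))) (at r)" for r
      by (rule DERIV_cong[OF DERIV_cmult[OF DERIV_diff[OF Gr0 DERIV_const]]]) simp
    have Grr: "((\<lambda>r. c * (- G r t' / (4 * (t' - s + k)))) has_real_derivative c * (G r t' / (16 * (t' - s + k)\<^sup>2))) (at r)" for r
      by (rule DERIV_cong[OF DERIV_cmult[OF DERIV_cdivide[OF DERIV_minus[OF Gr0]]]]) (simp add: power2_eq_square, simp add: algebra_simps)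
    show "((\<lambda>t'. c * (G ((norm (y - z))\<^sup>2) t' - \<kappa>) - v y t' - \<eta> * (t' - s)) has_real_derivative
       c * (G ((norm (y - z))\<^sup>2) t' * (- n / (2 * (t' - s + k)) + (norm (y - z))\<^sup>2 / (4 * (t' - s + k)\<^sup>2))) - vt y t' - \<eta>) (at t')"
      by (rule derivative_eq_intros refl Gt u_t[OF t0])+ simp
    show "((\<lambda>y. c * (G ((norm (y - z))\<^sup>2) t' - \<kappa>) - v y t' - \<eta> * (t' - s)) has_derivative
       (\<lambda>h. ((2 * (c * (- G ((norm (y - z))\<^sup>2) t' / (4 * (t' - s + k))))) *\<^sub>R (y - z) - g y t') \<bullet> h)) (at y)"
      using has_derivative_diff[OF has_derivative_diff[OF radial_has_derivative[where G' = "\<lambda>r. c * (- G r t' / (4 * (t' - s + k)))", OF Gr] u_x[OF t0]]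
         has_derivative_const[of "\<eta> * (t' - s)"]]
      by (simp only: inner_diff_left diff_0_right)
    show "((\<lambda>y. (2 * (c * (- G ((norm (y - z))\<^sup>2) t' / (4 * (t' - s + k))))) *\<^sub>R (y - z) - g y t') has_derivative
       (\<lambda>h. ((2 * (c * (- G ((norm (y - z))\<^sup>2) t' / (4 * (t' - s + k))))) *\<^sub>R h
          + (4 * (c * (G ((norm (y - z))\<^sup>2) t' / (16 * (t' - s + k)\<^sup>2))) * ((y - z) \<bullet> h)) *\<^sub>R (y - z)) - H y t' h)) (at y)"
      by (rule has_derivative_diff[OF radial_gradient_has_derivative[where G' = "\<lambda>r. c * (- G r t' / (4 * (t' - s + k)))"
          and G'' = "\<lambda>r. c * (G r t' / (16 * (t' - s + k)\<^sup>2))", OF Grr] u_xx[OF t0]])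
    define G0 where "G0 = G ((norm (y - z))\<^sup>2) t'"
    assume L: "(\<Sum>i\<in>Basis. (((2 * (c * (- G ((norm (y - z))\<^sup>2) t' / (4 * (t' - s + k))))) *\<^sub>R i
          + (4 * (c * (G ((norm (y - z))\<^sup>2) t' / (16 * (t' - s + k)\<^sup>2))) * ((y - z) \<bullet> i)) *\<^sub>R (y - z)) - H y t' i) \<bullet> i) \<le> 0"
      and T: "0 \<le> c * (G ((norm (y - z))\<^sup>2) t' * (- n / (2 * (t' - s + k)) + (norm (y - z))\<^sup>2 / (4 * (t' - s + k)\<^sup>2))) - vt y t' - \<eta>"
    have "2 * n * (c * (- G0 / (4 * (t' - s + k)))) + 4 * (norm (y - z))\<^sup>2 * (c * (G0 / (16 * (t' - s + k)\<^sup>2))) - vt y t' \<le> 0"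
      using L unfolding heat[OF t0] n_def G0_def
      by (simp only: inner_diff_left sum_subtractf radial_laplacian[unfolded inner_diff_left])
    moreover have "2 * n * (c * (- G0 / (4 * (t' - s + k)))) + 4 * (norm (y - z))\<^sup>2 * (c * (G0 / (16 * (t' - s + k)\<^sup>2)))
       = c * (G0 * (- n / (2 * (t' - s + k)) + (norm (y - z))\<^sup>2 / (4 * (t' - s + k)\<^sup>2)))"
    proof -
      have "2 * n * (c * (- G0 / (4 * W))) + 4 * N * (c * (G0 / (16 * W\<^sup>2)))
         = c * (G0 * (- n / (2 * W) + N / (4 * W\<^sup>2)))" for W N :: real
        by (simp add: algebra_simps)
      then show ?thesis .
    qed
    ultimately show False using T \<eta> unfolding G0_def by linarith
  next
    fix y assume "y \<in> cball z R"
    show "c * (G ((norm (y - z))\<^sup>2) s - \<kappa>) - v y s - \<eta> * (s - s) \<le> 0"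
    proof (cases "norm (y - z) \<le> \<rho>")
      case True
      have "G ((norm (y - z))\<^sup>2) s \<le> 1" unfolding G_def using assms(3) by simp
      moreover have "\<kappa> > 0" by (simp add: \<kappa>_def)
      ultimately have "G ((norm (y - z))\<^sup>2) s - \<kappa> \<le> 1" by linarith
      then have "c * (G ((norm (y - z))\<^sup>2) s - \<kappa>) \<le> c * 1"
        using assms(5) by (rule mult_left_mono)
      then show ?thesis using c[OF True] by simp
    next
      case False
      then have "\<rho>\<^sup>2 \<le> (norm (y - z))\<^sup>2" using assms(4) by (intro power_mono) auto
      then have "G ((norm (y - z))\<^sup>2) s - \<kappa> \<le> 0" using G_le[of s "(norm (y - z))\<^sup>2"] assms(3) by simp
      then have "c * (G ((norm (y - z))\<^sup>2) s - \<kappa>) \<le> 0" using assms(5) by (intro mult_nonneg_nonpos) auto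
      then show ?thesis using pos[of s y] assms(1,2) by simp
    qed
  next
    fix y t' assume yt: "dist z y = R" "s \<le> t'" "t' \<le> t"
    have "\<rho>\<^sup>2 * (t' - s + k) / k \<le> \<rho>\<^sup>2 * (t - s + k) / k"
      using yt assms(3) by (intro divide_right_mono mult_left_mono) auto
    also have "\<dots> \<le> (norm (y - z))\<^sup>2" using R2 yt(1) by (simp add: dist_norm norm_minus_commute)
    finally have "G ((norm (y - z))\<^sup>2) t' - \<kappa> \<le> 0" using G_le[of t'] yt by simp
    then have "c * (G ((norm (y - z))\<^sup>2) t' - \<kappa>) \<le> 0" using assms(5) by (intro mult_nonneg_nonpos) auto
    moreover have "\<eta> * (t' - s) \<ge> 0" using \<eta> yt by simp
    ultimately show "c * (G ((norm (y - z))\<^sup>2) t' - \<kappa>) - v y t' - \<eta> * (t' - s) \<le> 0"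
      using pos[of t' y] yt assms(2) by linarith
  qed (use R assms in \<open>auto simp: dist_norm norm_minus_commute\<close>)
  moreover have "\<eta> * (t - s) = \<epsilon>" using assms(1) by (simp add: \<eta>_def)
  ultimately show "c * (exp (- (real DIM('a) / 2) * ln ((t - s + k) / k) - (norm (x - z))\<^sup>2 / (4 * (t - s + k)))
     - exp (- \<rho>\<^sup>2 / (4 * k))) \<le> v x t + \<epsilon>" by (simp add: G_def n_def \<kappa>_def)
qed

text \<open>Maximise \<open>v d^m\<close>, where \<open>d\<close> is the parabolic distance to the boundary of the cylinder.\<close>

lemma parabolic_picking:
  fixes y :: 'a
  assumes "s < 0" "0 < R" "0 < m"
  obtains d z \<sigma> where "0 < d" "norm (z - y) + d \<le> R" "s - R\<^sup>2 + d\<^sup>2 \<le> \<sigma>" "\<sigma> \<le> s"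
    "v y s * R ^ m \<le> v z \<sigma> * d ^ m"
    "\<forall>z' \<sigma>'. norm (z' - z) \<le> d/2 \<longrightarrow> \<sigma> - (d/2)\<^sup>2 \<le> \<sigma>' \<longrightarrow> \<sigma>' \<le> \<sigma> \<longrightarrow> v z' \<sigma>' \<le> 2 ^ m * v z \<sigma>"
proof -
  define \<delta> where "\<delta> z \<sigma> = min (R - norm (z - y)) (sqrt (\<sigma> - s + R\<^sup>2))" for z \<sigma>
  let ?K = "cball y R \<times> {s - R\<^sup>2..s}"
  have "compact ?K" by (intro compact_Times) auto
  moreover have ys: "(y, s) \<in> ?K" using assms by auto
  moreover have "continuous_on ?K (\<lambda>w. v (fst w) (snd w) * \<delta> (fst w) (snd w) ^ m)"
    unfolding \<delta>_def using assms(1) by (intro continuous_intros) auto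
  ultimately obtain w where w: "w \<in> ?K"
    and wmax: "\<And>w'. w' \<in> ?K \<Longrightarrow> v (fst w') (snd w') * \<delta> (fst w') (snd w') ^ m \<le> v (fst w) (snd w) * \<delta> (fst w) (snd w) ^ m"
    using continuous_attains_sup[of ?K "\<lambda>w. v (fst w) (snd w) * \<delta> (fst w) (snd w) ^ m"] by blast
  define z \<sigma> d where "z = fst w" and "\<sigma> = snd w" and "d = \<delta> z \<sigma>"
  have K: "norm (z - y) \<le> R" "s - R\<^sup>2 \<le> \<sigma>" "\<sigma> \<le> s"
    using w by (auto simp: z_def \<sigma>_def dist_norm norm_minus_commute)
  have \<sigma>0: "\<sigma> < 0" using K assms by simp
  have max: "v z' \<sigma>' * \<delta> z' \<sigma>' ^ m \<le> v z \<sigma> * d ^ m"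
    if "norm (z' - y) \<le> R" "s - R\<^sup>2 \<le> \<sigma>'" "\<sigma>' \<le> s" for z' \<sigma>'
    using wmax[of "(z', \<sigma>')"] that by (simp add: z_def \<sigma>_def d_def dist_norm norm_minus_commute)
  have "\<delta> y s = R" using assms by (simp add: \<delta>_def)
  then have big: "v y s * R ^ m \<le> v z \<sigma> * d ^ m" using max[of y s] assms by simp
  have "0 < v y s * R ^ m" using pos assms by simp
  with big have "0 < v z \<sigma> * d ^ m" by linarith
  then have "d \<noteq> 0" using assms(3) by (auto simp: zero_power)
  moreover have "d \<ge> 0" using K by (auto simp: d_def \<delta>_def)
  ultimately have d: "d > 0" by simp
  have dz: "norm (z - y) + d \<le> R" by (simp add: d_def \<delta>_def)
  have "d \<le> sqrt (\<sigma> - s + R\<^sup>2)" by (simp add: d_def \<delta>_def)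
  then have ds: "d\<^sup>2 \<le> \<sigma> - s + R\<^sup>2" using d K(2) power_mono[of d "sqrt (\<sigma> - s + R\<^sup>2)" 2] by simp
  \<comment> \<open>A parabolic move of size d/2 leaves a distance of at least d/2 to the boundary,
    so maximality costs only the factor 2^m.\<close>
  have "v z' \<sigma>' \<le> 2 ^ m * v z \<sigma>"
    if "norm (z' - z) \<le> d/2" "\<sigma> - (d/2)\<^sup>2 \<le> \<sigma>'" "\<sigma>' \<le> \<sigma>" for z' \<sigma>'
  proof -
    have "norm (z' - y) \<le> norm (z' - z) + norm (z - y)"
      by (metis diff_add_cancel add_diff_eq norm_triangle_ineq)
    then have n: "d/2 \<le> R - norm (z' - y)" using that dz by linarith
    have "(d/2)\<^sup>2 \<le> \<sigma>' - s + R\<^sup>2" using that(2) ds zero_le_power2[of d] unfolding power_divide power2_eq_square[of 2] by linarith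
    then have "d/2 \<le> sqrt (\<sigma>' - s + R\<^sup>2)" by (rule real_le_rsqrt)
    with n have dd: "d/2 \<le> \<delta> z' \<sigma>'" by (simp add: \<delta>_def)
    have "\<sigma>' - s + R\<^sup>2 \<ge> 0" using \<open>(d/2)\<^sup>2 \<le> _\<close> by (meson order_trans zero_le_power2)
    then have m: "v z' \<sigma>' * \<delta> z' \<sigma>' ^ m \<le> v z \<sigma> * d ^ m" using max[of z' \<sigma>'] n d that(3) K(3) by simp
    have "v z' \<sigma>' * (d/2) ^ m \<le> v z' \<sigma>' * \<delta> z' \<sigma>' ^ m"
      using pos[of \<sigma>' z'] that \<sigma>0 d dd by (intro mult_left_mono power_mono) auto
    with m have "v z' \<sigma>' * (d/2) ^ m \<le> v z \<sigma> * d ^ m" by linarith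
    then show ?thesis using d by (simp add: power_divide field_simps)
  qed
  moreover have "s - R\<^sup>2 + d\<^sup>2 \<le> \<sigma>" using ds by simp
  ultimately show thesis using that[OF d dz _ K(3) big] by blast
qed

end

text \<open>A is sized so that ln 2, the logarithm and E each take at most A/(12 r), together the
  available A/(4 r). The part 144 n^2 gives sqrt A \<ge> 12 n, which matches ln (1 + Z^2) \<le> 2 Z
  for Z = sqrt A / r.\<close>

lemma powr_log_exponent_choice:
  fixes n A E r :: real
  assumes "1 \<le> n" "0 \<le> E" "0 < r" "r \<le> 1" and A: "A = 144 * n\<^sup>2 + 12 + 12 * E"
  shows "ln 2 + n / 2 * ln (1 + A / r\<^sup>2) + E \<le> A / r / 4"
proof -
  have A1: "A \<ge> 12" "A \<ge> 12 * E" "A \<ge> (12 * n)\<^sup>2" using assms by (auto simp: power_mult_distrib)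
  have Ar: "A \<le> A / r" using assms(3,4) A1 by (simp add: field_simps mult_left_le)
  define Z where "Z = sqrt A / r"
  have sA: "sqrt A \<ge> 12 * n" using A1(3) by (rule real_le_rsqrt)
  have Z: "Z > 0" using A1 assms(3) by (simp add: Z_def)
  have "n / 2 * ln (1 + A / r\<^sup>2) \<le> A / r / 12"
  proof -
    have "A / r\<^sup>2 = Z\<^sup>2" using A1 by (simp add: Z_def power_divide)
    then have "1 + A / r\<^sup>2 \<le> (1 + Z)\<^sup>2" using Z by (simp add: power2_eq_square algebra_simps)
    then have "ln (1 + A / r\<^sup>2) \<le> ln ((1 + Z)\<^sup>2)"
      using A1 by (subst ln_le_cancel_iff) (use Z in \<open>auto intro: add_pos_nonneg\<close>)
    also have "\<dots> = 2 * ln (1 + Z)" using Z by (simp add: ln_realpow)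
    also have "\<dots> \<le> 2 * Z" using ln_add_one_self_le_self[of Z] Z by simp
    finally have "n / 2 * ln (1 + A / r\<^sup>2) \<le> n / 2 * (2 * Z)" using assms(1) by (intro mult_left_mono) auto
    also have "\<dots> \<le> sqrt A / 12 * Z"
      using sA Z by (simp add: mult_right_mono)
    also have "\<dots> = A / r / 12" using A1 by (simp add: Z_def)
    finally show ?thesis .
  qed
  moreover have "ln 2 \<le> (1::real)" using ln_le_minus_one[of "2::real"] by simp
  ultimately show ?thesis using A1 Ar by (simp add: field_simps)
qed

context heat begin

text \<open>The scale k is chosen by \<open>powr_log_exponent_choice\<close> so that the subtracted
  tail is at most half of the Gaussian. The point of the result is that the loss is only polynomial
  in \<rho>, of degree 2 N; an exponential loss could not be made up for by
  \<open>parabolic_picking\<close>.\<close>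

lemma gaussian_spread:
  fixes x z :: 'a
  assumes "s < t" "t < 0" "0 < \<rho>" "\<rho>\<^sup>2 \<le> t - s" "0 \<le> c"
    and c: "\<And>y. norm (y - z) \<le> \<rho> \<Longrightarrow> c \<le> v y s"
  defines "N \<equiv> DIM('a)" and "E \<equiv> (norm (x - z))\<^sup>2 / (4 * (t - s))"
  shows "c / 2 * (\<rho>\<^sup>2 / (t - s)) ^ N * exp (- (N / 2 * (144 * (real N)\<^sup>2 + 12 + 12 * E)) - E) \<le> v x t"
proof -
  define A where "A = 144 * (real N)\<^sup>2 + 12 + 12 * E"
  define \<tau> where "\<tau> = t - s"
  have \<tau>: "\<tau> > 0" using assms(1) by (simp add: \<tau>_def)
  define r where "r = \<rho>\<^sup>2 / \<tau>"
  have N: "1 \<le> real N" using DIM_positive[where 'a='a] by (simp add: N_def Suc_leI)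
  have E: "E \<ge> 0" using assms(1) by (simp add: E_def)
  have r: "0 < r" "r \<le> 1" using assms(3,4) \<tau> by (auto simp: r_def \<tau>_def)
  have A: "A > 0" using E zero_le_power2[of "real N"] unfolding A_def by linarith
  define X where "X = A / r\<^sup>2"
  have X: "X > 0" using A r by (simp add: X_def)
  define k where "k = \<tau> / X"
  have k: "k > 0" using X \<tau> by (simp add: k_def)
  have kX: "(t - s + k) / k = 1 + X" using k X \<tau> by (simp add: k_def \<tau>_def[symmetric] field_simps)
  have "\<rho>\<^sup>2 / (4 * k) = A / r / 4"
    using X \<tau> r by (simp add: k_def X_def r_def power2_eq_square field_simps)
  then have tail: "ln 2 + N / 2 * ln (1 + X) + E \<le> \<rho>\<^sup>2 / (4 * k)"
    using powr_log_exponent_choice[OF N E r A_def] by (simp add: X_def)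
  define P where "P = exp (- (N / 2 * ln (1 + X)) - E)"
  have "exp (- \<rho>\<^sup>2 / (4 * k)) \<le> exp (- (ln 2 + N / 2 * ln (1 + X) + E))" using tail by simp
  also have "\<dots> = exp (- ln 2) * P" unfolding P_def by (simp add: exp_add[symmetric])
  also have "\<dots> = P / 2" by (simp add: exp_minus)
  finally have t2: "exp (- \<rho>\<^sup>2 / (4 * k)) \<le> P / 2" .
  have "(norm (x - z))\<^sup>2 / (4 * (t - s + k)) \<le> E"
    unfolding E_def using assms(1) k by (intro divide_left_mono) auto
  then have "P \<le> exp (- (N / 2) * ln ((t - s + k) / k) - (norm (x - z))\<^sup>2 / (4 * (t - s + k)))"
    unfolding kX P_def by simp
  with t2 have "P / 2 \<le> exp (- (N / 2) * ln ((t - s + k) / k) - (norm (x - z))\<^sup>2 / (4 * (t - s + k)))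
     - exp (- \<rho>\<^sup>2 / (4 * k))" by linarith
  then have "c * (P / 2) \<le> c * (exp (- (N / 2) * ln ((t - s + k) / k) - (norm (x - z))\<^sup>2 / (4 * (t - s + k)))
     - exp (- \<rho>\<^sup>2 / (4 * k)))"
    using assms(5) by (rule mult_left_mono)
  also have "\<dots> \<le> v x t" using gaussian_lower_bound[OF assms(1,2) k assms(3,5) c] by (simp add: N_def)
  finally have low: "c * (P / 2) \<le> v x t" .
  have "r ^ N * exp (- (N / 2 * A) - E) \<le> P"
  proof -
    have "1 + X \<le> (1 + A) / r\<^sup>2" using r by (simp add: X_def add_divide_distrib power_le_one)
    then have "ln (1 + X) \<le> ln ((1 + A) / r\<^sup>2)" using X A r by (subst ln_le_cancel_iff) auto
    also have "\<dots> = ln (1 + A) - 2 * ln r" using A r by (simp add: ln_div ln_realpow)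
    also have "\<dots> \<le> A - 2 * ln r" using ln_add_one_self_le_self[of A] A by simp
    finally have "N / 2 * ln (1 + X) \<le> N / 2 * (A - 2 * ln r)" using N by (intro mult_left_mono) auto
    then have "N * ln r + (- (N / 2 * A) - E) \<le> - (N / 2 * ln (1 + X)) - E" by (simp add: algebra_simps)
    then have "exp (N * ln r + (- (N / 2 * A) - E)) \<le> P" by (simp add: P_def)
    moreover have "exp (N * ln r) = r ^ N" using r by (simp add: exp_of_nat_mult)
    ultimately show ?thesis by (simp add: exp_add)
  qed
  then have "c / 2 * (r ^ N * exp (- (N / 2 * A) - E)) \<le> c / 2 * P"
    using assms(5) by (intro mult_left_mono) auto
  with low show ?thesis by (simp add: r_def \<tau>_def A_def)
qed

text \<open>Around the picked point v is at most a constant times its value there, on a cylinder of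
  size d/2. Hence \<open>square_minus_shift_le\<close> bounds v below on a ball of radius
  proportional to d, and \<open>gaussian_spread\<close> carries this to (x,t). The unknown d cancels
  in the end.\<close>

lemma harnack:
  obtains C where "0 \<le> C"
    "\<And>x y s t. s < t \<Longrightarrow> t < 0 \<Longrightarrow> v y s \<le> exp (C * (1 + (norm (x - y))\<^sup>2 / (t - s))) * v x t"
proof -
  define N where "N = DIM('a)"
  have N: "1 \<le> real N" "N > 0" using DIM_positive[where 'a='a] by (auto simp: N_def Suc_leI)
  \<comment> \<open>The exponent for which d cancels: picking gives v(y,s) \<le> v0 (d/R)^m, and
    spreading returns (\<rho>^2/\<tau>)^N with \<rho> proportional to d.\<close>
  define m where "m = 2 * N"
  \<comment> \<open>Small enough that \<open>square_minus_shift_le\<close> with M = 2^m v0 loses at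
    most v0^2/2.\<close>
  define \<omega> where "\<omega> = 1 / (4 ^ m * (16 * real N))"
  have \<omega>: "0 < \<omega>" "\<omega> \<le> 1"
  proof -
    show "0 < \<omega>" using N by (simp add: \<omega>_def)
    have "(1::real) * 1 \<le> 4 ^ m * (16 * real N)" using N by (intro mult_mono) auto
    then show "\<omega> \<le> 1" unfolding \<omega>_def using N by (subst divide_le_eq_1_pos) auto
  qed
  \<comment> \<open>The power of 2 collects the factor \<open>2 ^ (m + 1)\<close> of the lower bound
    on the ball and the 2 of \<open>gaussian_spread\<close>; 8/\<omega>^2 comes from \<rho> =
    \<omega> d/2 and \<tau> \<le> 2 (t - s).\<close>
  define K where "K = 2 ^ (m + 2) * (8 / \<omega>\<^sup>2) ^ N"
  have K: "K \<ge> 1"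
  proof -
    have "\<omega>\<^sup>2 \<le> 1" using \<omega> by (simp add: power_le_one)
    then have "8 / \<omega>\<^sup>2 \<ge> 1" using \<omega> by (simp add: field_simps)
    then have "(1::real) * 1 \<le> K" unfolding K_def by (intro mult_mono one_le_power) auto
    then show ?thesis by simp
  qed
  define C where "C = ln K + N / 2 * (144 * (real N)\<^sup>2 + 12) + (6 * real N + 1)"
  have C: "C \<ge> 0" using K by (simp add: C_def)
  have "v y s \<le> exp (C * (1 + (norm (x - y))\<^sup>2 / (t - s))) * v x t" if st: "s < t" "t < 0" for x y s t
  proof -
    define R where "R = sqrt (t - s)"
    have R: "R > 0" "R\<^sup>2 = t - s" using st by (auto simp: R_def)
    have s0: "s < 0" and m0: "0 < m" using st N by (auto simp: m_def)
    obtain d z \<sigma> where d: "0 < d" "norm (z - y) + d \<le> R" "s - R\<^sup>2 + d\<^sup>2 \<le> \<sigma>" "\<sigma> \<le> s"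
      and big: "v y s * R ^ m \<le> v z \<sigma> * d ^ m"
      and cyl: "\<forall>z' \<sigma>'. norm (z' - z) \<le> d/2 \<longrightarrow> \<sigma> - (d/2)\<^sup>2 \<le> \<sigma>' \<longrightarrow> \<sigma>' \<le> \<sigma> \<longrightarrow> v z' \<sigma>' \<le> 2 ^ m * v z \<sigma>"
      by (rule parabolic_picking[OF s0 R(1) m0, of y])
    define r where "r = d/2"
    have r: "r > 0" using d by (simp add: r_def)
    define v0 where "v0 = v z \<sigma>"
    have v0: "v0 > 0" using pos[of \<sigma> z] d st by (simp add: v0_def)
    define \<rho> where "\<rho> = \<omega> * r"
    have \<rho>: "\<rho> > 0" using \<omega> r by (simp add: \<rho>_def)
    have low: "v0 / 2 ^ (m + 1) \<le> v y' \<sigma>" if "norm (y' - z) \<le> \<rho>" for y'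
    proof -
      define h where "h = y' - z"
      have h: "norm h \<le> \<omega> * r" using that by (simp add: h_def \<rho>_def)
      have "v0\<^sup>2 - 2 ^ m * v0 * v (z + h) \<sigma>
        \<le> (2 ^ m * v0)\<^sup>2 * ((norm h)\<^sup>2 / (2 * (\<omega> * r\<^sup>2)) + 2 * real DIM('a) * (\<omega> * r\<^sup>2) / r\<^sup>2 + 2 * norm h / r)"
        unfolding v0_def
      proof (rule square_minus_shift_le)
        fix y'' t' assume *: "norm (y'' - z) \<le> r" "\<sigma> - \<omega> * r\<^sup>2 \<le> t'" "t' \<le> \<sigma>"
        have "\<omega> * r\<^sup>2 \<le> 1 * r\<^sup>2" using \<omega> by (intro mult_right_mono) auto
        then show "v y'' t' \<le> 2 ^ m * v z \<sigma>" using * cyl by (simp add: r_def)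
      qed (use \<omega> r d st in auto)
      also have "\<dots> \<le> (2 ^ m * v0)\<^sup>2 * (\<omega> / 2 + 2 * real N * \<omega> + 2 * \<omega>)"
      proof (intro mult_left_mono add_mono)
        have "(norm h)\<^sup>2 \<le> (\<omega> * r)\<^sup>2" using h by (intro power_mono) auto
        then show "(norm h)\<^sup>2 / (2 * (\<omega> * r\<^sup>2)) \<le> \<omega> / 2"
          using \<omega> r by (simp add: field_simps power2_eq_square)
        show "2 * real DIM('a) * (\<omega> * r\<^sup>2) / r\<^sup>2 \<le> 2 * real N * \<omega>" using r by (simp add: N_def)
        show "2 * norm h / r \<le> 2 * \<omega>" using h r by (simp add: field_simps)
      qed auto
      also have "\<dots> = v0\<^sup>2 * (4 ^ m * \<omega> * (2 * real N + 5/2))"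
        by (simp add: power_mult_distrib algebra_simps power_even_eq[symmetric])
           (simp add: power_mult power2_eq_square power_mult_distrib[symmetric])
      also have "4 ^ m * \<omega> * (2 * real N + 5/2) \<le> 1 / 2"
        using N by (simp add: \<omega>_def field_simps)
      finally have "v0\<^sup>2 - 2 ^ m * v0 * v (z + h) \<sigma> \<le> v0\<^sup>2 * (1 / 2)" by (simp add: mult_left_mono)
      then have "v0 * v0 \<le> v0 * (2 * 2 ^ m * v (z + h) \<sigma>)" by (simp add: power2_eq_square mult_ac)
      then have "v0 \<le> 2 * 2 ^ m * v (z + h) \<sigma>" using v0 by simp
      then show ?thesis by (simp add: h_def field_simps)
    qed
    define \<tau> where "\<tau> = t - \<sigma>"
    have "s - R\<^sup>2 \<le> \<sigma>" using d(3) zero_le_power2[of d] by linarith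
    then have \<tau>: "t - s \<le> \<tau>" "\<tau> \<le> 2 * (t - s)" "\<tau> > 0" using d(4) R st by (auto simp: \<tau>_def)
    have dR: "d \<le> R" using d(2) norm_ge_zero[of "z - y"] by linarith
    have "\<rho>\<^sup>2 \<le> \<tau>"
    proof -
      have "\<rho> \<le> 1 * R" unfolding \<rho>_def r_def using \<omega> d dR by (intro mult_mono) auto
      then have "\<rho>\<^sup>2 \<le> R\<^sup>2" using \<rho> by (intro power_mono) auto
      then show ?thesis using R \<tau> by simp
    qed
    define E where "E = (norm (x - z))\<^sup>2 / (4 * \<tau>)"
    have sp: "v0 / 2 ^ (m + 1) / 2 * (\<rho>\<^sup>2 / \<tau>) ^ N * exp (- (N / 2 * (144 * (real N)\<^sup>2 + 12 + 12 * E)) - E) \<le> v x t"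
      using gaussian_spread[of \<sigma> t \<rho> "v0 / 2 ^ (m + 1)" z x] low d st \<rho> v0 \<open>\<rho>\<^sup>2 \<le> \<tau>\<close>
      by (simp add: \<tau>_def E_def N_def)
    define e where "e = (norm (x - y))\<^sup>2 / (t - s)"
    have e: "e \<ge> 0" using st by (simp add: e_def)
    have E1: "E \<le> 1 + e"
    proof -
      have "norm (x - z) \<le> norm (x - y) + norm (y - z)" by (metis diff_add_cancel add_diff_eq norm_triangle_ineq)
      also have "norm (y - z) \<le> R" using d by (simp add: norm_minus_commute)
      finally have "(norm (x - z))\<^sup>2 \<le> (norm (x - y) + R)\<^sup>2" by (intro power_mono) auto
      also have "\<dots> \<le> 2 * (norm (x - y))\<^sup>2 + 2 * R\<^sup>2"
        using zero_le_power2[of "norm (x - y) - R"] by (simp add: power2_eq_square algebra_simps)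
      finally have "E \<le> (2 * (norm (x - y))\<^sup>2 + 2 * R\<^sup>2) / (4 * (t - s))"
        unfolding E_def using \<tau> st by (intro frac_le) auto
      also have "\<dots> = (e + 1) / 2" unfolding R(2) e_def using st by (simp add: field_simps)
      finally show ?thesis using e by simp
    qed
    define Q where "Q = ln K + N / 2 * (144 * (real N)\<^sup>2 + 12 + 12 * E) + E"
    have Q: "Q \<le> C * (1 + e)"
    proof -
      define c0 where "c0 = ln K + N / 2 * (144 * (real N)\<^sup>2 + 12)"
      have "c0 \<ge> 0" using K by (simp add: c0_def)
      have "Q = c0 + (6 * real N + 1) * E" by (simp add: Q_def c0_def algebra_simps)
      also have "\<dots> \<le> c0 * (1 + e) + (6 * real N + 1) * (1 + e)"
        using E1 e \<open>c0 \<ge> 0\<close> by (intro add_mono mult_left_mono) (auto simp: mult_le_cancel_left1)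
      also have "\<dots> = C * (1 + e)" by (simp add: C_def c0_def algebra_simps)
      finally show ?thesis .
    qed
    have "v y s * (1 / K) \<le> v0 / 2 ^ (m + 1) / 2 * (\<rho>\<^sup>2 / \<tau>) ^ N"
    proof -
      have "v y s * (R\<^sup>2) ^ N \<le> v0 * (d\<^sup>2) ^ N" using big by (simp add: m_def v0_def power_mult)
      then have b: "v y s \<le> v0 * (d\<^sup>2 / R\<^sup>2) ^ N" using R(1) by (simp add: power_divide field_simps)
      have "\<omega>\<^sup>2 / 8 * (d\<^sup>2 / R\<^sup>2) = \<rho>\<^sup>2 / (2 * (t - s))"
        unfolding R(2) \<rho>_def r_def using st by (simp add: field_simps power2_eq_square)
      also have "\<dots> \<le> \<rho>\<^sup>2 / \<tau>" using \<tau> by (intro divide_left_mono) auto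
      finally have f: "(\<omega>\<^sup>2 / 8 * (d\<^sup>2 / R\<^sup>2)) ^ N \<le> (\<rho>\<^sup>2 / \<tau>) ^ N" by (intro power_mono) auto
      have "v y s * (1 / K) \<le> v0 * (d\<^sup>2 / R\<^sup>2) ^ N * (1 / K)" using b K by (intro mult_right_mono) auto
      also have "\<dots> = v0 / 2 ^ (m + 1) / 2 * (\<omega>\<^sup>2 / 8 * (d\<^sup>2 / R\<^sup>2)) ^ N"
        unfolding K_def power_mult_distrib by (simp add: power_divide mult_ac)
      also have "\<dots> \<le> v0 / 2 ^ (m + 1) / 2 * (\<rho>\<^sup>2 / \<tau>) ^ N" using f v0 by (intro mult_left_mono) auto
      finally show ?thesis .
    qed
    then have "v y s * (1 / K) * exp (- (N / 2 * (144 * (real N)\<^sup>2 + 12 + 12 * E)) - E) \<le> v x t"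
      by (intro order_trans[OF mult_right_mono sp]) auto
    moreover have "1 / K * exp (- (N / 2 * (144 * (real N)\<^sup>2 + 12 + 12 * E)) - E) = exp (- Q)"
    proof -
      have "exp (- Q) = exp (- ln K) * exp (- (N / 2 * (144 * (real N)\<^sup>2 + 12 + 12 * E)) - E)"
        unfolding Q_def by (simp add: exp_add[symmetric])
      also have "exp (- ln K) = 1 / K" using K by (simp add: exp_minus divide_inverse)
      finally show ?thesis by simp
    qed
    ultimately have "v y s * exp (- Q) \<le> v x t" by (simp only: mult.assoc)
    then have "v y s \<le> exp Q * v x t" by (simp add: exp_minus field_simps)
    also have "\<dots> \<le> exp (C * (1 + e)) * v x t" using Q pos[of t x] st by (intro mult_right_mono) auto
    finally show ?thesis by (simp add: e_def)
  qed
  with C that show thesis by blast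
qed

end

section \<open>Harnack inequality for the Hamilton-Jacobi equation, all p \<ge> 2\<close>

context hamilton_jacobi begin

text \<open>The Cole-Hopf substitution: the rank-one part of the Hessian of \<open>exp u\<close> has
  trace exp u |\<nabla>u|^2, which is exactly the nonlinear term when p = 2.\<close>

lemma heat_exp:
  assumes "p = 2"
  shows "heat (\<lambda>x t. exp (u x t)) (\<lambda>x t. exp (u x t) * ut x t) (\<lambda>x t. exp (u x t) *\<^sub>R g x t)
    (\<lambda>x t h. exp (u x t) *\<^sub>R H x t h + (exp (u x t) * (g x t \<bullet> h)) *\<^sub>R g x t)"
proof
  fix t :: real and x assume t: "t < 0"
  show "((\<lambda>s. exp (u x s)) has_real_derivative exp (u x t) * ut x t) (at t)"
    by (rule DERIV_fun_exp[OF u_t[OF t]])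
  show ex: "((\<lambda>y. exp (u y t)) has_derivative (\<lambda>h. (exp (u x t) *\<^sub>R g x t) \<bullet> h)) (at x)"
    using has_derivative_exp[OF u_x[OF t, of x]] by (simp add: mult.commute)
  show "((\<lambda>y. exp (u y t) *\<^sub>R g y t) has_derivative
      (\<lambda>h. exp (u x t) *\<^sub>R H x t h + (exp (u x t) * (g x t \<bullet> h)) *\<^sub>R g x t)) (at x)"
    using has_derivative_scaleR[OF ex u_xx[OF t]] by simp
  have "(\<Sum>i\<in>Basis. (exp (u x t) *\<^sub>R H x t i + (exp (u x t) * (g x t \<bullet> i)) *\<^sub>R g x t) \<bullet> i)
    = exp (u x t) * ((\<Sum>i\<in>Basis. H x t i \<bullet> i) + (\<Sum>i\<in>Basis. (g x t \<bullet> i) * (g x t \<bullet> i)))"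
    by (simp add: inner_add_left sum.distrib sum_distrib_left distrib_left mult.assoc)
  also have "(\<Sum>i\<in>Basis. (g x t \<bullet> i) * (g x t \<bullet> i)) = norm (g x t) powr p"
    using assms by (simp add: euclidean_inner[symmetric] power2_norm_eq_inner)
  finally show "exp (u x t) * ut x t = (\<Sum>i\<in>Basis. (exp (u x t) *\<^sub>R H x t i + (exp (u x t) * (g x t \<bullet> i)) *\<^sub>R g x t) \<bullet> i)"
    using eq[OF t, of x] by simp
next
  show "continuous_on Qdom (\<lambda>z. exp (u (fst z) (snd z)))" by (intro continuous_on_exp u_cont)
  show "continuous_on Qdom (\<lambda>z. exp (u (fst z) (snd z)) * ut (fst z) (snd z))"
    by (intro continuous_on_mult continuous_on_exp u_cont ut_cont)
qed simp

lemma harnack: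
  obtains C where "0 \<le> C"
    "\<And>x y s t. s < t \<Longrightarrow> t < 0 \<Longrightarrow>
       u y s \<le> u x t + C * ((norm (x - y))\<^sup>2 + (t - s)) powr (p / (p - 1) / 2) * (t - s) powr (1 - p / (p - 1))"
proof (cases "p = 2")
  case True
  interpret v: heat "\<lambda>x t. exp (u x t)" "\<lambda>x t. exp (u x t) * ut x t" "\<lambda>x t. exp (u x t) *\<^sub>R g x t"
    "\<lambda>x t h. exp (u x t) *\<^sub>R H x t h + (exp (u x t) * (g x t \<bullet> h)) *\<^sub>R g x t"
    by (rule heat_exp[OF True])
  obtain C where C: "0 \<le> C"
    "\<And>x y s t. s < t \<Longrightarrow> t < 0 \<Longrightarrow> exp (u y s) \<le> exp (C * (1 + (norm (x - y))\<^sup>2 / (t - s))) * exp (u x t)"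
    using v.harnack by blast
  have "u y s \<le> u x t + C * ((norm (x - y))\<^sup>2 + (t - s)) powr (p / (p - 1) / 2) * (t - s) powr (1 - p / (p - 1))"
    if "s < t" "t < 0" for x y s t
  proof -
    have "exp (u y s) \<le> exp (C * (1 + (norm (x - y))\<^sup>2 / (t - s)) + u x t)"
      using C(2)[OF that, of y x] by (simp only: exp_add)
    then have "u y s \<le> u x t + C * (1 + (norm (x - y))\<^sup>2 / (t - s))" by simp
    \<comment> \<open>For p = 2 the exponents q/2 and 1 - q are 1 and -1.\<close>
    also have "C * (1 + (norm (x - y))\<^sup>2 / (t - s)) = C * ((norm (x - y))\<^sup>2 + (t - s)) * (1 / (t - s))"
      using that by (simp add: field_simps)
    finally show ?thesis using True that by (simp add: powr_minus_divide powr_one)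
  qed
  with C(1) show thesis by (rule that)
next
  case False
  define q where "q = p / (p - 1)"
  have q: "0 < q" "q < 2" using p False by (auto simp: q_def field_simps)
  define L where "L = (2 * real DIM('a) + 1) / (1 - q / 2)"
  have L: "L > 0" using q by (simp add: L_def add_nonneg_pos)
  define C where "C = (1 + L) * (1 + L) powr (q / 2)"
  have "u y s \<le> u x t + C * ((norm (x - y))\<^sup>2 + (t - s)) powr (q / 2) * (t - s) powr (1 - q)"
    if "s < t" "t < 0" for x y s t
  proof -
    have "u y s \<le> u x t + (1 + L) * ((norm (x - y))\<^sup>2 + L * (t - s)) powr (q/2) * (t - s) powr (1 - q)"
      using harnack_supercritical[of s t y x] p False that by (simp add: L_def q_def)
    also have "((norm (x - y))\<^sup>2 + L * (t - s)) powr (q/2) \<le> ((1 + L) * ((norm (x - y))\<^sup>2 + (t - s))) powr (q/2)"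
    proof (intro powr_mono2)
      show "(norm (x - y))\<^sup>2 + L * (t - s) \<le> (1 + L) * ((norm (x - y))\<^sup>2 + (t - s))"
      proof -
        have "(1 + L) * ((norm (x - y))\<^sup>2 + (t - s)) = (norm (x - y))\<^sup>2 + L * (t - s) + L * (norm (x - y))\<^sup>2 + (t - s)"
          by (simp add: algebra_simps)
        moreover have "L * (norm (x - y))\<^sup>2 \<ge> 0" using L by simp
        ultimately show ?thesis using that by linarith
      qed
    qed (use q L that in auto)
    also have "\<dots> = (1 + L) powr (q/2) * ((norm (x - y))\<^sup>2 + (t - s)) powr (q/2)"
      using L that by (intro powr_mult)
    finally show ?thesis using L by (simp add: C_def mult_ac mult_left_mono mult_right_mono)
  qed
  then show thesis using that[of C] L by (simp add: C_def q_def)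
qed

end

subsection \<open>Comparison of translates\<close>

text \<open>The term \<alpha>^(1-p) a^p equals \<alpha> (a/\<alpha>)^p, the perspective of the
  convex function z^p. A perspective is convex and homogeneous of degree one, hence
  subadditive.\<close>

lemma powr_perspective_subadditive:
  fixes a b \<alpha> \<beta> p :: real
  assumes "0 \<le> a" "0 \<le> b" "0 < \<alpha>" "0 < \<beta>" "1 \<le> p"
  shows "(\<alpha> + \<beta>) powr (1 - p) * (a + b) powr p \<le> \<alpha> powr (1 - p) * a powr p + \<beta> powr (1 - p) * b powr p"
proof (cases "a = 0 \<or> b = 0")
  case True
  have "(\<alpha> + \<beta>) powr (1 - p) \<le> \<beta> powr (1 - p)" "(\<alpha> + \<beta>) powr (1 - p) \<le> \<alpha> powr (1 - p)"
    using assms by (auto intro!: powr_mono2')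
  then have "(\<alpha> + \<beta>) powr (1 - p) * b powr p \<le> \<beta> powr (1 - p) * b powr p"
    "(\<alpha> + \<beta>) powr (1 - p) * a powr p \<le> \<alpha> powr (1 - p) * a powr p"
    by (simp_all only: mult_right_mono powr_ge_zero)
  then show ?thesis using True by auto
next
  case False
  define k where "k = \<alpha> + \<beta>"
  have k: "k > 0" using assms by (simp add: k_def)
  have *: "x * (y / x) powr p = x powr (1 - p) * y powr p" if "x > 0" "y \<ge> 0" for x y :: real
    using that by (simp add: powr_divide powr_diff)
  have "((1 - \<beta> / k) * (a / \<alpha>) + (\<beta> / k) * (b / \<beta>)) powr p \<le> (1 - \<beta> / k) * (a / \<alpha>) powr p + (\<beta> / k) * (b / \<beta>) powr p"
    using convex_onD[OF powr_convex[OF assms(5)], of "\<beta> / k" "a / \<alpha>" "b / \<beta>"] assms False k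
    by (simp add: k_def)
  moreover have "1 - \<beta> / k = \<alpha> / k" using k by (simp add: k_def field_simps)
  ultimately have "((a + b) / k) powr p \<le> \<alpha> / k * (a / \<alpha>) powr p + \<beta> / k * (b / \<beta>) powr p"
    using assms by (simp add: add_divide_distrib)
  then have "k * ((a + b) / k) powr p \<le> k * (\<alpha> / k * (a / \<alpha>) powr p + \<beta> / k * (b / \<beta>) powr p)"
    using k by (intro mult_left_mono) auto
  also have "\<dots> = \<alpha> * (a / \<alpha>) powr p + \<beta> * (b / \<beta>) powr p" using k by (simp add: distrib_left)
  finally show ?thesis using assms k by (simp add: * k_def[symmetric])
qed

text \<open>Of the weight 1 + \<delta>, the part 1 + \<delta>/2 goes to a and \<delta>/2 to b.
  Giving a more than 1 pushes its coefficient below 1, and the gap \<delta>/8 is what later absorbs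
  the drift.\<close>

lemma scaled_powr_sum_le:
  fixes a b \<delta> p :: real
  assumes "0 \<le> a" "0 \<le> b" "0 < \<delta>" "\<delta> \<le> 1" "2 \<le> p"
  shows "(1 + \<delta>) * ((a + b) / (1 + \<delta>)) powr p \<le> (1 - \<delta> / 8) * a powr p + (2 / \<delta>) powr (p - 1) * b powr p"
proof -
  have "(1 + \<delta>) * ((a + b) / (1 + \<delta>)) powr p = ((1 + \<delta> / 2) + \<delta> / 2) powr (1 - p) * (a + b) powr p"
    using assms by (simp add: powr_divide powr_diff add.commute)
  also have "\<dots> \<le> (1 + \<delta> / 2) powr (1 - p) * a powr p + (\<delta> / 2) powr (1 - p) * b powr p"
    using assms by (intro powr_perspective_subadditive) auto
  also have "\<dots> \<le> (1 - \<delta> / 8) * a powr p + (2 / \<delta>) powr (p - 1) * b powr p"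
  proof (intro add_mono mult_right_mono)
    have "(1 + \<delta> / 2) powr (1 - p) \<le> (1 + \<delta> / 2) powr (- 1)" using assms by (intro powr_mono) auto
    also have "\<dots> = 1 / (1 + \<delta> / 2)" using assms by (simp add: powr_minus_divide)
    also have "\<dots> \<le> 1 - \<delta> / 8"
    proof -
      have "\<delta> * \<delta> \<le> \<delta> * 1" using assms by (intro mult_left_mono) auto
      then have "1 \<le> (1 - \<delta> / 8) * (1 + \<delta> / 2)" using assms by (simp add: algebra_simps)
      then show ?thesis using assms by (simp add: pos_divide_le_eq)
    qed
    finally show "(1 + \<delta> / 2) powr (1 - p) \<le> 1 - \<delta> / 8" .
    have "(\<delta> / 2) powr (1 - p) = (2 / \<delta>) powr (p - 1)"
      using assms by (simp add: powr_divide powr_diff mult.commute)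
    then show "(\<delta> / 2) powr (1 - p) \<le> (2 / \<delta>) powr (p - 1)" by simp
  qed auto
  finally show ?thesis .
qed

text \<open>Young's inequality in threshold form: either x lies below the threshold, or the power
  already dominates. Used with exponent p for the drift and with exponent q for the linear growth
  \<epsilon>|x|.\<close>

lemma linear_le_powr_plus:
  fixes b c x p :: real
  assumes "0 \<le> x" "0 \<le> b" "0 < c" "1 < p"
  shows "b * x \<le> c * x powr p + b * (b / c) powr (1 / (p - 1))"
proof (cases "x \<le> (b / c) powr (1 / (p - 1))")
  case True
  then have "b * x \<le> b * (b / c) powr (1 / (p - 1))" using assms by (intro mult_left_mono) auto
  moreover have "c * x powr p \<ge> 0" using assms by simp
  ultimately show ?thesis by linarith
next
  case False
  then have "b / c \<le> x powr (p - 1)"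
  proof -
    have "((b / c) powr (1 / (p - 1))) powr (p - 1) \<le> x powr (p - 1)"
      using False assms by (intro powr_mono2) auto
    then show ?thesis using assms by (simp add: powr_powr)
  qed
  then have "b \<le> c * x powr (p - 1)" using assms by (simp add: field_simps)
  then have "b * x \<le> c * x powr (p - 1) * x" using assms by (intro mult_right_mono) auto
  also have "\<dots> = c * x powr p" using powr_mult_base[of x "p - 1"] assms by (simp add: mult_ac)
  finally have "b * x \<le> c * x powr p" .
  moreover have "b * (b / c) powr (1 / (p - 1)) \<ge> 0" using assms by simp
  ultimately show ?thesis by linarith
qed

text \<open>Because (q - 1) p = q, the p-th power of the gradient of the profile K S^(q/2) is at
  most a multiple of the profile itself, so exponential growth in time can absorb it.\<close>

lemma power_profile_gradient_le:
  fixes K S r p :: real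
  assumes "2 \<le> p" "0 < S" "0 \<le> r" "r \<le> S" "0 < K"
  defines "q \<equiv> p / (p - 1)"
  shows "(2 * (K * (q / 2) * S powr (q / 2 - 1)) * sqrt r) powr p \<le> 2 * (2 * K) powr (p - 1) * (K * S powr (q / 2))"
proof -
  have q: "0 < q" "q \<le> 2" "(q - 1) * p = q" using assms(1) by (auto simp: q_def field_simps)
  have "2 * (K * (q / 2) * S powr (q / 2 - 1)) * sqrt r \<le> 2 * K * S powr ((q - 1) / 2)"
  proof -
    have "2 * (K * (q / 2) * S powr (q / 2 - 1)) * sqrt r \<le> (2 * (K * (2 / 2) * S powr (q / 2 - 1))) * sqrt S"
      using q assms by (intro mult_mono real_sqrt_le_mono) auto
    also have "\<dots> = 2 * K * (S powr (q / 2 - 1) * S powr (1 / 2))" using assms by (simp add: powr_half_sqrt)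
    also have "S powr (q / 2 - 1) * S powr (1 / 2) = S powr ((q - 1) / 2)"
      by (simp add: powr_add[symmetric] diff_divide_distrib)
    finally show ?thesis .
  qed
  then have "(2 * (K * (q / 2) * S powr (q / 2 - 1)) * sqrt r) powr p \<le> (2 * K * S powr ((q - 1) / 2)) powr p"
    using q assms by (intro powr_mono2) auto
  also have "\<dots> = (2 * K) powr p * S powr ((q - 1) / 2 * p)" using assms by (simp add: powr_mult powr_powr)
  also have "(q - 1) / 2 * p = q / 2" using q(3) by simp
  also have "(2 * K) powr p = 2 * K * (2 * K) powr (p - 1)" using powr_mult_base[of "2 * K" "p - 1"] assms by simp
  finally show ?thesis by (simp add: mult_ac)
qed

context hamilton_jacobi begin

text \<open>Compares \<open>(1+\<delta>) u(y,t)\<close> with \<open>u\<close> along the line from \<open>(y, s-T)\<close> to \<open>(y+h, s)\<close>; the constant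
  \<open>a\<close> is what remains of the drift after absorption into \<open>\<delta>/8 |\<nabla>u|^p\<close>.\<close>

lemma translation_comparison:
  fixes z h :: 'a
  assumes "s < 0" "0 < T" "0 < \<delta>" "\<delta> \<le> 1" "0 < \<kappa>"
  defines "q \<equiv> p / (p - 1)" and "B \<equiv> 2 * real DIM('a) + 1"
  defines "a \<equiv> norm h / T * (8 * (norm h / T) / \<delta>) powr (1 / (p - 1))"
  assumes small: "2 * (4 * \<kappa> * exp B) powr (p - 1) * T < 1"
    and init: "\<And>y. norm (y - z) \<le> R \<Longrightarrow> u y (s - T) \<le> M + \<kappa> * (T + (norm (y - z))\<^sup>2) powr (q / 2)"
    and lat: "\<And>y t. norm (y - z) = R \<Longrightarrow> s - T \<le> t \<Longrightarrow> t \<le> s \<Longrightarrow>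
      (1 + \<delta>) * u y t - u (y + ((t - (s - T)) / T) *\<^sub>R h) t \<le> \<delta> * M + \<delta> * \<kappa> * (T + R\<^sup>2) powr (q / 2)"
    and y: "norm (y - z) \<le> R"
  shows "(1 + \<delta>) * u y s - u (y + h) s \<le> \<delta> * M + \<delta> * \<kappa> * exp B * (T + (norm (y - z))\<^sup>2) powr (q / 2) + a * T"
proof -
  define t1 where "t1 = s - T"
  define n where "n = real DIM('a)"
  define b where "b t = ((t - t1) / T) *\<^sub>R h" for t
  \<comment> \<open>The rate B/T with B = 2 n + 1 supplies 2 n/T for the Laplacian of \<Psi> and 1/T
    for the p-th power of its gradient, yet over the whole time T it multiplies the profile only by
    exp B.\<close>
  define K where "K t = \<delta> * \<kappa> * exp (B / T * (t - t1))" for t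
  define \<Psi> where "\<Psi> r t = K t * (r + T) powr (q / 2)" for r t
  define \<Psi>r where "\<Psi>r r t = K t * (q / 2) * (r + T) powr (q / 2 - 1)" for r t
  define \<Psi>rr where "\<Psi>rr r t = K t * (q / 2) * (q / 2 - 1) * (r + T) powr (q / 2 - 2)" for r t
  have q: "0 < q" "q \<le> 2" using p by (auto simp: q_def field_simps)
  have n: "n \<ge> 1" using DIM_positive[where 'a='a] by (simp add: n_def Suc_leI)
  have K0: "K t > 0" for t using assms(3,5) by (simp add: K_def)
  have a0: "a \<ge> 0" using assms(2,3) by (simp add: a_def)
  have Kt: "(K has_real_derivative B / T * K t) (at t)" for t
    unfolding K_def using assms(2) by (auto intro!: derivative_eq_intros)
  have b': "((\<lambda>t. y + b t) has_vector_derivative (1/T) *\<^sub>R h) (at t)" for y t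
    unfolding b_def has_vector_derivative_def
    by (auto intro!: derivative_eq_intros simp: divide_inverse)
  have sq: "(norm (y - z))\<^sup>2 + T > 0" for y using assms(2) by (simp add: add_nonneg_pos)
  have K1: "\<delta> * \<kappa> \<le> K t" if "t1 \<le> t" for t
    using that assms(2,3,5) by (simp add: K_def B_def)
  have "(1 + \<delta>) * u y s - u (y + b s) s - \<Psi> ((norm (y - z))\<^sup>2) s - (\<delta> * M + a * (s - t1)) \<le> 0"
  proof (rule parabolic_max_principle[where a = t1 and b = s and c = z and R = R
       and f = "\<lambda>y t. (1 + \<delta>) * u y t - u (y + b t) t - \<Psi> ((norm (y - z))\<^sup>2) t - (\<delta> * M + a * (t - t1))"
       and ft = "\<lambda>y t. (1 + \<delta>) * ut y t - (ut (y + b t) t + g (y + b t) t \<bullet> ((1/T) *\<^sub>R h)) - B / T * \<Psi> ((norm (y - z))\<^sup>2) t - a"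
       and g = "\<lambda>y t. (1 + \<delta>) *\<^sub>R g y t - g (y + b t) t - (2 * \<Psi>r ((norm (y - z))\<^sup>2) t) *\<^sub>R (y - z)"
       and H = "\<lambda>y t k. (1 + \<delta>) *\<^sub>R H y t k - H (y + b t) t k
          - ((2 * \<Psi>r ((norm (y - z))\<^sup>2) t) *\<^sub>R k + (4 * \<Psi>rr ((norm (y - z))\<^sup>2) t * ((y - z) \<bullet> k)) *\<^sub>R (y - z))"])
    show "continuous_on (cball z R \<times> {t1..s}) (\<lambda>w. (1 + \<delta>) * u (fst w) (snd w) - u (fst w + b (snd w)) (snd w)
        - \<Psi> ((norm (fst w - z))\<^sup>2) (snd w) - (\<delta> * M + a * (snd w - t1)))"
      unfolding b_def \<Psi>_def K_def by (intro continuous_intros) (use assms(1,2) less_imp_neq[OF sq, symmetric] in auto)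
  next
    fix y t assume yt: "y \<in> ball z R" "t1 < t" "t \<le> s"
    have t0: "t < 0" using yt assms by simp
    define r where "r = (norm (y - z))\<^sup>2"
    have r: "r \<ge> 0" "r + T > 0" using sq[of y] by (auto simp: r_def)
    have dr: "((\<lambda>r. \<Psi> r t) has_real_derivative \<Psi>r r t) (at r)"
      unfolding \<Psi>_def \<Psi>r_def
      by (rule DERIV_cong[OF DERIV_cmult[OF DERIV_powr_shift[OF r(2)]]]) simp
    have drr: "((\<lambda>r. \<Psi>r r t) has_real_derivative \<Psi>rr r t) (at r)"
      unfolding \<Psi>rr_def \<Psi>r_def
      by (rule DERIV_cong[OF DERIV_cmult[OF DERIV_powr_shift[OF r(2)]]]) simp
    show "((\<lambda>t. (1 + \<delta>) * u y t - u (y + b t) t - \<Psi> ((norm (y - z))\<^sup>2) t - (\<delta> * M + a * (t - t1))) has_real_derivative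
      (1 + \<delta>) * ut y t - (ut (y + b t) t + g (y + b t) t \<bullet> ((1/T) *\<^sub>R h)) - B / T * \<Psi> ((norm (y - z))\<^sup>2) t - a) (at t)"
    proof -
      have d1: "(\<Psi> ((norm (y - z))\<^sup>2) has_real_derivative B / T * \<Psi> ((norm (y - z))\<^sup>2) t) (at t)"
        unfolding \<Psi>_def[abs_def] by (rule DERIV_cong[OF DERIV_cmult_right[OF Kt]]) simp
      have d2: "((\<lambda>t. \<delta> * M + a * (t - t1)) has_real_derivative a) (at t)"
        by (auto intro!: derivative_eq_intros)
      show ?thesis
        by (rule DERIV_diff[OF DERIV_diff[OF DERIV_diff[OF DERIV_cmult[OF u_t[OF t0]] u_path[OF t0 b']] d1] d2])
    qed
    show "((\<lambda>y. (1 + \<delta>) * u y t - u (y + b t) t - \<Psi> ((norm (y - z))\<^sup>2) t - (\<delta> * M + a * (t - t1))) has_derivative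
      (\<lambda>k. ((1 + \<delta>) *\<^sub>R g y t - g (y + b t) t - (2 * \<Psi>r ((norm (y - z))\<^sup>2) t) *\<^sub>R (y - z)) \<bullet> k)) (at y)"
    proof -
      have d: "((\<lambda>y. \<Psi> ((norm (y - z))\<^sup>2) t) has_derivative (\<lambda>k. ((2 * \<Psi>r ((norm (y - z))\<^sup>2) t) *\<^sub>R (y - z)) \<bullet> k)) (at y)"
        by (rule radial_has_derivative[where G = "\<lambda>r. \<Psi> r t" and G' = "\<lambda>r. \<Psi>r r t"]) (use dr in \<open>simp add: r_def\<close>)
      have "((\<lambda>y. (1 + \<delta>) * u y t) has_derivative (\<lambda>k. ((1 + \<delta>) *\<^sub>R g y t) \<bullet> k)) (at y)"
        using has_derivative_mult_right[OF u_x[OF t0, of y], of "1 + \<delta>"] by simp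
      from has_derivative_diff[OF has_derivative_diff[OF has_derivative_diff[OF this has_derivative_shift[OF u_x[OF t0]]] d] has_derivative_const[of "\<delta> * M + a * (t - t1)"]]
      show ?thesis by (simp only: inner_diff_left diff_0_right)
    qed
    show "((\<lambda>y. (1 + \<delta>) *\<^sub>R g y t - g (y + b t) t - (2 * \<Psi>r ((norm (y - z))\<^sup>2) t) *\<^sub>R (y - z)) has_derivative
      (\<lambda>k. (1 + \<delta>) *\<^sub>R H y t k - H (y + b t) t k
          - ((2 * \<Psi>r ((norm (y - z))\<^sup>2) t) *\<^sub>R k + (4 * \<Psi>rr ((norm (y - z))\<^sup>2) t * ((y - z) \<bullet> k)) *\<^sub>R (y - z)))) (at y)"
      by (intro has_derivative_diff has_derivative_scaleR_right u_xx[OF t0] has_derivative_shift[OF u_xx[OF t0]]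
           radial_gradient_has_derivative[where G' = "\<lambda>r. \<Psi>r r t" and G'' = "\<lambda>r. \<Psi>rr r t"])
         (use drr in \<open>simp add: r_def\<close>)
    define X where "X = g y t"
    define Y where "Y = g (y + b t) t"
    define Z where "Z = (2 * \<Psi>r r t) *\<^sub>R (y - z)"
    assume 0: "(1 + \<delta>) *\<^sub>R g y t - g (y + b t) t - (2 * \<Psi>r ((norm (y - z))\<^sup>2) t) *\<^sub>R (y - z) = 0"
      and L: "(\<Sum>i\<in>Basis. ((1 + \<delta>) *\<^sub>R H y t i - H (y + b t) t i
          - ((2 * \<Psi>r ((norm (y - z))\<^sup>2) t) *\<^sub>R i + (4 * \<Psi>rr ((norm (y - z))\<^sup>2) t * ((y - z) \<bullet> i)) *\<^sub>R (y - z))) \<bullet> i) \<le> 0"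
      and T: "0 \<le> (1 + \<delta>) * ut y t - (ut (y + b t) t + g (y + b t) t \<bullet> ((1/T) *\<^sub>R h)) - B / T * \<Psi> ((norm (y - z))\<^sup>2) t - a"
    have lap: "(1 + \<delta>) * (\<Sum>i\<in>Basis. H y t i \<bullet> i) - (\<Sum>i\<in>Basis. H (y + b t) t i \<bullet> i)
       - (2 * n * \<Psi>r r t + 4 * r * \<Psi>rr r t) \<le> 0"
      using L by (simp only: inner_diff_left sum_subtractf radial_laplacian[unfolded inner_diff_left]
          inner_scaleR_left sum_distrib_left[symmetric] r_def[symmetric] n_def[symmetric])
    have utd: "(1 + \<delta>) * ut y t - ut (y + b t) t = (1 + \<delta>) * (\<Sum>i\<in>Basis. H y t i \<bullet> i) - (\<Sum>i\<in>Basis. H (y + b t) t i \<bullet> i)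
       + (1 + \<delta>) * norm X powr p - norm Y powr p"
      unfolding eq[OF t0] X_def Y_def by (simp add: algebra_simps)
    \<comment> \<open>Vanishing of the total gradient ties X to Y and Z. The convexity estimate then
      saves \<delta>/8 |Y|^p, to be spent on the drift.\<close>
    have "(1 + \<delta>) *\<^sub>R X = Y + Z" using 0 by (simp add: X_def Y_def Z_def r_def algebra_simps)
    then have "(1 + \<delta>) * norm X = norm (Y + Z)" using assms(3)
      by (metis abs_of_pos add_pos_pos norm_scaleR zero_less_one)
    then have "norm X = norm (Y + Z) / (1 + \<delta>)" using assms(3) by (simp add: field_simps)
    also have "\<dots> \<le> (norm Y + norm Z) / (1 + \<delta>)" using assms(3) by (intro divide_right_mono norm_triangle_ineq) auto
    finally have "(1 + \<delta>) * norm X powr p \<le> (1 + \<delta>) * ((norm Y + norm Z) / (1 + \<delta>)) powr p"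
      using assms(3) p by (intro mult_left_mono powr_mono2) auto
    also have "\<dots> \<le> (1 - \<delta> / 8) * norm Y powr p + (2 / \<delta>) powr (p - 1) * norm Z powr p"
      using assms(3,4) p by (intro scaled_powr_sum_le) auto
    finally have Xp: "(1 + \<delta>) * norm X powr p \<le> norm Y powr p - \<delta> / 8 * norm Y powr p + (2 / \<delta>) powr (p - 1) * norm Z powr p"
      by (simp add: algebra_simps)
    have Yh: "- (Y \<bullet> ((1/T) *\<^sub>R h)) \<le> \<delta> / 8 * norm Y powr p + a"
    proof -
      have "- (Y \<bullet> h) \<le> norm Y * norm h" using norm_cauchy_schwarz[of "- Y" h] by simp
      then have "- (Y \<bullet> h) / T \<le> norm Y * norm h / T" using assms(2) by (intro divide_right_mono) auto
      then have "- (Y \<bullet> ((1/T) *\<^sub>R h)) \<le> norm h / T * norm Y" by (simp add: mult.commute)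
      also have "\<dots> \<le> \<delta> / 8 * norm Y powr p + norm h / T * ((norm h / T) / (\<delta> / 8)) powr (1 / (p - 1))"
        using assms(2,3) p by (intro linear_le_powr_plus) auto
      finally show ?thesis by (simp add: a_def mult_ac)
    qed
    have Zp: "(2 / \<delta>) powr (p - 1) * norm Z powr p < \<Psi> r t / T"
    proof -
      have nz: "norm Z = 2 * (K t * (q / 2) * (r + T) powr (q / 2 - 1)) * sqrt r"
        unfolding Z_def \<Psi>r_def r_def using K0[of t] q by (simp add: abs_mult)
      have "norm Z powr p \<le> 2 * (2 * K t) powr (p - 1) * (K t * (r + T) powr (q / 2))"
        unfolding nz q_def using p r K0 assms(2) by (intro power_profile_gradient_le) auto
      then have "norm Z powr p \<le> 2 * (2 * K t) powr (p - 1) * \<Psi> r t" by (simp add: \<Psi>_def)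
      then have "(2 / \<delta>) powr (p - 1) * norm Z powr p \<le> (2 / \<delta>) powr (p - 1) * (2 * (2 * K t) powr (p - 1) * \<Psi> r t)"
        by (intro mult_left_mono) auto
      also have "\<dots> = 2 * ((2 / \<delta>) powr (p - 1) * (2 * K t) powr (p - 1)) * \<Psi> r t"
        by (simp only: mult_ac)
      also have "(2 / \<delta>) powr (p - 1) * (2 * K t) powr (p - 1) = ((2 / \<delta>) * (2 * K t)) powr (p - 1)"
        by (rule powr_mult[symmetric])
      also have "(2 / \<delta>) * (2 * K t) = 4 * \<kappa> * exp (B / T * (t - t1))" using assms(3) by (simp add: K_def)
      also have "2 * (4 * \<kappa> * exp (B / T * (t - t1))) powr (p - 1) * \<Psi> r t \<le> 2 * (4 * \<kappa> * exp B) powr (p - 1) * \<Psi> r t"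
      proof (intro mult_right_mono mult_left_mono powr_mono2)
        have "B / T * (t - t1) \<le> B / T * T"
          using yt assms(2) by (intro mult_left_mono) (auto simp: t1_def B_def)
        then show "exp (B / T * (t - t1)) \<le> exp B" using assms(2) by simp
        show "0 \<le> \<Psi> r t" using K0[of t] by (simp add: \<Psi>_def)
      qed (use assms(5) p in auto)
      also have "\<dots> < 1 / T * \<Psi> r t"
        using small assms(2) K0[of t] r by (intro mult_strict_right_mono) (auto simp: \<Psi>_def field_simps)
      finally show ?thesis by simp
    qed
    have P1: "2 * n * \<Psi>r r t \<le> 2 * n / T * \<Psi> r t"
    proof -
      have "(r + T) powr (q / 2) = (r + T) * (r + T) powr (q / 2 - 1)"
        using powr_mult_base[of "r + T" "q / 2 - 1"] r by simp
      then have e: "\<Psi> r t = (r + T) * (K t * (r + T) powr (q / 2 - 1))" by (simp add: \<Psi>_def)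
      define w where "w = K t * (r + T) powr (q / 2 - 1)"
      have w: "w \<ge> 0" using K0[of t] by (simp add: w_def)
      have "\<Psi>r r t = q / 2 * w" by (simp add: \<Psi>r_def w_def)
      also have "\<dots> \<le> 1 * w" using w q by (intro mult_right_mono) auto
      also have "\<dots> \<le> (r + T) * w / T" using w r assms(2) by (simp add: field_simps)
      finally have "\<Psi>r r t \<le> \<Psi> r t / T" by (simp add: e w_def)
      then have "2 * n * \<Psi>r r t \<le> 2 * n * (\<Psi> r t / T)" using n by (intro mult_left_mono) auto
      then show ?thesis by simp
    qed
    have P2: "4 * r * \<Psi>rr r t \<le> 0"
    proof -
      have "K t * (q / 2) * (q / 2 - 1) \<le> 0" using K0[of t] q by (intro mult_nonneg_nonpos) auto
      then have "\<Psi>rr r t \<le> 0" unfolding \<Psi>rr_def by (rule mult_nonpos_nonneg) simp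
      then show ?thesis using r by (intro mult_nonneg_nonpos) auto
    qed
    have "B / T * \<Psi> r t = 2 * n / T * \<Psi> r t + \<Psi> r t / T" by (simp add: B_def n_def algebra_simps add_divide_distrib)
    then show False using T lap utd Xp Yh Zp P1 P2 unfolding r_def[symmetric] Y_def[symmetric] by linarith
  next
    \<comment> \<open>At the start the two points coincide, so only \<delta> u remains and an upper
      bound on u is enough.\<close>
    fix y assume "y \<in> cball z R"
    then have "u y t1 \<le> M + \<kappa> * (T + (norm (y - z))\<^sup>2) powr (q / 2)"
      using init[of y] by (simp add: t1_def dist_norm norm_minus_commute)
    then have "\<delta> * u y t1 \<le> \<delta> * (M + \<kappa> * (T + (norm (y - z))\<^sup>2) powr (q / 2))"
      using assms(3) by (intro mult_left_mono) auto
    then show "(1 + \<delta>) * u y t1 - u (y + b t1) t1 - \<Psi> ((norm (y - z))\<^sup>2) t1 - (\<delta> * M + a * (t1 - t1)) \<le> 0"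
      by (simp add: b_def \<Psi>_def K_def algebra_simps)
  next
    fix y t assume yt: "dist z y = R" "t1 \<le> t" "t \<le> s"
    have nR: "norm (y - z) = R" using yt(1) by (simp add: dist_norm norm_minus_commute)
    have "\<delta> * \<kappa> * (T + R\<^sup>2) powr (q / 2) \<le> \<Psi> ((norm (y - z))\<^sup>2) t"
      unfolding \<Psi>_def nR add.commute[of T] using K1[OF yt(2)] by (rule mult_right_mono) simp
    moreover have "a * (t - t1) \<ge> 0" using a0 yt by simp
    ultimately show "(1 + \<delta>) * u y t - u (y + b t) t - \<Psi> ((norm (y - z))\<^sup>2) t - (\<delta> * M + a * (t - t1)) \<le> 0"
      using lat[OF nR, of t] yt by (simp add: t1_def b_def)
  qed (use y assms in \<open>auto simp: t1_def dist_norm norm_minus_commute\<close>)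
  moreover have "\<Psi> ((norm (y - z))\<^sup>2) s = \<delta> * \<kappa> * exp B * (T + (norm (y - z))\<^sup>2) powr (q / 2)"
    using assms(2) by (simp add: \<Psi>_def K_def t1_def add.commute)
  moreover have "b s = h" using assms(2) by (simp add: b_def t1_def)
  ultimately show ?thesis by (simp add: t1_def)
qed

section \<open>Growth bounds from the hypothesis at t0, and the translation defect\<close>

lemma sublinear_global_bound:
  assumes "t < 0" "\<forall>\<epsilon>>0. \<exists>R>0. \<forall>x. norm x \<ge> R \<longrightarrow> u x t \<le> \<epsilon> * norm x" "0 < \<epsilon>"
  obtains A where "\<And>x. u x t \<le> A + \<epsilon> * norm x"
proof -
  obtain R where R: "\<And>x. norm x \<ge> R \<Longrightarrow> u x t \<le> \<epsilon> * norm x" using assms by blast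
  have "compact ((\<lambda>x. u x t) ` cball 0 R)"
    using assms(1) by (intro compact_continuous_image continuous_intros) auto
  then have "bounded ((\<lambda>x. u x t) ` cball 0 R)" by (rule compact_imp_bounded)
  then obtain B where B: "\<forall>y\<in>(\<lambda>x. u x t) ` cball 0 R. norm y \<le> B" unfolding bounded_iff by blast
  have "u x t \<le> \<bar>B\<bar> + \<epsilon> * norm x" for x
  proof (cases "norm x \<ge> R")
    case True
    then show ?thesis using R[of x] by simp
  next
    case False
    then have "\<bar>u x t\<bar> \<le> B" using B by auto
    moreover have "\<epsilon> * norm x \<ge> 0" using assms by simp
    ultimately show ?thesis by linarith
  qed
  then show thesis by (rule that)
qed

text \<open>The first term grows at most linearly in R, since Harnack with equal space points passes
  from t0 to earlier times at bounded cost. The second is bounded by Harnack from a very early time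
  at the origin, which gives a small multiple of R^q. As q > 1, the allowance \<delta> \<kappa> R^q
  wins.\<close>

lemma translation_lateral_eventually:
  fixes h :: 'a
  assumes "s < t0" "t0 < 0" "0 < T" "0 < \<delta>" "0 < \<kappa>" "0 < \<epsilon>"
    and A: "\<And>y. u y t0 \<le> A + \<epsilon> * norm y"
  defines "q \<equiv> p / (p - 1)"
  shows "eventually (\<lambda>R. \<forall>y t. norm y = R \<longrightarrow> s - T \<le> t \<longrightarrow> t \<le> s \<longrightarrow>
    (1 + \<delta>) * u y t - u (y + ((t - (s - T)) / T) *\<^sub>R h) t \<le> \<delta> * M + \<delta> * \<kappa> * (T + R\<^sup>2) powr (q / 2)) at_top"
proof -
  have q: "1 < q" "q \<le> 2" using p by (auto simp: q_def field_simps)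
  obtain C where C: "0 \<le> C" "\<And>x y s t. s < t \<Longrightarrow> t < 0 \<Longrightarrow>
       u y s \<le> u x t + C * ((norm (x - y))\<^sup>2 + (t - s)) powr (q / 2) * (t - s) powr (1 - q)"
    using harnack unfolding q_def by blast
  define D where "D = t0 - (s - T)"
  have up: "u y t \<le> A + \<epsilon> * norm y + C * D powr (1 - q / 2)" if "s - T \<le> t" "t \<le> s" for y t
  proof -
    have "u y t \<le> u y t0 + C * (t0 - t) powr (q / 2) * (t0 - t) powr (1 - q)"
      using C(2)[of t t0 y y] that assms(1-6) by simp
    also have "C * (t0 - t) powr (q / 2) * (t0 - t) powr (1 - q) = C * (t0 - t) powr (1 - q / 2)"
      by (simp add: powr_add[symmetric] mult.assoc)
    also have "\<dots> \<le> C * D powr (1 - q / 2)"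
      using that assms(1-6) q C by (intro mult_left_mono powr_mono2) (auto simp: D_def)
    finally show ?thesis using A[of y] by simp
  qed
  \<comment> \<open>A long waiting time S brings the coefficient below \<delta> \<kappa>/8.
    Replacing |w|^2 + T + S by 4 (T + R^2) costs at most a factor 4, which leaves \<delta>
    \<kappa>/2 for the linear terms.\<close>
  have "((\<lambda>S. C * S powr (1 - q)) \<longlongrightarrow> 0) at_top" using q by real_asymp
  then have "eventually (\<lambda>S. C * S powr (1 - q) < \<delta> * \<kappa> / 8) at_top"
    using assms(1-6) by (intro order_tendstoD) auto
  then have "eventually (\<lambda>S. C * S powr (1 - q) < \<delta> * \<kappa> / 8 \<and> 0 < S) at_top"
    using eventually_gt_at_top[of 0] by (rule eventually_conj)
  then obtain S where S: "C * S powr (1 - q) < \<delta> * \<kappa> / 8" "0 < S"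
    using eventually_happens'[OF trivial_limit_at_top_linorder] by blast
  define s' where "s' = s - T - S"
  have low: "- u w t \<le> - u 0 s' + \<delta> * \<kappa> / 8 * ((norm w)\<^sup>2 + T + S) powr (q / 2)" if "s - T \<le> t" "t \<le> s" for w t
  proof -
    have "u 0 s' \<le> u w t + C * ((norm w)\<^sup>2 + (t - s')) powr (q / 2) * (t - s') powr (1 - q)"
      using C(2)[of s' t 0 w] that assms(1-6) S by (simp add: s'_def)
    also have "C * ((norm w)\<^sup>2 + (t - s')) powr (q / 2) * (t - s') powr (1 - q)
      \<le> C * ((norm w)\<^sup>2 + T + S) powr (q / 2) * S powr (1 - q)"
      using that assms(1-6) S C q by (intro mult_mono mult_left_mono powr_mono2 powr_mono2') (auto simp: s'_def)
    also have "\<dots> = C * S powr (1 - q) * ((norm w)\<^sup>2 + T + S) powr (q / 2)" by (simp add: mult_ac)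
    also have "\<dots> \<le> \<delta> * \<kappa> / 8 * ((norm w)\<^sup>2 + T + S) powr (q / 2)" using S by (intro mult_right_mono) auto
    finally show ?thesis by simp
  qed
  have "eventually (\<lambda>R. (R + norm h)\<^sup>2 + T + S \<le> 4 * (T + R\<^sup>2)) at_top" by real_asymp
  moreover have "eventually (\<lambda>R. (1 + \<delta>) * (A + C * D powr (1 - q / 2) + \<epsilon> * R) + (- u 0 s' - \<delta> * M)
      \<le> (\<delta> * \<kappa> / 2) * (T + R\<^sup>2) powr (q / 2)) at_top"
    using q assms(4-6) mult_pos_pos[OF assms(4,5)] by real_asymp
  ultimately show ?thesis
  proof eventually_elim
    case (elim R)
    show ?case
    proof (intro allI impI)
      fix y :: 'a and t assume y: "norm y = R" "s - T \<le> t" "t \<le> s"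
      define w where "w = y + ((t - (s - T)) / T) *\<^sub>R h"
      have "norm w \<le> norm y + norm (((t - (s - T)) / T) *\<^sub>R h)" unfolding w_def by (rule norm_triangle_ineq)
      also have "norm (((t - (s - T)) / T) *\<^sub>R h) \<le> 1 * norm h"
        unfolding norm_scaleR using y assms(1-6) by (intro mult_right_mono) auto
      finally have "norm w \<le> R + norm h" using y by simp
      then have "(norm w)\<^sup>2 + T + S \<le> (R + norm h)\<^sup>2 + T + S" by (simp add: power_mono)
      also note elim(1)
      finally have "((norm w)\<^sup>2 + T + S) powr (q / 2) \<le> (4 * (T + R\<^sup>2)) powr (q / 2)"
        using q assms(1-6) S by (intro powr_mono2) auto
      also have "\<dots> = 4 powr (q / 2) * (T + R\<^sup>2) powr (q / 2)" by (rule powr_mult)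
      also have "\<dots> \<le> 4 powr 1 * (T + R\<^sup>2) powr (q / 2)" using q by (intro mult_right_mono powr_mono) auto
      finally have "\<delta> * \<kappa> / 8 * ((norm w)\<^sup>2 + T + S) powr (q / 2) \<le> \<delta> * \<kappa> / 8 * (4 * (T + R\<^sup>2) powr (q / 2))"
        using assms(1-6) by (intro mult_left_mono) auto
      then have "- u w t \<le> - u 0 s' + \<delta> * \<kappa> / 2 * (T + R\<^sup>2) powr (q / 2)" using low[OF y(2,3), of w] by simp
      moreover have "(1 + \<delta>) * u y t \<le> (1 + \<delta>) * (A + C * D powr (1 - q / 2) + \<epsilon> * R)"
        using up[OF y(2,3), of y] y(1) assms(1-6) by (intro mult_left_mono) auto
      ultimately show "(1 + \<delta>) * u y t - u (y + ((t - (s - T)) / T) *\<^sub>R h) t \<le> \<delta> * M + \<delta> * \<kappa> * (T + R\<^sup>2) powr (q / 2)"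
        using elim(2) unfolding w_def[symmetric] by (simp add: algebra_simps)
    qed
  qed
qed

text \<open>The scaling is \<delta> = \<Lambda>/T with \<kappa> proportional to T^(1-q). Majorising
  \<epsilon>|x| by \<kappa>|x|^q costs \<epsilon> (\<epsilon>/\<kappa>)^(p-1), of order T because
  (q-1)(p-1) = 1; times \<delta> this is a multiple of \<Lambda> \<epsilon>^p without T. The
  accumulated drift is likewise free of T, and these two terms survive as T tends to
  infinity.\<close>

lemma translation_defect_le:
  fixes y h :: 'a
  assumes "s < t0" "t0 < 0" "0 < \<epsilon>" "0 < \<Lambda>"
    and A: "\<And>y. u y t0 \<le> A + \<epsilon> * norm y"
  defines "B \<equiv> 2 * real DIM('a) + 1"
  shows "u y s - u (y + h) s \<le> \<Lambda> * (\<epsilon> * (\<epsilon> / (exp (- B) / 16)) powr (p - 1))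
     + norm h * (8 * norm h / \<Lambda>) powr (1 / (p - 1))"
proof -
  define q where "q = p / (p - 1)"
  have q: "1 < q" "q \<le> 2" using p by (auto simp: q_def field_simps)
  have pq: "1 / (q - 1) = p - 1" "(1 - q) * (p - 1) = - 1" using p by (auto simp: q_def field_simps)
  \<comment> \<open>Gives 4 \<kappa> exp B = T^(1-q)/4, so the smallness condition becomes 2
    (1/4)^(p-1) < 1 for every T.\<close>
  define c where "c = exp (- B) / 16"
  have c: "c > 0" by (simp add: c_def)
  obtain C where C: "0 \<le> C" "\<And>x y s t. s < t \<Longrightarrow> t < 0 \<Longrightarrow>
       u y s \<le> u x t + C * ((norm (x - y))\<^sup>2 + (t - s)) powr (q / 2) * (t - s) powr (1 - q)"
    using harnack unfolding q_def by blast
  define D where "D = t0 - s"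
  have D: "D > 0" using assms(1-4) by (simp add: D_def)
  define K where "K = \<Lambda> * (\<epsilon> * (\<epsilon> / c) powr (p - 1)) + norm h * (8 * norm h / \<Lambda>) powr (1 / (p - 1))"
  \<comment> \<open>The Harnack cost is O(sqrt T) against the factor \<Lambda>/T, and the profile
    term decays like T^(-q/2).\<close>
  have "((\<lambda>T. \<Lambda> / T * (A + C * (T + D) powr (1/2)) + K + \<Lambda> / T * (c * T powr (1 - q)) * exp B * (T + (norm y)\<^sup>2) powr (q/2)) \<longlongrightarrow> K) at_top"
    using q D by real_asymp
  moreover have "((\<lambda>T. (1 + \<Lambda> / T) * u y s - u (y + h) s) \<longlongrightarrow> u y s - u (y + h) s) at_top"
    by real_asymp
  moreover have "eventually (\<lambda>T. (1 + \<Lambda> / T) * u y s - u (y + h) s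
      \<le> \<Lambda> / T * (A + C * (T + D) powr (1/2)) + K + \<Lambda> / T * (c * T powr (1 - q)) * exp B * (T + (norm y)\<^sup>2) powr (q/2)) at_top"
    using eventually_ge_at_top[of 1] eventually_ge_at_top[of \<Lambda>]
  proof eventually_elim
    case (elim T)
    define \<delta> where "\<delta> = \<Lambda> / T"
    define \<kappa> where "\<kappa> = c * T powr (1 - q)"
    have \<delta>: "0 < \<delta>" "\<delta> \<le> 1" using elim assms(1-4) by (auto simp: \<delta>_def)
    have \<kappa>: "\<kappa> > 0" using c elim by (simp add: \<kappa>_def)
    define M where "M = A + C * (T + D) powr (1/2) + \<epsilon> * (\<epsilon> / \<kappa>) powr (p - 1)"
    have small: "2 * (4 * \<kappa> * exp B) powr (p - 1) * T < 1"
    proof -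
      have "4 * \<kappa> * exp B = 1/4 * T powr (1 - q)" by (simp add: \<kappa>_def c_def exp_minus)
      then have "(4 * \<kappa> * exp B) powr (p - 1) = (1/4) powr (p - 1) * T powr (- 1)"
        by (simp only: powr_mult powr_powr pq(2))
      then have "2 * (4 * \<kappa> * exp B) powr (p - 1) * T = 2 * (1/4) powr (p - 1)"
        using elim by (simp add: powr_minus_divide)
      also have "(1/4::real) powr (p - 1) \<le> (1/4) powr 1" using p by (intro powr_mono') auto
      finally show ?thesis by simp
    qed
    obtain R where R: "norm y \<le> R" "\<forall>y t. norm y = R \<longrightarrow> s - T \<le> t \<longrightarrow> t \<le> s \<longrightarrow>
      (1 + \<delta>) * u y t - u (y + ((t - (s - T)) / T) *\<^sub>R h) t \<le> \<delta> * M + \<delta> * \<kappa> * (T + R\<^sup>2) powr (q / 2)"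
    proof -
      have "eventually (\<lambda>R. norm y \<le> R \<and> (\<forall>y t. norm y = R \<longrightarrow> s - T \<le> t \<longrightarrow> t \<le> s \<longrightarrow>
        (1 + \<delta>) * u y t - u (y + ((t - (s - T)) / T) *\<^sub>R h) t \<le> \<delta> * M + \<delta> * \<kappa> * (T + R\<^sup>2) powr (q / 2))) at_top"
        using translation_lateral_eventually[OF assms(1,2) _ \<delta>(1) \<kappa> assms(3) A, of T h M] elim
        by (intro eventually_conj eventually_ge_at_top) (auto simp: q_def)
      then show thesis using eventually_happens'[OF trivial_limit_at_top_linorder] that by blast
    qed
    have "(1 + \<delta>) * u y s - u (y + h) s \<le> \<delta> * M + \<delta> * \<kappa> * exp B * (T + (norm (y - 0))\<^sup>2) powr (q / 2)
       + norm h / T * (8 * (norm h / T) / \<delta>) powr (1 / (p - 1)) * T"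
      unfolding q_def B_def
    proof (rule translation_comparison)
      fix x :: 'a
      have "u x (s - T) \<le> u x t0 + C * (T + D) powr (q / 2) * (T + D) powr (1 - q)"
        using C(2)[of "s - T" t0 x x] elim assms(1-4) by (simp add: D_def algebra_simps)
      also have "C * (T + D) powr (q / 2) * (T + D) powr (1 - q) = C * (T + D) powr (1 - q / 2)"
        by (simp add: powr_add[symmetric] mult.assoc)
      also have "\<dots> \<le> C * (T + D) powr (1/2)" using C(1) q elim D by (intro mult_left_mono powr_mono) auto
      finally have 1: "u x (s - T) \<le> u x t0 + C * (T + D) powr (1/2)" by simp
      have "\<epsilon> * norm x \<le> \<kappa> * norm x powr q + \<epsilon> * (\<epsilon> / \<kappa>) powr (1 / (q - 1))"
        using assms(3) \<kappa> q by (intro linear_le_powr_plus) auto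
      also have "norm x powr q = ((norm x)\<^sup>2) powr (q / 2)"
      proof -
        have "norm x powr q = (norm x powr 2) powr (q / 2)" unfolding powr_powr by simp
        then show ?thesis by simp
      qed
      also have "\<dots> \<le> (T + (norm x)\<^sup>2) powr (q / 2)" using elim q by (intro powr_mono2) auto
      finally have "\<epsilon> * norm x \<le> \<kappa> * (T + (norm x)\<^sup>2) powr (q / 2) + \<epsilon> * (\<epsilon> / \<kappa>) powr (p - 1)"
        using \<kappa> by (simp add: pq(1) mult_left_mono)
      then show "u x (s - T) \<le> M + \<kappa> * (T + (norm (x - 0))\<^sup>2) powr (p / (p - 1) / 2)"
        using 1 A[of x] by (simp add: M_def q_def)
    next
      fix x :: 'a and t assume "norm (x - 0) = R" "s - T \<le> t" "t \<le> s"
      then show "(1 + \<delta>) * u x t - u (x + ((t - (s - T)) / T) *\<^sub>R h) t \<le> \<delta> * M + \<delta> * \<kappa> * (T + R\<^sup>2) powr (p / (p - 1) / 2)"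
        using R(2) by (simp add: q_def)
    qed (use small R(1) \<delta> \<kappa> assms(1-4) elim in \<open>auto simp: B_def\<close>)
    moreover have "norm h / T * (8 * (norm h / T) / \<delta>) powr (1 / (p - 1)) * T = norm h * (8 * norm h / \<Lambda>) powr (1 / (p - 1))"
      using elim assms(4) by (simp add: \<delta>_def)
    moreover have "\<delta> * (\<epsilon> * (\<epsilon> / \<kappa>) powr (p - 1)) = \<Lambda> * (\<epsilon> * (\<epsilon> / c) powr (p - 1))"
    proof -
      have "\<epsilon> / \<kappa> = \<epsilon> / c * T powr (q - 1)" using elim by (simp add: \<kappa>_def powr_diff)
      moreover have "(q - 1) * (p - 1) = 1" using pq(2) by (simp add: algebra_simps)
      ultimately have "(\<epsilon> / \<kappa>) powr (p - 1) = (\<epsilon> / c) powr (p - 1) * T"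
        using elim by (simp only: powr_mult powr_powr) simp
      then show ?thesis using elim by (simp add: \<delta>_def)
    qed
    moreover have "\<delta> * M = \<delta> * (A + C * (T + D) powr (1/2)) + \<delta> * (\<epsilon> * (\<epsilon> / \<kappa>) powr (p - 1))"
      by (simp add: M_def algebra_simps)
    ultimately show ?case by (simp add: K_def \<delta>_def \<kappa>_def)
  qed
  ultimately have "u y s - u (y + h) s \<le> K" by (rule tendsto_le[OF trivial_limit_at_top_linorder])
  then show ?thesis by (simp add: K_def c_def)
qed

section \<open>Constancy up to time t0\<close>

lemma liouville_space:
  fixes x y :: 'a
  assumes "s < t0" "t0 < 0" "\<forall>\<epsilon>>0. \<exists>R>0. \<forall>x. norm x \<ge> R \<longrightarrow> u x t0 \<le> \<epsilon> * norm x"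
  shows "u x s = u y s"
proof -
  have "u x s - u (x + h) s \<le> 0" for x h :: 'a
  proof -
    define c where "c = exp (- (2 * real DIM('a) + 1)) / 16"
    have c: "c > 0" by (simp add: c_def)
    \<comment> \<open>For fixed \<Lambda> the first summand is a multiple of \<Lambda> \<epsilon>^p,
      so \<epsilon> goes to 0 first. Here sublinear rather than linear growth is decisive.\<close>
    have le: "u x s - u (x + h) s \<le> norm h * (8 * norm h / \<Lambda>) powr (1 / (p - 1))" if "0 < \<Lambda>" for \<Lambda>
    proof (rule tendsto_lowerbound)
      show "((\<lambda>\<epsilon>. \<Lambda> * (\<epsilon> * (\<epsilon> / c) powr (p - 1)) + norm h * (8 * norm h / \<Lambda>) powr (1 / (p - 1)))
         \<longlongrightarrow> norm h * (8 * norm h / \<Lambda>) powr (1 / (p - 1))) (at_right 0)"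
        using p c by real_asymp
      show "eventually (\<lambda>\<epsilon>. u x s - u (x + h) s \<le> \<Lambda> * (\<epsilon> * (\<epsilon> / c) powr (p - 1)) + norm h * (8 * norm h / \<Lambda>) powr (1 / (p - 1))) (at_right 0)"
        using eventually_at_right_less[of 0]
      proof eventually_elim
        case (elim \<epsilon>)
        obtain A where "\<And>x. u x t0 \<le> A + \<epsilon> * norm x" using sublinear_global_bound[OF assms(2,3) elim] by blast
        from translation_defect_le[OF assms(1,2) elim that this] show ?case by (simp add: c_def)
      qed
    qed simp
    show ?thesis
    proof (cases "h = 0")
      case False
      show ?thesis
      proof (rule tendsto_lowerbound)
        show "((\<lambda>\<Lambda>. norm h * (8 * norm h / \<Lambda>) powr (1 / (p - 1))) \<longlongrightarrow> 0) at_top"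
          using p False zero_less_norm_iff[of h] by real_asymp
        show "eventually (\<lambda>\<Lambda>. u x s - u (x + h) s \<le> norm h * (8 * norm h / \<Lambda>) powr (1 / (p - 1))) at_top"
          using eventually_gt_at_top[of 0] by eventually_elim (rule le)
      qed simp
    qed simp
  qed
  from this[of x "y - x"] this[of y "x - y"] show ?thesis by simp
qed

text \<open>Harnack up to t0 requires a positive time gap, so spatial constancy comes strictly
  before t0. There the equation reduces to ut = 0, and continuity in time reaches t0 itself.\<close>

lemma liouville_before:
  assumes "t0 < 0" "\<forall>\<epsilon>>0. \<exists>R>0. \<forall>x. norm x \<ge> R \<longrightarrow> u x t0 \<le> \<epsilon> * norm x"
  shows "\<exists>c. \<forall>x t. t \<le> t0 \<longrightarrow> u x t = c"
proof -
  note space = liouville_space[OF _ assms]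
  have ut0: "ut x s = 0" if s: "s < t0" for x s
  proof -
    have s0: "s < 0" using s assms by simp
    have g0: "g y s = 0" for y
    proof -
      have "(\<lambda>y. u y s) = (\<lambda>_. u x s)" using space[OF s] by (intro ext)
      then have "((\<lambda>y. u y s) has_derivative (\<lambda>_. 0)) (at y)" by simp
      from has_derivative_unique[OF this u_x[OF s0]] have "g y s \<bullet> g y s = 0" by metis
      then show ?thesis by simp
    qed
    then have "((\<lambda>y. g y s) has_derivative (\<lambda>_. 0)) (at x)" by simp
    from has_derivative_unique[OF this u_xx[OF s0]] have "H x s = (\<lambda>_. 0)" by simp
    then show ?thesis using eq[OF s0, of x] g0 by simp
  qed
  have "u x s = u x t0" if "s < t0" for x s
  proof (rule DERIV_isconst_end[OF that, symmetric])
    show "continuous_on {s..t0} (u x)"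
      using assms by (intro continuous_on_u[where \<alpha> = "\<lambda>_. x" and \<beta> = "\<lambda>t. t"] continuous_intros) auto
    show "(u x has_real_derivative 0) (at s')" if "s < s'" "s' < t0" for s'
      using u_t[of s' x] ut0[of s' x] that assms by simp
  qed
  then have to_t0: "u x s = u x t0" if "s \<le> t0" for x s using that by (cases "s = t0") auto
  have "u x t0 = u 0 t0" for x
    using to_t0[of "t0 - 1" x] to_t0[of "t0 - 1" 0] space[of "t0 - 1" x 0] by simp
  with to_t0 have "\<forall>x t. t \<le> t0 \<longrightarrow> u x t = u 0 t0" by metis
  then show ?thesis by blast
qed

section \<open>Continuation of constancy to later times\<close>

lemma bounded_after_constant:
  assumes "t1 < 0"
  obtains \<delta> where "0 < \<delta>"
    "\<And>t' c. t' \<le> t1 \<Longrightarrow> (\<And>x. u x t' = c) \<Longrightarrow>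
       \<exists>B. \<forall>x t. t' \<le> t \<longrightarrow> t \<le> min t1 (t' + \<delta>) \<longrightarrow> u x t \<le> B"
proof -
  define q where "q = p / (p - 1)"
  have q: "1 < q" "q \<le> 2" using p by (auto simp: q_def field_simps)
  define n where "n = real DIM('a)"
  have n: "n \<ge> 0" by (simp add: n_def)
  obtain C0 where C0: "0 \<le> C0" "\<And>x y s t. s < t \<Longrightarrow> t < 0 \<Longrightarrow>
       u y s \<le> u x t + C0 * ((norm (x - y))\<^sup>2 + (t - s)) powr (q / 2) * (t - s) powr (1 - q)"
    using harnack unfolding q_def by blast
  \<comment> \<open>A fixed later time from which Harnack bounds u from above on all slices t \<le>
    t1: the gap is at least t2 - t1, so C does not depend on t'.\<close>
  define t2 where "t2 = t1 / 2"
  have t2: "t1 < t2" "t2 < 0" using assms by (auto simp: t2_def)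
  define C where "C = C0 * (t2 - t1) powr (1 - q)"
  have C: "C \<ge> 0" using C0 by (simp add: C_def)
  \<comment> \<open>Larger than the Harnack coefficient, so the barrier exceeds the Harnack bound on
    the lateral boundary once R is large.\<close>
  define L where "L = 2 * C + 1"
  have L: "L > 0" using C by (simp add: L_def)
  \<comment> \<open>A growth rate that beats the p-th power of the barrier's gradient as long as Q
    \<le> L exp 1, that is, during a time 1/k. It is built from C and p alone, which makes the time
    step independent of t'.\<close>
  define k where "k = 2 * (2 * (L * exp 1)) powr (p - 1) + 1"
  have k: "k > 0" unfolding k_def by (intro add_nonneg_pos) auto
  have "\<exists>B. \<forall>x t. t' \<le> t \<longrightarrow> t \<le> min t1 (t' + 1 / k) \<longrightarrow> u x t \<le> B"
    if t': "t' \<le> t1" and c: "\<And>x. u x t' = c" for t' c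
  proof (intro exI allI impI)
    fix z t assume t: "t' \<le> t" "t \<le> min t1 (t' + 1 / k)"
    define b where "b = min t1 (t' + 1 / k)"
    \<comment> \<open>The growth 2 n of S in time reproduces the first-order part 2 n Gr of the
      Laplacian.\<close>
    define S where "S r t = r + (1 + 2 * n * (t - t'))" for r t
    define Q where "Q t = L * exp (k * (t - t'))" for t
    define G where "G r t = Q t * S r t powr (q / 2)" for r t
    define Gr where "Gr r t = Q t * (q / 2) * S r t powr (q / 2 - 1)" for r t
    define Grr where "Grr r t = Q t * (q / 2) * (q / 2 - 1) * S r t powr (q / 2 - 2)" for r t
    define E where "E = t2 - t'"
    have S: "S r t > 0" "r \<le> S r t" if "0 \<le> r" "t' \<le> t" for r t
    proof -
      have "2 * n * (t - t') \<ge> 0" using that n by simp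
      then show "S r t > 0" "r \<le> S r t" using that by (simp_all add: S_def)
    qed
    have Q: "Q t > 0" "L \<le> Q t" if "t' \<le> t" for t using L k that by (auto simp: Q_def)
    have Qle: "Q t \<le> L * exp 1" if "t \<le> b" for t
    proof -
      have "k * (t - t') \<le> k * (1 / k)" using that k by (intro mult_left_mono) (auto simp: b_def)
      then show ?thesis using L k by (simp add: Q_def)
    qed
    have "eventually (\<lambda>R. u z t2 + C * (R\<^sup>2 + E) powr (q / 2) \<le> c + L * (R\<^sup>2 + 1) powr (q / 2)) at_top"
      using q C unfolding L_def by real_asymp
    with eventually_gt_at_top[of 0]
    have "eventually (\<lambda>R. 0 < R \<and> u z t2 + C * (R\<^sup>2 + E) powr (q / 2) \<le> c + L * (R\<^sup>2 + 1) powr (q / 2)) at_top"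
      by (rule eventually_conj)
    then obtain R where R: "0 < R" "u z t2 + C * (R\<^sup>2 + E) powr (q / 2) \<le> c + L * (R\<^sup>2 + 1) powr (q / 2)"
      using eventually_happens'[OF trivial_limit_at_top_linorder] by blast
    \<comment> \<open>The estimate is evaluated at the centre of the ball: R depends on z through
      u(z,t2), but the value of the barrier at its centre does not, so the bound is uniform in
      z.\<close>
    have "u z t \<le> c + G ((norm (z - z))\<^sup>2) t"
    proof (rule upper_barrier[where a = t' and b = b and R = R and Gr = Gr and Grr = Grr
          and Gt = "\<lambda>r t. k * G r t + 2 * n * Gr r t"])
      show "b < 0" using assms by (simp add: b_def)
      show "continuous_on ({0..R\<^sup>2} \<times> {t'..b}) (\<lambda>w. G (fst w) (snd w))"
        unfolding G_def Q_def S_def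
        by (intro continuous_intros) (use less_imp_neq[OF S(1), symmetric] in \<open>auto simp: S_def\<close>)
    next
      fix r t assume r: "0 \<le> r" "r < R\<^sup>2" "t' < t" "t \<le> b"
      have S0: "S r t > 0" using S r by simp
      show "(G r has_real_derivative k * G r t + 2 * n * Gr r t) (at t)"
      proof -
        have d1: "(Q has_real_derivative k * Q t) (at t)"
          unfolding Q_def[abs_def] by (auto intro!: derivative_eq_intros)
        have "0 < r + 1 + 2 * n * (t - t')" using S0 by (simp add: S_def)
        from DERIV_powr_affine[OF this, of "q / 2"]
        have d2: "((\<lambda>t. S r t powr (q / 2)) has_real_derivative q / 2 * (2 * n) * S r t powr (q / 2 - 1)) (at t)"
          by (simp add: S_def add.assoc)
        show ?thesis unfolding G_def[abs_def]
          by (rule DERIV_cong[OF DERIV_mult[OF d1 d2]]) (simp add: Gr_def)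
      qed
      have S0': "0 < r + (1 + 2 * n * (t - t'))" using S0 by (simp add: S_def)
      show "((\<lambda>r. G r t) has_real_derivative Gr r t) (at r)"
        unfolding G_def Gr_def S_def
        by (rule DERIV_cong[OF DERIV_cmult[OF DERIV_powr_shift[OF S0']]]) simp
      show "((\<lambda>r. Gr r t) has_real_derivative Grr r t) (at r)"
        unfolding Grr_def Gr_def S_def
        by (rule DERIV_cong[OF DERIV_cmult[OF DERIV_powr_shift[OF S0']]]) simp
      have Qt: "Q t > 0" "Q t \<le> L * exp 1" using Q Qle r by auto
      have "Q t * (q / 2) * (q / 2 - 1) \<le> 0" using Qt q by (intro mult_nonneg_nonpos) auto
      then have "Grr r t \<le> 0" unfolding Grr_def by (rule mult_nonpos_nonneg) simp
      then have "4 * r * Grr r t \<le> 0" using r by (intro mult_nonneg_nonpos) auto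
      moreover have "(2 * \<bar>Gr r t\<bar> * sqrt r) powr p < k * G r t"
      proof -
        have "\<bar>Gr r t\<bar> = Q t * (q / 2) * S r t powr (q / 2 - 1)" using Qt q by (simp add: Gr_def abs_mult)
        then have "(2 * \<bar>Gr r t\<bar> * sqrt r) powr p \<le> 2 * (2 * Q t) powr (p - 1) * G r t"
          unfolding G_def q_def using p S0 S(2) r Qt power_profile_gradient_le[of p "S r t" r "Q t"] by simp
        also have "\<dots> \<le> 2 * (2 * (L * exp 1)) powr (p - 1) * G r t"
          using Qt p by (intro mult_right_mono mult_left_mono powr_mono2) (auto simp: G_def)
        also have "\<dots> < k * G r t" unfolding k_def using Qt S0 by (intro mult_strict_right_mono) (auto simp: G_def)
        finally show ?thesis .
      qed
      ultimately show "2 * real DIM('a) * Gr r t + 4 * r * Grr r t + (2 * \<bar>Gr r t\<bar> * sqrt r) powr p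
          < k * G r t + 2 * n * Gr r t"
        unfolding n_def by linarith
    next
      fix x
      have "G ((norm (x - z))\<^sup>2) t' \<ge> 0" using Q(1)[of t'] by (simp add: G_def)
      then show "u x t' \<le> c + G ((norm (x - z))\<^sup>2) t'" using c by simp
    next
      fix x t assume x: "norm (x - z) = R" "t' \<le> t" "t \<le> b"
      have tt: "t \<le> t1" using x by (simp add: b_def)
      have "u x t \<le> u z t2 + C0 * (R\<^sup>2 + (t2 - t)) powr (q / 2) * (t2 - t) powr (1 - q)"
        using C0(2)[of t t2 x z] x(1) tt t2 by (simp add: norm_minus_commute)
      also have "\<dots> \<le> u z t2 + C0 * (R\<^sup>2 + E) powr (q / 2) * (t2 - t1) powr (1 - q)"
        using C0(1) x(2) tt t2 q by (intro add_left_mono mult_mono mult_left_mono powr_mono2 powr_mono2') (auto simp: E_def)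
      also have "\<dots> \<le> c + L * (R\<^sup>2 + 1) powr (q / 2)" using R(2) by (simp add: C_def mult_ac)
      also have "\<dots> \<le> c + G (R\<^sup>2) t"
        unfolding G_def using Q[OF x(2)] x n q L
        by (intro add_left_mono mult_mono powr_mono2) (auto simp: S_def)
      finally show "u x t \<le> c + G (R\<^sup>2) t" .
    qed (use t R in \<open>auto simp: b_def\<close>)
    also have "G ((norm (z - z))\<^sup>2) t \<le> L * exp 1 * (1 + 2 * n / k) powr (q / 2)"
    proof -
      have "t - t' \<le> 1 / k" using t by simp
      then have "2 * n * (t - t') \<le> 2 * n * (1 / k)" using n by (intro mult_left_mono) auto
      then show ?thesis unfolding G_def using Qle[of t] t n q L S(1)[of 0 t]
        by (intro mult_mono powr_mono2) (auto simp: b_def S_def)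
    qed
    finally show "u z t \<le> c + L * exp 1 * (1 + 2 * n / k) powr (q / 2)" by simp
  qed
  then show thesis using that[of "1 / k"] k by simp
qed

lemma constant_forward:
  assumes "t0 \<le> t1" "t1 < 0" "\<forall>x t. t \<le> t0 \<longrightarrow> u x t = c0"
  shows "\<exists>c. \<forall>x t. t \<le> t1 \<longrightarrow> u x t = c"
proof -
  obtain \<delta> where \<delta>: "0 < \<delta>" and bdd: "\<And>t' c. t' \<le> t1 \<Longrightarrow> (\<And>x. u x t' = c) \<Longrightarrow>
       \<exists>B. \<forall>x t. t' \<le> t \<longrightarrow> t \<le> min t1 (t' + \<delta>) \<longrightarrow> u x t \<le> B"
    using bounded_after_constant[OF assms(2)] by blast
  have "\<exists>c. \<forall>x t. t \<le> min t1 (t0 + real m * \<delta>) \<longrightarrow> u x t = c" for m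
  proof (induction m)
    case 0
    then show ?case using assms by auto
  next
    case (Suc m)
    define t' b where "t' = min t1 (t0 + real m * \<delta>)" and "b = min t1 (t0 + real (Suc m) * \<delta>)"
    have tb: "t' \<le> t1" "t' \<le> b" "b \<le> min t1 (t' + \<delta>)" using \<delta> by (auto simp: t'_def b_def algebra_simps)
    from Suc obtain c where "\<And>x. u x t' = c" unfolding t'_def by blast
    from bdd[OF tb(1) this] obtain B where B: "\<And>x. u x b \<le> B" using tb by blast
    have sub: "\<forall>\<epsilon>>0. \<exists>R>0. \<forall>x. norm x \<ge> R \<longrightarrow> u x b \<le> \<epsilon> * norm x"
    proof (intro allI impI)
      fix \<epsilon> :: real assume "\<epsilon> > 0"
      show "\<exists>R>0. \<forall>x. norm x \<ge> R \<longrightarrow> u x b \<le> \<epsilon> * norm x"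
      proof (intro exI[of _ "max 1 (B / \<epsilon>)"] conjI allI impI)
        fix x :: 'a assume "max 1 (B / \<epsilon>) \<le> norm x"
        then have "B \<le> \<epsilon> * norm x" using \<open>\<epsilon> > 0\<close> by (simp add: field_simps)
        then show "u x b \<le> \<epsilon> * norm x" using B[of x] by simp
      qed simp
    qed
    have "b < 0" using assms(2) by (simp add: b_def)
    from liouville_before[OF this sub] show ?case unfolding b_def .
  qed
  note step = this
  obtain m where "(t1 - t0) / \<delta> \<le> real m" using real_arch_simple by blast
  then have "min t1 (t0 + real m * \<delta>) = t1" using \<delta> by (simp add: field_simps)
  with step[of m] show ?thesis by simp
qed

end

theorem theorem2p1:
  fixes u :: "'a::euclidean_space \<Rightarrow> real \<Rightarrow> real" and p t0 :: real
  assumes "p \<ge> 2"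
    and "classical_solution p u"
    and "t0 < 0"
    and "\<forall>\<epsilon>>0. \<exists>R>0. \<forall>x. norm x \<ge> R \<longrightarrow> u x t0 \<le> \<epsilon> * norm x"
  shows "\<exists>c. \<forall>x t. t < 0 \<longrightarrow> u x t = c"
proof -
  from assms(2) obtain ut g H where sol: "\<forall>x t. t < 0 \<longrightarrow>
            ((\<lambda>s. u x s) has_real_derivative ut x t) (at t)
          \<and> ((\<lambda>y. u y t) has_derivative (\<lambda>h. g x t \<bullet> h)) (at x)
          \<and> ((\<lambda>y. g y t) has_derivative H x t) (at x)"
      "continuous_on Qdom (\<lambda>z. u (fst z) (snd z))" "continuous_on Qdom (\<lambda>z. ut (fst z) (snd z))"
      "\<forall>x t. t < 0 \<longrightarrow> ut x t - (\<Sum>i\<in>Basis. H x t i \<bullet> i) = norm (g x t) powr p"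
    unfolding classical_solution_def by (elim exE conjE) (rule that, assumption+)
  interpret hamilton_jacobi u ut g H p
  proof
    fix t :: real and x :: 'a assume "t < 0"
    then have "ut x t - (\<Sum>i\<in>Basis. H x t i \<bullet> i) = norm (g x t) powr p" using sol(4) by blast
    then show "ut x t = (\<Sum>i\<in>Basis. H x t i \<bullet> i) + norm (g x t) powr p" by simp
  qed (use sol assms(1) in blast)+
  obtain c0 where c0: "\<forall>x t. t \<le> t0 \<longrightarrow> u x t = c0" using liouville_before[OF assms(3,4)] by blast
  have "u x t = c0" if "t < 0" for x t
  proof -
    \<comment> \<open>Going up to \<open>max t t0\<close> puts t0 in the range of the new constant,
      which identifies it with c0.\<close>
    have "max t t0 < 0" using that assms(3) by simp
    from constant_forward[OF _ this c0] obtain c where c: "\<And>x s. s \<le> max t t0 \<Longrightarrow> u x s = c" by auto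
    from c[of t x] c[of t0 x] c0 show ?thesis by simp
  qed
  then show ?thesis by blast
qed

end
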